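(* Let $C=\bigcup_{j=1}^r C_j$ be a reduced curve with $r$ branches, embedded in $k^n$ by a surjection $k[[X_1,\dots,X_n]]\to\mathcal O$, $X_i\mapsto x_i$, where $x_1,\dots,x_n$ generate the maximal ideal of the local ring $\mathcal O$ of $C$. Let $y_1,\dots,y_m,y_{m+1},\dots,y_{m+r}$ be elements of the maximal ideal of $k[[X_1,\dots,X_n]]$ such that: (1) $y_1,\dots,y_m$ generate the maximal ideal of $k[[X_1,\dots,X_n]]$; (2) $y_1,\dots,y_m\notin I_{C_j}$ for $1\le j\le r$; (3) for each $1\le j\le r$ the numbers $\mathrm{ord}_{t_j}(y_s\circ\eta_{C_j})\in\mathbb Z_{>0}$, $s=1,\dots,m$, generate the group $\mathbb Z$; (4) $y_{m+j}\in\bigcap_{1\le i\le r,\ i\ne j} I_{C_i}$ and $y_{m+j}\notin I_{C_j}$, for $1\le j\le r$. Let $C\hookrightarrow k^{m+r}$ be the embedding defined by $y_1,\dots,y_{m+r}$. Then there exists a toric modification of $X_{\Sigma_{0,m+r}}=k^{m+r}$ which is a toric embedded resolution of $C$.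
   Context: $k$ is an algebraically closed field of arbitrary characteristic. A curve is $\mathrm{Spec}\,\mathcal O$ with $\mathcal O$ a complete Noetherian local ring of dimension one over $k$ with residue field $k$; it is reduced if $\mathcal O$ is reduced and a branch if $\mathcal O$ is a domain. The branches $C_j$ of a reduced curve correspond to the minimal primes of $\mathcal O$. If $C\subset k^n$ is embedded as in the claim, $I_{C_j}\subset k[[X_1,\dots,X_n]]$ is the defining prime ideal of $C_j$, and $\eta_{C_j}\colon \mathrm{Spec}\,k[[t_j]]\to k^n$ is the composition of a normalization of $C_j$ with the inclusion $C_j\subset k^n$; $h\circ\eta_{C_j}\in k[[t_j]]$ is the image of $h$. If $z_1,\dots,z_p$ generate the maximal ideal of $k[[X_1,\dots,X_n]]$, the surjection $k[[Z_1,\dots,Z_p]]\to k[[X_1,\dots,X_n]]$, $Z_i\mapsto z_i$, gives an embedding $k^n\hookrightarrow k^p$ and, by composition, the embedding $C\hookrightarrow k^p$ defined by $z_1,\dots,z_p$. $\Sigma_{0,p}$ is the fan of faces of $\mathbb R_{\ge0}^p$ with respect to the lattice $\mathbb Z^p$, so $X_{\Sigma_{0,p}}=k^p$. A regular subdivision $\Sigma$ of $\Sigma_{0,p}$ is a fan with support $\mathbb R^p_{\ge 0}$ all of whose cones are spanned by part of a basis of $\mathbb Z^p$; $\pi_{\Sigma_{0,p}}^\Sigma\colon X_\Sigma\to k^p$ is the associated toric modification. Its exceptional locus is the union of the orbits $O(\sigma)_\Sigma$ with $\sigma\in\Sigma\setminus\Sigma_{0,p}$; its discriminant locus is the union of the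 orbits $O(\tau)_{\Sigma_{0,p}}$ with $\tau\in\Sigma_{0,p}\setminus\Sigma$. The strict transform $\tilde C$ of $C$ is the closure of the preimage of $C$ minus the exceptional locus. $\pi_{\Sigma_{0,p}}^\Sigma$ (with $\Sigma$ a regular subdivision) is a toric embedded resolution of $C\subset k^p$ if no branch of $C$ is contained in the discriminant locus, and $\tilde C$ is smooth and transversal to the orbit stratification of the exceptional locus. Transversality of a branch is tested inside the minimal coordinate subspace containing it: if this subspace is the closure of $O(\sigma)_{\Sigma_{0,p}}$ (then $\sigma\in\Sigma$), one considers the toric modification from the closure of $O(\sigma)_\Sigma$ onto it. *)

theory Defs
  imports
    "HOL-Analysis.Analysis"
    "HOL-Library.Poly_Mapping"
    "HOL-Computational_Algebra.Computational_Algebra"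
    "HOL-Algebra.Ring_Divisibility"
    "HOL-Algebra.Ideal_Product"
    "HOL-Algebra.Elementary_Groups"
    "HOL-Algebra.Algebraic_Closure_Type"
begin

section \<open>Formal power series in finitely many variables\<close>

typedef (overloaded) ('k, 'n::finite) mfps = "UNIV :: ((nat ^ 'n) \<Rightarrow> 'k) set"
  morphisms mcoeff Abs_mfps ..

setup_lifting type_definition_mfps

lemma mfps_eqI: "(\<And>e. mcoeff f e = mcoeff g e) \<Longrightarrow> f = g"
  by (simp add: mcoeff_inject[symmetric] fun_eq_iff)

lemma finite_exponents_le: "finite {a :: nat ^ 'n::finite. \<forall>i. a $ i \<le> e $ i}"
proof -
  have "{a :: nat ^ 'n. \<forall>i. a $ i \<le> e $ i} \<subseteq> vec_lambda ` (PiE UNIV (\<lambda>i. {..e $ i}))"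
  proof
    fix a :: "nat ^ 'n" assume "a \<in> {a. \<forall>i. a $ i \<le> e $ i}"
    then have "vec_nth a \<in> PiE UNIV (\<lambda>i. {..e $ i})" by auto
    then have "vec_lambda (vec_nth a) \<in> vec_lambda ` (PiE UNIV (\<lambda>i. {..e $ i}))" by (rule imageI)
    then show "a \<in> vec_lambda ` (PiE UNIV (\<lambda>i. {..e $ i}))" by simp
  qed
  moreover have "finite (PiE (UNIV :: 'n set) (\<lambda>i. {..e $ i}))"
    by (rule finite_PiE) auto
  ultimately show ?thesis by (meson finite_imageI finite_subset)
qed

definition splittings :: "nat ^ 'n::finite \<Rightarrow> ((nat ^ 'n) \<times> (nat ^ 'n)) set" where
  "splittings e = {(a, b). a + b = e}"

lemma finite_splittings [simp]: "finite (splittings e)"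
proof (rule finite_subset)
  show "splittings e \<subseteq> {a. \<forall>i. a $ i \<le> e $ i} \<times> {a. \<forall>i. a $ i \<le> e $ i}"
    by (auto simp: splittings_def)
  show "finite ({a. \<forall>i. a $ i \<le> e $ i} \<times> {a. \<forall>i. a $ i \<le> e $ i})"
    by (intro finite_cartesian_product finite_exponents_le)
qed

instantiation mfps :: (comm_ring_1, finite) comm_ring_1
begin

lift_definition zero_mfps :: "('a, 'b) mfps" is "\<lambda>_. 0" .
lift_definition one_mfps :: "('a, 'b) mfps" is "\<lambda>e. if e = 0 then 1 else 0" .
lift_definition plus_mfps :: "('a, 'b) mfps \<Rightarrow> ('a, 'b) mfps \<Rightarrow> ('a, 'b) mfps"
  is "\<lambda>f g e. f e + g e" .
lift_definition minus_mfps :: "('a, 'b) mfps \<Rightarrow> ('a, 'b) mfps \<Rightarrow> ('a, 'b) mfps"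
  is "\<lambda>f g e. f e - g e" .
lift_definition uminus_mfps :: "('a, 'b) mfps \<Rightarrow> ('a, 'b) mfps"
  is "\<lambda>f e. - f e" .
lift_definition times_mfps :: "('a, 'b) mfps \<Rightarrow> ('a, 'b) mfps \<Rightarrow> ('a, 'b) mfps"
  is "\<lambda>f g e. \<Sum>(a, b)\<in>splittings e. f a * g b" .

instance
proof
  fix f g h :: "('a, 'b) mfps"
  show "f + g + h = f + (g + h)" by transfer (simp add: add.assoc)
  show "f + g = g + f" by transfer (simp add: add.commute)
  show "0 + f = f" by transfer simp
  show "- f + f = 0" by transfer simp
  show "f - g = f + - g" by transfer simp
  show "f * g = g * f"
  proof (transfer, rule ext)
    fix f g :: "(nat ^ 'b) \<Rightarrow> 'a" and e :: "nat ^ 'b"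
    show "(\<Sum>(a, b)\<in>splittings e. f a * g b) = (\<Sum>(a, b)\<in>splittings e. g a * f b)"
      by (rule sum.reindex_bij_witness[where i = prod.swap and j = prod.swap])
        (auto simp: splittings_def add.commute mult.commute)
  qed
  show "(f * g) * h = f * (g * h)"
  proof (transfer, rule ext)
    fix f g h :: "(nat ^ 'b) \<Rightarrow> 'a" and e :: "nat ^ 'b"
    have "(\<Sum>(a, b)\<in>splittings e. (\<Sum>(c, d)\<in>splittings a. f c * g d) * h b)
        = (\<Sum>(p, q)\<in>Sigma (splittings e) (\<lambda>p. splittings (fst p)). f (fst q) * g (snd q) * h (snd p))"
      by (subst sum.Sigma[symmetric]) (auto simp: sum_distrib_right case_prod_beta)
    also have "\<dots> = (\<Sum>(p, q)\<in>Sigma (splittings e) (\<lambda>p. splittings (snd p)). f (fst p) * (g (fst q) * h (snd q)))"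
      by (rule sum.reindex_bij_witness
            [where i = "\<lambda>(p, q). ((fst p + fst q, snd q), (fst p, fst q))"
               and j = "\<lambda>(p, q). ((fst q, snd q + snd p), (snd q, snd p))"])
         (auto simp: splittings_def add.assoc mult.assoc)
    also have "\<dots> = (\<Sum>(a, b)\<in>splittings e. f a * (\<Sum>(c, d)\<in>splittings b. g c * h d))"
      by (subst sum.Sigma[symmetric]) (auto simp: sum_distrib_left case_prod_beta)
    finally show "(\<Sum>(a, b)\<in>splittings e. (\<Sum>(c, d)\<in>splittings a. f c * g d) * h b)
        = (\<Sum>(a, b)\<in>splittings e. f a * (\<Sum>(c, d)\<in>splittings b. g c * h d))" .
  qed
  show "1 * f = f"
  proof (transfer, rule ext)
    fix f :: "(nat ^ 'b) \<Rightarrow> 'a" and e :: "nat ^ 'b"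
    have "(\<Sum>(a, b)\<in>splittings e. (if a = 0 then 1 else 0) * f b)
        = (\<Sum>(a, b)\<in>{(0 :: nat ^ 'b, e)}. (if a = 0 then 1 else 0) * f b)"
    proof (intro sum.mono_neutral_right finite_splittings)
      show "{(0 :: nat ^ 'b, e)} \<subseteq> splittings e" by (simp add: splittings_def)
    qed (auto simp: splittings_def split: if_splits)
    then show "(\<Sum>(a, b)\<in>splittings e. (if a = 0 then 1 else 0) * f b) = f e" by simp
  qed
  show "(f + g) * h = f * h + g * h"
    by transfer (auto simp: distrib_right sum.distrib case_prod_beta)
  show "(0 :: ('a, 'b) mfps) \<noteq> 1"
    by transfer (auto simp: fun_eq_iff)
qed

end

lift_definition mconst :: "'k::zero \<Rightarrow> ('k, 'n::finite) mfps" is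
  "\<lambda>c e. if e = 0 then c else 0" .

lift_definition mvar :: "'n::finite \<Rightarrow> ('k::zero_neq_one, 'n) mfps" is
  "\<lambda>i e. if e = axis i 1 then 1 else 0" .


section \<open>Commutative algebra\<close>

abbreviation TR :: "'a::ring_1 ring" where
  "TR \<equiv> ring_of_type_algebra"

definition alg_hom ::
  "('k \<Rightarrow> 'a) \<Rightarrow> ('a, 'c) ring_scheme \<Rightarrow> ('k \<Rightarrow> 'b) \<Rightarrow> ('b, 'd) ring_scheme \<Rightarrow> ('a \<Rightarrow> 'b) \<Rightarrow> bool" where
  "alg_hom i A j B f \<longleftrightarrow> f \<in> ring_hom A B \<and> (\<forall>c. f (i c) = j c)"

definition local_ring :: "('a, 'b) ring_scheme \<Rightarrow> bool" where
  "local_ring R \<longleftrightarrow> cring R \<and> (\<exists>!M. maximalideal M R)"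

definition max_ideal :: "('a, 'b) ring_scheme \<Rightarrow> 'a set" where
  "max_ideal R = (THE M. maximalideal M R)"

definition ideal_power :: "('a, 'b) ring_scheme \<Rightarrow> 'a set \<Rightarrow> nat \<Rightarrow> 'a set" where
  "ideal_power R I n = (ideal_prod R I ^^ n) (carrier R)"

text \<open>Bijectivity of the canonical map from \<open>R\<close> to the inverse limit of the \<open>R / M\<^sup>n\<close>.\<close>
definition complete_local_ring :: "('a, 'b) ring_scheme \<Rightarrow> bool" where
  "complete_local_ring R \<longleftrightarrow> local_ring R \<and>
     (\<forall>a :: nat \<Rightarrow> 'a. (\<forall>n. a n \<in> carrier R) \<and>
        (\<forall>n. a (Suc n) \<ominus>\<^bsub>R\<^esub> a n \<in> ideal_power R (max_ideal R) n) \<longrightarrow>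
        (\<exists>!l. l \<in> carrier R \<and> (\<forall>n. l \<ominus>\<^bsub>R\<^esub> a n \<in> ideal_power R (max_ideal R) n)))"

definition krull_dim :: "('a, 'b) ring_scheme \<Rightarrow> enat" where
  "krull_dim R = Sup {enat n | n. \<exists>P :: nat \<Rightarrow> 'a set.
     (\<forall>i\<le>n. primeideal (P i) R) \<and> (\<forall>i<n. P i \<subset> P (Suc i))}"

definition reduced_ring :: "('a, 'b) ring_scheme \<Rightarrow> bool" where
  "reduced_ring R \<longleftrightarrow> cring R \<and>
     (\<forall>a\<in>carrier R. \<forall>n::nat. a [^]\<^bsub>R\<^esub> n = \<zero>\<^bsub>R\<^esub> \<longrightarrow> a = \<zero>\<^bsub>R\<^esub>)"

definition minimal_primes_over :: "('a, 'b) ring_scheme \<Rightarrow> 'a set \<Rightarrow> 'a set set" where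
  "minimal_primes_over R I =
     {P. primeideal P R \<and> I \<subseteq> P \<and> \<not> (\<exists>Q. primeideal Q R \<and> I \<subseteq> Q \<and> Q \<subset> P)}"

definition fraction_rel :: "('a, 'b) ring_scheme \<Rightarrow> 'a set \<Rightarrow> (('a \<times> 'a) \<times> ('a \<times> 'a)) set" where
  "fraction_rel R P = {((a, s), (b, t)).
     a \<in> carrier R \<and> b \<in> carrier R \<and> s \<in> carrier R - P \<and> t \<in> carrier R - P \<and>
     (\<exists>u\<in>carrier R - P. u \<otimes>\<^bsub>R\<^esub> (t \<otimes>\<^bsub>R\<^esub> a \<ominus>\<^bsub>R\<^esub> s \<otimes>\<^bsub>R\<^esub> b) = \<zero>\<^bsub>R\<^esub>)}"

text \<open>The localization of \<open>R\<close> at the prime \<open>P\<close>: the class of \<open>(a, s)\<close> is the fraction \<open>a / s\<close>.\<close>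
definition localization :: "('a, 'b) ring_scheme \<Rightarrow> 'a set \<Rightarrow> ('a \<times> 'a) set ring" where
  "localization R P =
     \<lparr>carrier = (carrier R \<times> (carrier R - P)) // fraction_rel R P,
      mult = (\<lambda>U V. \<Union>p\<in>U. \<Union>q\<in>V.
        fraction_rel R P `` {(fst p \<otimes>\<^bsub>R\<^esub> fst q, snd p \<otimes>\<^bsub>R\<^esub> snd q)}),
      one = fraction_rel R P `` {(\<one>\<^bsub>R\<^esub>, \<one>\<^bsub>R\<^esub>)},
      zero = fraction_rel R P `` {(\<zero>\<^bsub>R\<^esub>, \<one>\<^bsub>R\<^esub>)},
      add = (\<lambda>U V. \<Union>p\<in>U. \<Union>q\<in>V.
        fraction_rel R P `` {(snd q \<otimes>\<^bsub>R\<^esub> fst p \<oplus>\<^bsub>R\<^esub> snd p \<otimes>\<^bsub>R\<^esub> fst q, snd p \<otimes>\<^bsub>R\<^esub> snd q)})\<rparr>"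

definition regular_local_ring :: "('a, 'b) ring_scheme \<Rightarrow> bool" where
  "regular_local_ring R \<longleftrightarrow> local_ring R \<and> noetherian_ring R \<and>
     (\<exists>A\<subseteq>carrier R. finite A \<and> genideal R A = max_ideal R \<and> enat (card A) = krull_dim R)"

definition regular_ring :: "('a, 'b) ring_scheme \<Rightarrow> bool" where
  "regular_ring R \<longleftrightarrow> (\<forall>P. primeideal P R \<longrightarrow> regular_local_ring (localization R P))"

definition integral_over :: "'a::comm_ring_1 set \<Rightarrow> 'a \<Rightarrow> bool" where
  "integral_over S b \<longleftrightarrow> (\<exists>p :: 'a poly. Polynomial.lead_coeff p = 1 \<and> set (Polynomial.coeffs p) \<subseteq> S \<and> Polynomial.poly p b = 0)"

text \<open>\<open>f\<close> embeds the domain \<open>A\<close> into its normalization: the target is integral over the image,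
  has the same fraction field and is integrally closed in it.\<close>
definition is_normalization :: "('a, 'c) ring_scheme \<Rightarrow> ('a \<Rightarrow> 'b::idom) \<Rightarrow> bool" where
  "is_normalization A f \<longleftrightarrow>
     f \<in> ring_hom A TR \<and> inj_on f (carrier A) \<and>
     (\<forall>b. integral_over (f ` carrier A) b) \<and>
     (\<forall>b. \<exists>a\<in>carrier A. \<exists>s\<in>carrier A. f s \<noteq> 0 \<and> f s * b = f a) \<and>
     (\<forall>z :: 'b fract. integral_over (range to_fract) z \<longrightarrow> z \<in> range to_fract)"

text \<open>A curve \<open>Spec R\<close>, where \<open>\<iota>\<close> is the structure map of the \<open>k\<close>-algebra \<open>R\<close>.\<close>
definition formal_curve :: "('k::field \<Rightarrow> 'a) \<Rightarrow> ('a, 'b) ring_scheme \<Rightarrow> bool" where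
  "formal_curve \<iota> R \<longleftrightarrow>
     \<iota> \<in> ring_hom TR R \<and> complete_local_ring R \<and> noetherian_ring R \<and> krull_dim R = 1 \<and>
     bij_betw (\<lambda>c. max_ideal R +>\<^bsub>R\<^esub> \<iota> c) UNIV (carrier (R Quot max_ideal R))"


section \<open>Fans\<close>

definition real_vec :: "int ^ 'p \<Rightarrow> real ^ 'p::finite" where
  "real_vec u = (\<chi> i. of_int (u $ i))"

definition rational_cone :: "(real ^ 'p::finite) set \<Rightarrow> bool" where
  "rational_cone \<sigma> \<longleftrightarrow> (\<exists>B :: (int ^ 'p) set. finite B \<and> \<sigma> = convex_cone hull (real_vec ` B))"

definition strictly_convex_cone :: "'a::real_vector set \<Rightarrow> bool" where
  "strictly_convex_cone \<sigma> \<longleftrightarrow> convex_cone \<sigma> \<and> \<sigma> \<inter> uminus ` \<sigma> = {0}"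

text \<open>The library's \<open>face_of\<close> also counts the empty set as a face; cones are nonempty.\<close>
definition cone_face :: "'a::real_vector set \<Rightarrow> 'a set \<Rightarrow> bool" where
  "cone_face \<tau> \<sigma> \<longleftrightarrow> \<tau> face_of \<sigma> \<and> \<tau> \<noteq> {}"

definition fan :: "(real ^ 'p::finite) set set \<Rightarrow> bool" where
  "fan \<Sigma> \<longleftrightarrow> finite \<Sigma> \<and>
     (\<forall>\<sigma>\<in>\<Sigma>. rational_cone \<sigma> \<and> strictly_convex_cone \<sigma>) \<and>
     (\<forall>\<sigma>\<in>\<Sigma>. \<forall>\<tau>. cone_face \<tau> \<sigma> \<longrightarrow> \<tau> \<in> \<Sigma>) \<and>
     (\<forall>\<sigma>\<in>\<Sigma>. \<forall>\<tau>\<in>\<Sigma>. cone_face (\<sigma> \<inter> \<tau>) \<sigma> \<and> cone_face (\<sigma> \<inter> \<tau>) \<tau>)"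

definition lattice_basis :: "('p::finite \<Rightarrow> int ^ 'p) \<Rightarrow> bool" where
  "lattice_basis b \<longleftrightarrow> (\<forall>u. \<exists>!c :: 'p \<Rightarrow> int. u = (\<Sum>i\<in>UNIV. c i *s b i))"

definition regular_cone :: "(real ^ 'p::finite) set \<Rightarrow> bool" where
  "regular_cone \<sigma> \<longleftrightarrow>
     (\<exists>b I. lattice_basis b \<and> \<sigma> = convex_cone hull ((\<lambda>i. real_vec (b i)) ` I))"

definition orthant :: "(real ^ 'p::finite) set" where
  "orthant = {v. \<forall>i. 0 \<le> v $ i}"

definition orthant_fan :: "(real ^ 'p::finite) set set" where
  "orthant_fan = {\<tau>. cone_face \<tau> orthant}"

definition regular_subdivision :: "(real ^ 'p::finite) set set \<Rightarrow> bool" where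
  "regular_subdivision \<Sigma> \<longleftrightarrow> fan \<Sigma> \<and> \<Union>\<Sigma> = orthant \<and> (\<forall>\<sigma>\<in>\<Sigma>. regular_cone \<sigma>)"

definition dual_monoid :: "(real ^ 'p::finite) set \<Rightarrow> (int ^ 'p) set" where
  "dual_monoid \<sigma> = {u. \<forall>v\<in>\<sigma>. 0 \<le> real_vec u \<bullet> v}"

definition perp :: "(real ^ 'p::finite) set \<Rightarrow> (int ^ 'p) set" where
  "perp \<sigma> = {u. \<forall>v\<in>\<sigma>. real_vec u \<bullet> v = 0}"


section \<open>The toric modification over the formal neighbourhood of the origin\<close>

text \<open>
  A formal curve in \<open>k\<^sup>p\<close> is a closed subscheme of \<open>Spec k[[Z]]\<close>, so \<open>X\<^sub>\<Sigma> \<rightarrow> k\<^sup>p\<close> is pulled back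
  along \<open>Spec k[[Z]] \<rightarrow> k\<^sup>p\<close>.  The chart of \<open>\<sigma> \<in> \<Sigma>\<close> is the fibre product of \<open>Spec k[[Z]]\<close> and
  \<open>Spec k[\<sigma>\<^sup>\<or> \<inter> M]\<close> over \<open>k\<^sup>p\<close>.  It is represented as the closed subscheme of
  \<open>Spec k[[Z]][\<sigma>\<^sup>\<or> \<inter> M]\<close> defined by the relations \<open>\<chi>\<^sup>e = Z\<^sub>i\<close> with \<open>e\<close> the \<open>i\<close>-th unit vector;
  its points are the primes containing these relations, and its closed subschemes are given by
  ideals of \<open>k[[Z]][\<sigma>\<^sup>\<or> \<inter> M]\<close> containing them.
\<close>

type_synonym ('k, 'p) laurent = "(int ^ 'p) \<Rightarrow>\<^sub>0 ('k, 'p) mfps"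

definition chi :: "int ^ 'p::finite \<Rightarrow> ('k::comm_ring_1, 'p) laurent" where
  "chi u = Poly_Mapping.single u 1"

definition base :: "('k::comm_ring_1, 'p::finite) mfps \<Rightarrow> ('k, 'p) laurent" where
  "base f = Poly_Mapping.single 0 f"

definition chart_ring :: "(real ^ 'p::finite) set \<Rightarrow> ('k::comm_ring_1, 'p) laurent ring" where
  "chart_ring \<sigma> = TR\<lparr>carrier := {f. Poly_Mapping.keys f \<subseteq> dual_monoid \<sigma>}\<rparr>"

definition chart_relations :: "('k::comm_ring_1, 'p::finite) laurent set" where
  "chart_relations = range (\<lambda>i. chi (axis i 1) - base (mvar i))"

definition chart_points :: "(real ^ 'p::finite) set \<Rightarrow> ('k::comm_ring_1, 'p) laurent set set" where
  "chart_points \<sigma> = {q. primeideal q (chart_ring \<sigma>) \<and> chart_relations \<subseteq> q}"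

text \<open>The part of the orbit \<open>O(\<tau>)\<close> of \<open>X\<^sub>\<Sigma>\<close> in the chart of \<open>\<sigma>\<close>; empty unless \<open>\<tau>\<close> is a face of \<open>\<sigma>\<close>.\<close>
definition orbit ::
  "(real ^ 'p::finite) set \<Rightarrow> (real ^ 'p) set \<Rightarrow> ('k::comm_ring_1, 'p) laurent set set" where
  "orbit \<sigma> \<tau> = {q \<in> chart_points \<sigma>. cone_face \<tau> \<sigma> \<and>
     (\<forall>u\<in>dual_monoid \<sigma>. chi u \<notin> q \<longleftrightarrow> u \<in> perp \<tau>)}"

definition exceptional_locus ::
  "(real ^ 'p::finite) set set \<Rightarrow> (real ^ 'p) set \<Rightarrow> ('k::comm_ring_1, 'p) laurent set set" where
  "exceptional_locus \<Sigma> \<sigma> = (\<Union>\<tau>\<in>\<Sigma> - orthant_fan. orbit \<sigma> \<tau>)"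

definition base_orbit :: "(real ^ 'p::finite) set \<Rightarrow> ('k::comm_ring_1, 'p) mfps set set" where
  "base_orbit \<tau> = {q. primeideal q TR \<and> (\<forall>i. mvar i \<in> q \<longleftrightarrow> axis i 1 \<in> \<tau>)}"

definition discriminant_locus ::
  "(real ^ 'p::finite) set set \<Rightarrow> ('k::comm_ring_1, 'p) mfps set set" where
  "discriminant_locus \<Sigma> = (\<Union>\<tau>\<in>orthant_fan - \<Sigma>. base_orbit \<tau>)"

text \<open>The ideal, in the chart of \<open>\<sigma>\<close>, of the closure (with its reduced structure) of the preimage
  of \<open>V(I) \<subseteq> Spec k[[Z]]\<close> minus the exceptional locus.  Forming closures commutes with restriction
  to the open chart.  Intersecting with the carrier only matters when there are no such points.\<close>
definition strict_transform ::
  "(real ^ 'p::finite) set set \<Rightarrow> (real ^ 'p) set \<Rightarrow> ('k::comm_ring_1, 'p) mfps set \<Rightarrow>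
   ('k, 'p) laurent set" where
  "strict_transform \<Sigma> \<sigma> I = carrier (chart_ring \<sigma>) \<inter>
     \<Inter> {q \<in> chart_points \<sigma>. base ` I \<subseteq> q \<and> q \<notin> exceptional_locus \<Sigma> \<sigma>}"

text \<open>The ideal of the closure of the orbit \<open>O(\<sigma>)\<close> in the chart of \<open>\<tau>\<close>, for \<open>\<sigma>\<close> a face of \<open>\<tau>\<close>.
  For \<open>\<sigma> = \<tau>\<close> it is the ideal of \<open>O(\<tau>)\<close>, which is closed in this chart.\<close>
definition orbit_closure_ideal ::
  "(real ^ 'p::finite) set \<Rightarrow> (real ^ 'p) set \<Rightarrow> ('k::comm_ring_1, 'p) laurent set" where
  "orbit_closure_ideal \<tau> \<sigma> =
     genideal (chart_ring \<tau>) (chart_relations \<union> chi ` (dual_monoid \<tau> - perp \<sigma>))"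

definition rational_point ::
  "(real ^ 'p::finite) set \<Rightarrow> (('k::field, 'p) laurent \<Rightarrow> 'k) \<Rightarrow> bool" where
  "rational_point \<sigma> x \<longleftrightarrow>
     alg_hom (\<lambda>c. base (mconst c)) (chart_ring \<sigma>) (\<lambda>c. c) TR x \<and> (\<forall>f\<in>chart_relations. x f = 0)"

text \<open>Zariski tangent space at \<open>x\<close> of the subscheme defined by \<open>J\<close>: the \<open>k\<close>-derivations at \<open>x\<close>
  (extended by \<open>0\<close> outside the carrier) that kill \<open>J\<close>.\<close>
definition tangent_space ::
  "(real ^ 'p::finite) set \<Rightarrow> (('k::field, 'p) laurent \<Rightarrow> 'k) \<Rightarrow> ('k, 'p) laurent set \<Rightarrow>
   (('k, 'p) laurent \<Rightarrow> 'k) set" where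
  "tangent_space \<sigma> x J = {D.
     (\<forall>f\<in>carrier (chart_ring \<sigma>). \<forall>g\<in>carrier (chart_ring \<sigma>).
        D (f + g) = D f + D g \<and> D (f * g) = x f * D g + x g * D f) \<and>
     (\<forall>c. D (base (mconst c)) = 0) \<and>
     (\<forall>f. f \<notin> carrier (chart_ring \<sigma>) \<longrightarrow> D f = 0) \<and>
     (\<forall>f\<in>J. D f = 0)}"

text \<open>The cone \<open>\<sigma>\<close> such that the minimal coordinate subspace containing \<open>V(P)\<close> is the closure of
  the orbit of \<open>\<sigma>\<close> in \<open>k\<^sup>p\<close>.\<close>
definition coord_cone :: "('k::comm_ring_1, 'p::finite) mfps set \<Rightarrow> (real ^ 'p) set" where
  "coord_cone P = convex_cone hull {axis i 1 | i. mvar i \<in> P}"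

text \<open>
  The orbit closure of \<open>\<sigma>\<close> is the toric variety of the fan of the images in \<open>N\<^sub>\<real> / span \<sigma>\<close> of the
  cones containing \<open>\<sigma>\<close> as a face; such an image is represented by its preimage \<open>\<tau> + span \<sigma>\<close>.
  The exceptional orbits of the modification of orbit closures are those of the cones \<open>\<tau>\<close> whose
  image is not the image of a cone of \<open>\<Sigma>\<^sub>0\<close>.  For \<open>\<sigma> = {0}\<close> these are the \<open>\<tau> \<in> \<Sigma> - \<Sigma>\<^sub>0\<close>.
\<close>
definition cone_mod :: "'a::real_vector set \<Rightarrow> 'a set \<Rightarrow> 'a set" where
  "cone_mod \<sigma> \<tau> = {v + w | v w. v \<in> \<tau> \<and> w \<in> Real_Vector_Spaces.span \<sigma>}"

definition exceptional_cones ::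
  "(real ^ 'p::finite) set set \<Rightarrow> (real ^ 'p) set \<Rightarrow> (real ^ 'p) set set" where
  "exceptional_cones \<Sigma> \<sigma> = {\<tau> \<in> \<Sigma>. cone_face \<sigma> \<tau> \<and>
     cone_mod \<sigma> \<tau> \<notin> cone_mod \<sigma> ` {\<tau>\<^sub>0 \<in> orthant_fan. cone_face \<sigma> \<tau>\<^sub>0}}"

text \<open>Transversality of the strict transform of the branch \<open>V(P)\<close> to the orbits of the exceptional
  locus, inside the orbit closure \<open>V\<close> of \<open>coord_cone P\<close>: at every common point the tangent spaces of
  the strict transform and of the orbit span that of \<open>V\<close>.  The field being algebraically closed,
  the points concerned are \<open>k\<close>-rational.  Points of \<open>O(\<tau>)\<close> are looked at in the chart of \<open>\<tau>\<close>.\<close>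
definition transversal_branch ::
  "(real ^ 'p::finite) set set \<Rightarrow> ('k::field, 'p) mfps set \<Rightarrow> bool" where
  "transversal_branch \<Sigma> P \<longleftrightarrow>
     (\<forall>\<tau>\<in>exceptional_cones \<Sigma> (coord_cone P). \<forall>x.
        rational_point \<tau> x \<and>
        (\<forall>f\<in>strict_transform \<Sigma> \<tau> P \<union> orbit_closure_ideal \<tau> \<tau>. x f = 0) \<longrightarrow>
        {(\<lambda>f. D f + E f) | D E.
            D \<in> tangent_space \<tau> x (strict_transform \<Sigma> \<tau> P) \<and>
            E \<in> tangent_space \<tau> x (orbit_closure_ideal \<tau> \<tau>)}
        = tangent_space \<tau> x (orbit_closure_ideal \<tau> (coord_cone P)))"

text \<open>\<open>I\<close> is the ideal of the reduced curve in \<open>k[[Z]]\<close>.  Smoothness of the strict transform means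
  regularity of its local rings, \<open>k\<close> being algebraically closed.\<close>
definition toric_embedded_resolution ::
  "(real ^ 'p::finite) set set \<Rightarrow> ('k::alg_closed_field, 'p) mfps set \<Rightarrow> bool" where
  "toric_embedded_resolution \<Sigma> I \<longleftrightarrow> regular_subdivision \<Sigma> \<and>
     (\<forall>P\<in>minimal_primes_over TR I. \<not> {q. primeideal q TR \<and> P \<subseteq> q} \<subseteq> discriminant_locus \<Sigma>) \<and>
     (\<forall>\<sigma>\<in>\<Sigma>. regular_ring (chart_ring \<sigma> Quot strict_transform \<Sigma> \<sigma> I)) \<and>
     (\<forall>P\<in>minimal_primes_over TR I. transversal_branch \<Sigma> P)"

end

theory Submission
  imports Defs
begin

text \<open>
  Let \<open>v\<^sub>j\<close> be the vector of the orders \<open>ord z\<^sub>i\<close> of the new coordinates along the branch \<open>C\<^sub>j\<close>, and let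
  \<open>\<sigma>\<^sub>j\<close> be the face of the orthant spanned by the axes of the coordinates that vanish on \<open>C\<^sub>j\<close>, namely
  those \<open>z\<^sub>m\<^sub>+\<^sub>l\<close> with \<open>l \<noteq> j\<close>.  Toric geometry reads off the behaviour of \<open>C\<^sub>j\<close> in a modification from the
  position of \<open>v\<^sub>j\<close> modulo the span of \<open>\<sigma>\<^sub>j\<close>.  The fan sought contains \<open>\<sigma>\<^sub>j\<close>, and \<open>v\<^sub>j\<close> generates a ray of
  the star of \<open>\<sigma>\<^sub>j\<close>: as the orders of \<open>z\<^sub>1, \<dots>, z\<^sub>m\<close> generate the group of integers, the monomial
  dual to this ray has order one on \<open>C\<^sub>j\<close>.  It is thus a parameter of the lifted branch and at the same
  time an equation of the exceptional orbit that the branch meets, which gives smoothness and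
  transversality at once.

  The fan arises from the faces of the orthant by star subdivisions of edges \<open>{u, w}\<close> at \<open>u + w\<close>, which
  preserve regularity (\<open>regular_complex_star_subdivision\<close>).  Write \<open>v\<^sub>j\<close> modulo \<open>\<sigma>\<^sub>j\<close> as a positive
  combination of rays of a cone.  As long as two rays occur for some \<open>j\<close>, subdividing the edge between
  them lowers the sum of all coefficients (\<open>exists_complex_with_rays\<close>).  No \<open>\<sigma>\<^sub>l\<close> is ever destroyed, because
  among the axes of \<open>z\<^sub>m\<^sub>+\<^sub>1, \<dots>, z\<^sub>m\<^sub>+\<^sub>r\<close> only that of \<open>z\<^sub>m\<^sub>+\<^sub>j\<close> can occur in the combination for \<open>v\<^sub>j\<close>.
  This is the purpose of the functions \<open>z\<^sub>m\<^sub>+\<^sub>j\<close>: they move the branches into different coordinate subspaces,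
  where each direction can be made a ray independently of the others.

  The arithmetic input is a conductor statement (\<open>conductor\<close>): the image of \<open>k[[Z]]\<close> in \<open>k[[t\<^sub>j]]\<close> contains
  every series of large order.  Hence a prime of \<open>k[[Z]]\<close> over the branch is the ideal of the branch or the
  maximal ideal.  A point of a chart over the maximal ideal lies in the orbit of a cone that meets the
  interior of the orthant, so it is exceptional; over the ideal of the branch there is only the kernel of
  the evaluation of chart functions in \<open>k((t\<^sub>j))\<close> (\<open>nonexceptional_point_over_branch\<close>).  The strict transform is
  therefore cut out by these kernels.  By the conductor again, the evaluation has image \<open>k[[t\<^sub>j]]\<close> or \<open>k((t\<^sub>j))\<close>,
  according to whether the ray of \<open>v\<^sub>j\<close> belongs to the chart, and monomials dual to the axes of the \<open>z\<^sub>m\<^sub>+\<^sub>j\<close>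
  separate the branches.  So the coordinate ring of the strict transform in a chart is a finite product of
  such rings, which is regular (\<open>regular_strict_transform\<close>).  At a point on the exceptional locus, a tangent
  vector of the coordinate subspace is a multiple of the velocity of the branch plus a vector on which the
  monomial dual to the ray vanishes; the latter is tangent to the orbit (\<open>tangent_spaces_span\<close>).
\<close>

unbundle no Formal_Power_Series.fps_syntax

section \<open>Regular cone complexes and star subdivision\<close>

definition pair :: "int ^ 'p::finite \<Rightarrow> int ^ 'p \<Rightarrow> int" where
  "pair u v = (\<Sum>i\<in>UNIV. u $ i * v $ i)"

lemma pair_add_left: "pair (u + u') v = pair u v + pair u' v"
  and pair_add_right: "pair u (v + v') = pair u v + pair u v'"
  and pair_diff_left: "pair (u - u') v = pair u v - pair u' v"
  and pair_uminus_left: "pair (- u) v = - pair u v"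
  and pair_scale_left: "pair (k *s u) v = k * pair u v"
  and pair_scale_right: "pair u (k *s v) = k * pair u v"
  and pair_zero_left: "pair 0 v = 0"
  by (simp_all add: pair_def algebra_simps sum.distrib sum_subtractf sum_negf sum_distrib_left)

lemma pair_sum_left: "pair (\<Sum>i\<in>I. f i) v = (\<Sum>i\<in>I. pair (f i) v)"
  by (induction I rule: infinite_finite_induct) (auto simp: pair_add_left pair_zero_left)

lemma pair_sum_right: "pair u (\<Sum>i\<in>I. f i) = (\<Sum>i\<in>I. pair u (f i))"
  by (induction I rule: infinite_finite_induct) (auto simp: pair_add_right, auto simp: pair_def)

lemma pair_axis_right [simp]: "pair u (axis i 1) = u $ i"
  by (simp add: pair_def axis_def if_distrib[of "\<lambda>x. _ * x"] cong: if_cong)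

lemma pair_axis_left [simp]: "pair (axis i 1) u = u $ i"
  by (simp add: pair_def axis_def if_distrib[of "\<lambda>x. x * _"] cong: if_cong)

lemma inner_real_vec: "real_vec u \<bullet> real_vec v = of_int (pair u v)"
  by (simp add: real_vec_def inner_vec_def pair_def)

lemma real_vec_nth [simp]: "real_vec u $ i = of_int (u $ i)"
  by (simp add: real_vec_def)

lemma real_vec_add: "real_vec (u + v) = real_vec u + real_vec v"
  by (simp add: vec_eq_iff)

lemma real_vec_axis: "real_vec (axis i 1) = axis i 1"
  by (simp add: vec_eq_iff axis_def)

text \<open>The second condition gives the coordinates of a vector explicitly, so that being a basis is
  visibly stable under the elementary operation below.\<close>

definition dual_bases :: "('p::finite \<Rightarrow> int ^ 'p) \<Rightarrow> ('p \<Rightarrow> int ^ 'p) \<Rightarrow> bool" where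
  "dual_bases b d \<longleftrightarrow> (\<forall>i j. pair (d i) (b j) = (if i = j then 1 else 0)) \<and>
     (\<forall>v. v = (\<Sum>i\<in>UNIV. pair (d i) v *s b i))"

lemma dual_bases_lattice_basis:
  assumes "dual_bases b d"
  shows "lattice_basis b"
  unfolding lattice_basis_def
proof (intro allI ex1I)
  fix u
  show "u = (\<Sum>i\<in>UNIV. pair (d i) u *s b i)" using assms by (simp add: dual_bases_def)
next
  fix u and c :: "'a \<Rightarrow> int"
  assume u: "u = (\<Sum>i\<in>UNIV. c i *s b i)"
  have "pair (d j) u = c j" for j
  proof -
    have "pair (d j) u = (\<Sum>i\<in>UNIV. c i * pair (d j) (b i))"
      by (simp add: u pair_sum_right pair_scale_right)
    also have "\<dots> = (\<Sum>i\<in>UNIV. if i = j then c i else 0)"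
      using assms by (intro sum.cong) (auto simp: dual_bases_def)
    finally show ?thesis by simp
  qed
  then show "c = (\<lambda>i. pair (d i) u)" by auto
qed

lemma dual_bases_axis: "dual_bases (\<lambda>i. axis i 1) (\<lambda>i. axis i 1)"
proof -
  have "v = (\<Sum>i\<in>UNIV. v $ i *s axis i 1)" for v :: "int ^ 'a"
    by (simp add: vec_eq_iff axis_def if_distrib cong: if_cong)
  moreover have "axis i 1 $ j = (if i = j then 1 else 0 :: int)" for i j :: 'a
    by (simp add: axis_def)
  ultimately show ?thesis by (simp add: dual_bases_def)
qed

text \<open>The elementary operation \<open>b\<^sub>j \<mapsto> b\<^sub>i + b\<^sub>j\<close> is unimodular; on the dual basis it acts by the
  contragredient operation.\<close>

lemma dual_bases_replace:
  assumes bd: "dual_bases b d" and ne: "i \<noteq> j"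
  shows "dual_bases (b(j := b i + b j)) (d(i := d i - d j))"
  unfolding dual_bases_def
proof (intro conjI allI)
  fix k l
  show "pair ((d(i := d i - d j)) k) ((b(j := b i + b j)) l) = (if k = l then 1 else 0)"
    using bd ne by (auto simp: dual_bases_def pair_add_right pair_diff_left)
next
  fix v
  let ?b = "b(j := b i + b j)" and ?d = "d(i := d i - d j)"
  have split: "(\<Sum>k\<in>UNIV. g k) = g i + g j + (\<Sum>k\<in>UNIV - {i, j}. g k)" for g :: "'a \<Rightarrow> int ^ 'a"
    using ne by (simp add: sum.remove[of _ i] sum.remove[of _ j] Diff_insert2[symmetric] algebra_simps)
  have "v = (\<Sum>k\<in>UNIV. pair (d k) v *s b k)" using bd by (simp add: dual_bases_def)
  also have "\<dots> = (\<Sum>k\<in>UNIV. pair (?d k) v *s ?b k)"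
    unfolding split using ne
    by (simp add: pair_diff_left vec_eq_iff algebra_simps)
  finally show "v = (\<Sum>k\<in>UNIV. pair (?d k) v *s ?b k)" .
qed

definition supp :: "('a \<Rightarrow> 'b::zero) \<Rightarrow> 'a set" where
  "supp c = {a. c a \<noteq> 0}"

definition comb :: "(int ^ 'p::finite \<Rightarrow> real) \<Rightarrow> real ^ 'p" where
  "comb c = (\<Sum>a\<in>supp c. c a *\<^sub>R real_vec a)"

definition gen_cone :: "(int ^ 'p::finite) set \<Rightarrow> (real ^ 'p) set" where
  "gen_cone A = convex_cone hull (real_vec ` A)"

lemma comb_eq: "finite F \<Longrightarrow> supp c \<subseteq> F \<Longrightarrow> comb c = (\<Sum>a\<in>F. c a *\<^sub>R real_vec a)"
  unfolding comb_def by (rule sum.mono_neutral_left) (auto simp: supp_def)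

lemma sum_in_convex_cone:
  assumes "convex_cone C" and "\<And>a. a \<in> F \<Longrightarrow> f a \<in> C"
  shows "sum f F \<in> C"
  using assms(2)
  by (induction F rule: infinite_finite_induct)
    (auto intro: convex_cone_add[OF assms(1)] convex_cone_contains_0[OF assms(1)])

lemma mem_gen_cone:
  assumes "finite A"
  shows "v \<in> gen_cone A \<longleftrightarrow> (\<exists>c. (\<forall>a. 0 \<le> c a) \<and> supp c \<subseteq> A \<and> comb c = v)"
proof
  let ?C = "{comb c | c. (\<forall>a. 0 \<le> c a) \<and> supp c \<subseteq> A}"
  assume v: "v \<in> gen_cone A"
  have "convex_cone ?C"
    unfolding convex_cone_iff
  proof (intro conjI ballI allI impI)
    show "0 \<in> ?C" by (auto intro!: exI[of _ "\<lambda>_. 0"] simp: comb_def supp_def)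
  next
    fix x y assume "x \<in> ?C" "y \<in> ?C"
    then obtain c d where c: "\<forall>a. 0 \<le> c a" "supp c \<subseteq> A" "x = comb c"
      and d: "\<forall>a. 0 \<le> d a" "supp d \<subseteq> A" "y = comb d" by auto
    have "supp (\<lambda>a. c a + d a) \<subseteq> supp c \<union> supp d" by (auto simp: supp_def)
    then have "supp (\<lambda>a. c a + d a) \<subseteq> A" using c d by blast
    moreover have "comb (\<lambda>a. c a + d a) = x + y"
      using c d calculation assms by (simp add: comb_eq[of A] scaleR_add_left sum.distrib)
    ultimately show "x + y \<in> ?C" using c d by (auto intro!: exI[of _ "\<lambda>a. c a + d a"])
  next
    fix x and r :: real assume "x \<in> ?C" and r: "0 \<le> r"
    then obtain c where c: "\<forall>a. 0 \<le> c a" "supp c \<subseteq> A" "x = comb c" by auto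
    have "supp (\<lambda>a. r * c a) \<subseteq> A" using c by (auto simp: supp_def)
    moreover have "comb (\<lambda>a. r * c a) = r *\<^sub>R x"
      using c calculation assms by (simp add: comb_eq[of A] scaleR_sum_right)
    ultimately show "r *\<^sub>R x \<in> ?C" using c r by (auto intro!: exI[of _ "\<lambda>a. r * c a"])
  qed
  moreover have "real_vec ` A \<subseteq> ?C"
  proof
    fix x assume "x \<in> real_vec ` A"
    then obtain a where a: "a \<in> A" "x = real_vec a" by auto
    then show "x \<in> ?C"
      by (auto intro!: exI[of _ "\<lambda>b. if b = a then 1 else 0"] simp: comb_def supp_def split: if_splits)
  qed
  ultimately have "gen_cone A \<subseteq> ?C"
    unfolding gen_cone_def by (intro hull_minimal)
  then show "\<exists>c. (\<forall>a. 0 \<le> c a) \<and> supp c \<subseteq> A \<and> comb c = v" using v by blast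
next
  assume "\<exists>c. (\<forall>a. 0 \<le> c a) \<and> supp c \<subseteq> A \<and> comb c = v"
  then obtain c where c: "\<forall>a. 0 \<le> c a" "supp c \<subseteq> A" "comb c = v" by auto
  have "(\<Sum>a\<in>supp c. c a *\<^sub>R real_vec a) \<in> gen_cone A"
    unfolding gen_cone_def
  proof (rule sum_in_convex_cone[OF convex_cone_convex_cone_hull])
    fix a assume "a \<in> supp c"
    then have "real_vec a \<in> convex_cone hull (real_vec ` A)" using c(2) by (intro hull_inc) auto
    then show "c a *\<^sub>R real_vec a \<in> convex_cone hull (real_vec ` A)"
      using c(1) by (simp add: convex_cone_hull_mul)
  qed
  then show "v \<in> gen_cone A" using c by (simp add: comb_def)
qed

lemma real_vec_in_gen_cone: "a \<in> A \<Longrightarrow> real_vec a \<in> gen_cone A"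
  unfolding gen_cone_def by (rule hull_inc) auto

lemma gen_cone_mono: "A \<subseteq> B \<Longrightarrow> gen_cone A \<subseteq> gen_cone B"
  unfolding gen_cone_def by (intro hull_mono image_mono)

lemma convex_cone_gen_cone: "convex_cone (gen_cone A)"
  unfolding gen_cone_def by (rule convex_cone_convex_cone_hull)

text \<open>A regular fan is recorded by the sets of primitive generators of its cones.  The last two
  conditions say that the relative interiors of the cones partition the orthant: the support of a
  coefficient function is the generator set of the cone whose relative interior contains the vector.
  That two cones meet in a common face is a consequence.\<close>

locale regular_complex =
  fixes K :: "(int ^ 'p::finite) set set"
  assumes finite_K: "finite K"
    and down: "A \<in> K \<Longrightarrow> B \<subseteq> A \<Longrightarrow> B \<in> K"
    and basis: "A \<in> K \<Longrightarrow> \<exists>b d. dual_bases b d \<and> A \<subseteq> range b"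
    and nonneg: "A \<in> K \<Longrightarrow> a \<in> A \<Longrightarrow> 0 \<le> a $ i"
    and unique: "\<lbrakk>\<And>a. 0 \<le> c a; \<And>a. 0 \<le> c' a; supp c \<in> K; supp c' \<in> K; comb c = comb c'\<rbrakk> \<Longrightarrow> c = c'"
    and cover: "v \<in> orthant \<Longrightarrow> \<exists>c. (\<forall>a. 0 \<le> c a) \<and> supp c \<in> K \<and> comb c = v"
begin

lemma finite_mem: "A \<in> K \<Longrightarrow> finite A"
  using basis by (meson finite_class.finite_UNIV finite_imageI finite_subset)

end

lemma regular_complex_orthant:
  "regular_complex (Pow (range (\<lambda>i. axis i 1)) :: (int ^ 'p::finite) set set)"
proof
  let ?E = "range (\<lambda>i. axis i 1) :: (int ^ 'p) set"
  have inj: "inj (\<lambda>i::'p. axis i (1::int))" by (auto simp: inj_on_def axis_eq_axis)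
  have comb_nth: "comb c $ i = c (axis i 1)" if "supp c \<subseteq> ?E" for c :: "int ^ 'p \<Rightarrow> real" and i
  proof -
    have "comb c = (\<Sum>i\<in>UNIV. c (axis i 1) *\<^sub>R real_vec (axis i 1))"
      using that by (simp add: comb_eq[of ?E] sum.reindex[OF inj])
    then have "comb c $ i = (\<Sum>k\<in>UNIV. if k = i then c (axis k 1) else 0)"
      by (simp add: real_vec_axis axis_def if_distrib cong: if_cong)
    then show ?thesis by simp
  qed
  fix c c' :: "int ^ 'p \<Rightarrow> real"
  assume "supp c \<in> Pow ?E" "supp c' \<in> Pow ?E" "comb c = comb c'"
  moreover have "c a = 0" "c' a = 0" if "a \<notin> ?E" for a
    using that \<open>supp c \<in> Pow ?E\<close> \<open>supp c' \<in> Pow ?E\<close> unfolding supp_def by blast+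
  ultimately show "c = c'"
    by (metis (no_types, lifting) PowD comb_nth ext rangeE)
next
  let ?E = "range (\<lambda>i. axis i 1) :: (int ^ 'p) set"
  have inj: "inj (\<lambda>i::'p. axis i (1::int))" by (auto simp: inj_on_def axis_eq_axis)
  fix v :: "real ^ 'p" assume v: "v \<in> orthant"
  define c where "c a = (if a \<in> ?E then v $ (SOME i. a = axis i 1) else 0)" for a
  have c_axis: "c (axis i 1) = v $ i" for i
    by (simp add: c_def axis_eq_axis)
  have s: "supp c \<subseteq> ?E" by (auto simp: supp_def c_def split: if_splits)
  have "comb c = (\<Sum>i\<in>UNIV. v $ i *\<^sub>R axis i 1)"
    using s by (simp add: comb_eq[of ?E] sum.reindex[OF inj] c_axis real_vec_axis)
  also have "\<dots> = v"
    by (simp add: vec_eq_iff axis_def if_distrib cong: if_cong)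
  finally show "\<exists>c. (\<forall>a. 0 \<le> c a) \<and> supp c \<in> Pow ?E \<and> comb c = v"
    using s v by (intro exI[of _ c]) (auto simp: c_def orthant_def)
qed (use dual_bases_axis in \<open>auto simp: axis_def\<close>)

definition star_subdivision :: "'a \<Rightarrow> 'a \<Rightarrow> 'a::plus set set \<Rightarrow> 'a set set" where
  "star_subdivision u w K = {A \<in> K. \<not> {u, w} \<subseteq> A} \<union>
     {insert (u + w) A | A. A \<in> K \<and> \<not> {u, w} \<subseteq> A \<and> A \<union> {u, w} \<in> K}"

lemma star_subdivision_oldI: "A \<in> K \<Longrightarrow> \<not> {u, w} \<subseteq> A \<Longrightarrow> A \<in> star_subdivision u w K"
  unfolding star_subdivision_def by blast

lemma star_subdivision_newI:
  "\<lbrakk>A \<in> K; \<not> {u, w} \<subseteq> A; A \<union> {u, w} \<in> K; B = insert (u + w) A\<rbrakk> \<Longrightarrow> B \<in> star_subdivision u w K"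
  unfolding star_subdivision_def by blast

lemma star_subdivisionE:
  assumes "B \<in> star_subdivision u w K"
  obtains (old) "B \<in> K" "\<not> {u, w} \<subseteq> B"
    | (new) A where "B = insert (u + w) A" "A \<in> K" "\<not> {u, w} \<subseteq> A" "A \<union> {u, w} \<in> K"
  using assms unfolding star_subdivision_def by blast

context regular_complex
begin

text \<open>Otherwise \<open>u + w\<close> would be represented both on its own ray and on the edge \<open>{u, w}\<close>.\<close>

lemma edge_midpoint_fresh:
  assumes uw: "{u, w} \<in> K" "u \<noteq> w" and A: "A \<in> K"
  shows "u + w \<notin> A"
proof
  assume "u + w \<in> A"
  then have z: "{u + w} \<in> K" using A down by blast
  define c where "c = (\<lambda>a. if a = u + w then 1 else 0 :: real)"
  define c' where "c' = (\<lambda>a. if a = u \<or> a = w then 1 else 0 :: real)"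
  have s: "supp c = {u + w}" "supp c' = {u, w}" by (auto simp: supp_def c_def c'_def)
  have "comb c = comb c'"
    unfolding comb_def s using uw(2) by (simp add: c_def c'_def real_vec_add)
  then have "c = c'" using unique[of c c'] s z uw by (auto simp: c_def c'_def)
  then show False using s uw(2) by (metis doubleton_eq_iff insert_absorb2)
qed

text \<open>The relation \<open>1 \<cdot> (u + w) = u + w\<close> between generators, which converts representations in a
  subdivision into representations in the original complex and back.\<close>

lemma edge_shift_comb:
  fixes c :: "int ^ 'p \<Rightarrow> real"
  assumes "finite (supp c)" "u \<noteq> w" "u + w \<noteq> u" "u + w \<noteq> w"
  shows "comb (c(u + w := c (u + w) + m, u := c u - m, w := c w - m)) = comb c"
proof -
  let ?F = "supp c \<union> {u, w, u + w}"
  let ?c = "c(u + w := c (u + w) + m, u := c u - m, w := c w - m)"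
  have split: "(\<Sum>a\<in>?F. g a) = g u + g w + g (u + w) + (\<Sum>a\<in>?F - {u, w, u + w}. g a)"
    for g :: "int ^ 'p \<Rightarrow> real ^ 'p"
  proof -
    have "(\<Sum>a\<in>?F. g a) = (\<Sum>a\<in>?F - {u, w, u + w}. g a) + (\<Sum>a\<in>{u, w, u + w}. g a)"
      by (rule sum.subset_diff) (use assms in auto)
    then show ?thesis using assms by (simp add: algebra_simps)
  qed
  have rest: "(\<Sum>a\<in>?F - {u, w, u + w}. ?c a *\<^sub>R real_vec a) = (\<Sum>a\<in>?F - {u, w, u + w}. c a *\<^sub>R real_vec a)"
    by (rule sum.cong) auto
  have "comb ?c = (\<Sum>a\<in>?F. ?c a *\<^sub>R real_vec a)"
    by (rule comb_eq) (use assms in \<open>auto simp: supp_def\<close>)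
  also have "\<dots> = (\<Sum>a\<in>?F. c a *\<^sub>R real_vec a)"
    unfolding split rest using assms by (simp add: real_vec_add algebra_simps)
  also have "\<dots> = comb c"
    by (rule comb_eq[symmetric]) (use assms in auto)
  finally show ?thesis .
qed

lemma star_subdivision_basis:
  assumes "u \<noteq> w" and A: "\<not> {u, w} \<subseteq> A" "A \<union> {u, w} \<in> K"
  shows "\<exists>b d. dual_bases b d \<and> insert (u + w) A \<subseteq> range b"
proof -
  have *: "\<exists>b d. dual_bases b d \<and> insert (u + w) A \<subseteq> range b"
    if h: "u \<noteq> w" "w \<notin> A" "A \<union> {u, w} \<in> K" for u w
  proof -
    obtain b d where bd: "dual_bases b d" "A \<union> {u, w} \<subseteq> range b" using basis[OF h(3)] by blast
    then obtain i j where ij: "u = b i" "w = b j" by auto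
    have "insert (u + w) A \<subseteq> range (b(j := b i + b j))"
    proof
      fix a assume a: "a \<in> insert (u + w) A"
      show "a \<in> range (b(j := b i + b j))"
      proof (cases "a = u + w")
        case True
        then have "a = (b(j := b i + b j)) j" using ij by simp
        then show ?thesis by blast
      next
        case False
        then obtain k where k: "a = b k" "k \<noteq> j" using a bd(2) ij h(2) by auto
        then have "a = (b(j := b i + b j)) k" by simp
        then show ?thesis by blast
      qed
    qed
    then show ?thesis using dual_bases_replace[OF bd(1), of i j] ij h(1) by blast
  qed
  show ?thesis
  proof (cases "w \<in> A")
    case False
    then show ?thesis using * assms by blast
  next
    case True
    then have "u \<notin> A" using assms by auto
    then show ?thesis using *[of w u] assms by (simp add: add.commute insert_commute)
  qed
qed

text \<open>Representations in the subdivision and in the original complex determine each other.  In one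
  direction the coefficient of \<open>u + w\<close> is distributed to \<open>u\<close> and \<open>w\<close>; as a cone of the subdivision never
  contains both \<open>u\<close> and \<open>w\<close>, that coefficient is recovered as the smaller one of the resulting
  coefficients of \<open>u\<close> and \<open>w\<close>.\<close>

proposition regular_complex_star_subdivision:
  assumes uw: "{u, w} \<in> K" "u \<noteq> w"
  shows "regular_complex (star_subdivision u w K)"
proof
  let ?z = "u + w" and ?K = "star_subdivision u w K"
  have zA: "A \<in> K \<Longrightarrow> ?z \<notin> A" for A using edge_midpoint_fresh[OF uw] .
  have zu: "?z \<noteq> u" "?z \<noteq> w" using zA[OF uw(1)] by auto
  have uK: "u \<in> \<Union>K" "w \<in> \<Union>K" using uw by auto
  have "?K \<subseteq> K \<union> insert ?z ` K" by (auto simp: star_subdivision_def)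
  then show "finite ?K" using finite_K finite_subset by blast
  show "B \<in> ?K" if h: "A \<in> ?K" "B \<subseteq> A" for A B
    using h(1)
  proof (cases rule: star_subdivisionE)
    case old
    show ?thesis
      by (rule star_subdivision_oldI[OF down[OF old(1) h(2)]]) (use old(2) h(2) in blast)
  next
    case (new A')
    let ?B = "B - {?z}"
    have sub: "?B \<subseteq> A'" using h(2) new(1) by blast
    have n: "\<not> {u, w} \<subseteq> ?B" using sub new(3) by blast
    show ?thesis
    proof (cases "?z \<in> B")
      case True
      show ?thesis
      proof (rule star_subdivision_newI[OF down[OF new(2) sub] n])
        show "?B \<union> {u, w} \<in> K" by (rule down[OF new(4)]) (use sub in blast)
        show "B = insert ?z ?B" by (rule insert_Diff[OF True, symmetric])
      qed
    next
      case False
      then have "?B = B" by blast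
      then show ?thesis using star_subdivision_oldI[OF down[OF new(2) sub] n] by simp
    qed
  qed
  show "\<exists>b d. dual_bases b d \<and> A \<subseteq> range b" if "A \<in> ?K" for A
    using that by (cases rule: star_subdivisionE) (use basis star_subdivision_basis[OF uw(2)] in auto)
  show "0 \<le> a $ i" if "A \<in> ?K" "a \<in> A" for A a i
  proof -
    have "a = ?z \<or> a \<in> \<Union>K" using that(1) by (cases rule: star_subdivisionE) (use that(2) in auto)
    moreover have n: "0 \<le> b $ i" if "b \<in> \<Union>K" for b using that nonneg by blast
    moreover have "0 \<le> ?z $ i" using n[OF uK(1)] n[OF uK(2)] by simp
    ultimately show ?thesis by blast
  qed
next
  let ?z = "u + w" and ?K = "star_subdivision u w K"
  have zA: "A \<in> K \<Longrightarrow> ?z \<notin> A" for A using edge_midpoint_fresh[OF uw] .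
  have zu: "?z \<noteq> u" "?z \<noteq> w" using zA[OF uw(1)] by auto
  define r where "r c = c(?z := 0, u := c u + c ?z, w := c w + c ?z)" for c :: "int ^ 'p \<Rightarrow> real"
  have r: "0 \<le> r c a" "supp (r c) \<in> K" "comb (r c) = comb c" "min (r c u) (r c w) = c ?z"
    if c: "\<And>a. 0 \<le> c a" "supp c \<in> ?K" for c a
  proof -
    show "0 \<le> r c a" using c by (simp add: r_def)
    have fin: "finite (supp c)" using c(2) by (cases rule: star_subdivisionE) (use finite_mem in auto)
    have nuw: "\<not> (c u \<noteq> 0 \<and> c w \<noteq> 0)"
    proof
      assume "c u \<noteq> 0 \<and> c w \<noteq> 0"
      then have "{u, w} \<subseteq> supp c" by (auto simp: supp_def)
      with c(2) zu show False by (cases rule: star_subdivisionE) auto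
    qed
    have "min (c u) (c w) = 0" using nuw c(1)[of u] c(1)[of w] by (auto simp: min_def)
    then show "min (r c u) (r c w) = c ?z" using uw(2) zu by (auto simp: r_def min_def)
    show "comb (r c) = comb c"
      using edge_shift_comb[OF fin uw(2) zu, of "- c ?z"] by (simp add: r_def)
    show "supp (r c) \<in> K"
    proof (cases "supp c \<in> K")
      case True
      then have "c ?z = 0" using zA[OF True] by (auto simp: supp_def)
      then have "r c = c" by (auto simp: r_def)
      then show ?thesis using True by simp
    next
      case False
      obtain A where A: "supp c = insert ?z A" "A \<in> K" "A \<union> {u, w} \<in> K"
        by (rule star_subdivisionE[OF c(2)]) (use False that in auto)
      have "c ?z \<noteq> 0" using A by (auto simp: supp_def)
      then have pos: "0 < c ?z" using c(1)[of ?z] by simp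
      have "supp (r c) = A \<union> {u, w}"
      proof (rule Set.set_eqI)
        fix a
        have "c u + c ?z \<noteq> 0" "c w + c ?z \<noteq> 0" using pos c(1)[of u] c(1)[of w] by auto
        then show "a \<in> supp (r c) \<longleftrightarrow> a \<in> A \<union> {u, w}"
          using A(1) zA[OF A(2)] zu by (auto simp: supp_def r_def set_eq_iff)
      qed
      then show ?thesis using A by simp
    qed
  qed
  fix c c' :: "int ^ 'p \<Rightarrow> real"
  assume c: "\<And>a. 0 \<le> c a" "\<And>a. 0 \<le> c' a" "supp c \<in> ?K" "supp c' \<in> ?K" "comb c = comb c'"
  have req: "r c = r c'" by (rule unique) (use r c in auto)
  then have z: "c ?z = c' ?z" using r(4)[OF c(1,3)] r(4)[OF c(2,4)] by simp
  show "c = c'"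
  proof
    fix a
    show "c a = c' a" using fun_cong[OF req, of a] z by (auto simp: r_def split: if_splits)
  qed
next
  let ?z = "u + w" and ?K = "star_subdivision u w K"
  have zA: "A \<in> K \<Longrightarrow> ?z \<notin> A" for A using edge_midpoint_fresh[OF uw] .
  have zu: "?z \<noteq> u" "?z \<noteq> w" using zA[OF uw(1)] by auto
  fix v :: "real ^ 'p" assume "v \<in> orthant"
  then obtain c where c: "\<And>a. 0 \<le> c a" "supp c \<in> K" "comb c = v" using cover by blast
  define m where "m = min (c u) (c w)"
  have cz: "c ?z = 0" using zA[OF c(2)] by (auto simp: supp_def)
  define c' where "c' = c(?z := c ?z + m, u := c u - m, w := c w - m)"
  have "comb c' = v"
    using edge_shift_comb[OF finite_mem[OF c(2)] uw(2) zu] c(3) by (simp add: c'_def)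
  moreover have "0 \<le> c' a" for a using c(1) by (simp add: c'_def m_def)
  moreover have "supp c' \<in> ?K"
  proof (cases "m = 0")
    case True
    then have "c' = c" by (auto simp: c'_def cz)
    moreover have "\<not> {u, w} \<subseteq> supp c" using True c(1)[of u] c(1)[of w]
      by (auto simp: supp_def m_def min_def split: if_splits)
    ultimately show ?thesis using c(2) by (simp add: star_subdivision_def)
  next
    case False
    then have cuw: "c u \<noteq> 0" "c w \<noteq> 0"
      using c(1)[of u] c(1)[of w] by (auto simp: m_def min_def split: if_splits)
    let ?A = "supp c' - {?z}"
    have sub: "?A \<subseteq> supp c" using cuw by (auto simp: supp_def c'_def split: if_splits)
    have "c' u = 0 \<or> c' w = 0" using uw(2) zu by (auto simp: c'_def m_def min_def)
    then have n: "\<not> {u, w} \<subseteq> ?A" by (auto simp: supp_def)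
    have "?A \<union> {u, w} \<in> K" by (rule down[OF c(2)]) (use sub cuw in \<open>auto simp: supp_def\<close>)
    moreover have "supp c' = insert ?z ?A" using False cz zu by (auto simp: supp_def c'_def)
    ultimately show ?thesis using star_subdivision_newI[OF down[OF c(2) sub] n] by blast
  qed
  ultimately show "\<exists>c. (\<forall>a. 0 \<le> c a) \<and> supp c \<in> ?K \<and> comb c = v" by blast
qed

end

section \<open>Making every branch direction a ray\<close>

text \<open>For a set \<open>S\<close> of coordinate vectors, the coordinates on which \<open>S\<close> vanishes describe the quotient by
  the span of \<open>S\<close>.  The class of \<open>v\<close> lies in the relative interior of the image of the cone generated by
  \<open>supp n \<union> S\<close> and has coefficients \<open>n\<close> there.\<close>
definition relative_position ::
  "(int ^ 'p::finite) set set \<Rightarrow> (int ^ 'p) set \<Rightarrow> int ^ 'p \<Rightarrow> (int ^ 'p \<Rightarrow> nat) \<Rightarrow> bool" where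
  "relative_position K S v n \<longleftrightarrow> supp n \<inter> S = {} \<and> supp n \<union> S \<in> K \<and>
     (\<forall>i. (\<forall>s\<in>S. s $ i = 0) \<longrightarrow> v $ i = (\<Sum>a\<in>supp n. int (n a) * a $ i))"

context regular_complex
begin

lemma edge_shift_sum:
  fixes n n' :: "int ^ 'p \<Rightarrow> nat" and f :: "int ^ 'p \<Rightarrow> int"
  assumes fin: "finite F" "supp n \<subseteq> F" "supp n' \<subseteq> F" "u \<in> F" "w \<in> F" "u + w \<in> F"
    and ne: "u \<noteq> w" "u + w \<noteq> u" "u + w \<noteq> w"
    and eq: "\<And>a. a \<in> F - {u, w, u + w} \<Longrightarrow> n' a = n a"
  shows "(\<Sum>a\<in>supp n'. int (n' a) * f a) - (\<Sum>a\<in>supp n. int (n a) * f a)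
     = (int (n' u) - int (n u)) * f u + (int (n' w) - int (n w)) * f w
       + (int (n' (u + w)) - int (n (u + w))) * f (u + w)"
proof -
  have *: "(\<Sum>a\<in>supp m. int (m a) * f a) = int (m u) * f u + int (m w) * f w + int (m (u + w)) * f (u + w)
     + (\<Sum>a\<in>F - {u, w, u + w}. int (m a) * f a)" if "supp m \<subseteq> F" for m
  proof -
    have "(\<Sum>a\<in>supp m. int (m a) * f a) = (\<Sum>a\<in>F. int (m a) * f a)"
      using that fin by (intro sum.mono_neutral_left) (auto simp: supp_def)
    also have "\<dots> = (\<Sum>a\<in>F - {u, w, u + w}. int (m a) * f a) + (\<Sum>a\<in>{u, w, u + w}. int (m a) * f a)"
      by (rule sum.subset_diff) (use fin in auto)
    finally show ?thesis using ne by (simp add: algebra_simps)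
  qed
  have "(\<Sum>a\<in>F - {u, w, u + w}. int (n' a) * f a) = (\<Sum>a\<in>F - {u, w, u + w}. int (n a) * f a)"
    using eq by (intro sum.cong) auto
  then show ?thesis
    unfolding *[OF fin(2)] *[OF fin(3)] by (simp add: algebra_simps)
qed

text \<open>Only a cone that contains the edge is affected; there the common weight of \<open>u\<close> and \<open>w\<close> moves to
  \<open>u + w\<close>.  If one end lies in \<open>S\<close>, the whole weight of the other end moves to \<open>u + w\<close>, and the total is
  unchanged; if both carry weight, the total drops by the common weight.\<close>

lemma relative_position_star_subdivision:
  assumes uw: "{u, w} \<in> K" "u \<noteq> w" "\<not> {u, w} \<subseteq> S" and n: "relative_position K S v n"
  shows "\<exists>n'. relative_position (star_subdivision u w K) S v n' \<and> sum n' (supp n') \<le> sum n (supp n) \<and>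
    (n u \<noteq> 0 \<and> n w \<noteq> 0 \<longrightarrow> sum n' (supp n') < sum n (supp n))"
proof (cases "{u, w} \<subseteq> supp n \<union> S")
  case False
  then have "relative_position (star_subdivision u w K) S v n"
    using n star_subdivision_oldI[of "supp n \<union> S" K u w] by (simp add: relative_position_def)
  moreover have "\<not> (n u \<noteq> 0 \<and> n w \<noteq> 0)" using False by (auto simp: supp_def)
  ultimately show ?thesis by blast
next
  case True
  let ?z = "u + w" and ?K = "star_subdivision u w K"
  have U: "supp n \<inter> S = {}" "supp n \<union> S \<in> K"
    and v: "\<And>i. (\<forall>s\<in>S. s $ i = 0) \<Longrightarrow> v $ i = (\<Sum>a\<in>supp n. int (n a) * a $ i)"
    using n by (auto simp: relative_position_def)
  have zA: "A \<in> K \<Longrightarrow> ?z \<notin> A" for A using edge_midpoint_fresh[OF uw(1,2)] .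
  have zu: "?z \<noteq> u" "?z \<noteq> w" using zA[OF uw(1)] by auto
  have zn: "n ?z = 0" "?z \<notin> S" using zA[OF U(2)] by (auto simp: supp_def)
  \<comment> \<open>a generator in \<open>S\<close> counts as having infinite weight\<close>
  define m where "m = (if u \<in> S then n w else if w \<in> S then n u else min (n u) (n w))"
  have nS: "n a = 0" if "a \<in> S" for a using U(1) that by (auto simp: supp_def)
  have nz: "n a \<noteq> 0 \<longleftrightarrow> a \<notin> S" if "a = u \<or> a = w" for a using True U(1) that by (auto simp: supp_def)
  have m: "0 < m" "u \<notin> S \<Longrightarrow> m \<le> n u" "w \<notin> S \<Longrightarrow> m \<le> n w"
    using nz[of u] nz[of w] uw(3) by (auto simp: m_def)
  have mle: "u \<in> S \<Longrightarrow> m = n w" "w \<in> S \<Longrightarrow> m = n u"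
    using uw(3) by (auto simp: m_def)
  define n' where "n' = n(?z := m, u := n u - m, w := n w - m)"
  have zero: "n' u = 0 \<and> u \<notin> S \<or> n' w = 0 \<and> w \<notin> S"
    using uw(2,3) zu by (auto simp: n'_def m_def min_def)
  have n'S: "n' a = 0" if "a \<in> S" for a using nS[OF that] zn(2) that by (auto simp: n'_def)
  let ?A = "supp n' \<union> S - {?z}"
  have sub: "?A \<subseteq> supp n \<union> S" by (auto simp: supp_def n'_def split: if_splits)
  have "\<not> {u, w} \<subseteq> ?A" using zero by (auto simp: supp_def)
  moreover have "?A \<union> {u, w} \<in> K" by (rule down[OF U(2)]) (use sub True in auto)
  moreover have "n' ?z = m" using zu by (simp add: n'_def)
  then have "supp n' \<union> S = insert ?z ?A" using m(1) by (auto simp: supp_def)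
  ultimately have 1: "supp n' \<union> S \<in> ?K" using star_subdivision_newI[OF down[OF U(2) sub]] by blast
  let ?F = "supp n \<union> {u, w, ?z}"
  have shift: "(\<Sum>a\<in>supp n'. int (n' a) * f a) - (\<Sum>a\<in>supp n. int (n a) * f a)
     = (int (n' u) - int (n u)) * f u + (int (n' w) - int (n w)) * f w
       + (int (n' ?z) - int (n ?z)) * f ?z" for f
    by (rule edge_shift_sum[where F = ?F])
      (use finite_mem[OF U(2)] uw zu in \<open>auto simp: supp_def n'_def split: if_splits\<close>)
  have vals: "n' u = n u - m" "n' w = n w - m" "n' ?z = m" using uw zu by (auto simp: n'_def)
  have "v $ i = (\<Sum>a\<in>supp n'. int (n' a) * a $ i)" if "\<forall>s\<in>S. s $ i = 0" for i
  proof -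
    have u0: "u \<in> S \<Longrightarrow> u $ i = 0" "w \<in> S \<Longrightarrow> w $ i = 0" using that by auto
    show ?thesis
      using v[OF that] shift[of "\<lambda>a. a $ i"] m u0 zn nS[of u] nS[of w] unfolding vals
      by (cases "u \<in> S"; cases "w \<in> S") (auto simp: algebra_simps of_nat_diff)
  qed
  then have 2: "relative_position ?K S v n'" using 1 n'S by (auto simp: relative_position_def supp_def)
  have "int (sum n' (supp n')) - int (sum n (supp n)) = int (n u - m) - int (n u) + (int (n w - m) - int (n w)) + int m"
    using shift[of "\<lambda>_. 1"] zn(1) unfolding vals by simp
  moreover have "int (n u - m) = int (n u) - (if u \<in> S then 0 else int m)"
    "int (n w - m) = int (n w) - (if w \<in> S then 0 else int m)"
    using m(2,3) nS by auto
  ultimately have "int (sum n' (supp n')) - int (sum n (supp n))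
      = int m - (if u \<in> S then 0 else int m) - (if w \<in> S then 0 else int m)" by linarith
  then have "sum n' (supp n') \<le> sum n (supp n)" "n u \<noteq> 0 \<and> n w \<noteq> 0 \<longrightarrow> sum n' (supp n') < sum n (supp n)"
    using m(1) nz[of u] nz[of w] uw(3) by (auto split: if_splits simp del: of_nat_sum)
  then show ?thesis using 2 by blast
qed

end

text \<open>Induction on the sum of all coefficients: two rays \<open>u \<noteq> w\<close> in the support of the same \<open>n j\<close> are
  joined by an edge, and the edge lies in no \<open>S l\<close>, since \<open>E - S j\<close> has at most one element.\<close>

proposition exists_complex_with_rays:
  fixes S :: "'r::finite \<Rightarrow> (int ^ 'p::finite) set" and v :: "'r \<Rightarrow> int ^ 'p"
  assumes K0: "regular_complex K0" and n0: "\<And>j. relative_position K0 (S j) (v j) (n0 j)"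
    and SE: "\<And>j. S j \<subseteq> E" and E: "\<And>j a b. a \<in> E - S j \<Longrightarrow> b \<in> E - S j \<Longrightarrow> a = b"
  shows "\<exists>K n. regular_complex K \<and>
    (\<forall>j. relative_position K (S j) (v j) (n j) \<and> (\<forall>a\<in>supp (n j). \<forall>b\<in>supp (n j). a = b))"
proof -
  define ok where "ok K n \<longleftrightarrow> regular_complex K \<and> (\<forall>j. relative_position K (S j) (v j) (n j))"
    for K and n :: "'r \<Rightarrow> int ^ 'p \<Rightarrow> nat"
  define size where "size n = (\<Sum>j\<in>UNIV. sum (n j) (supp (n j)))" for n :: "'r \<Rightarrow> int ^ 'p \<Rightarrow> nat"
  have "\<exists>K' n'. regular_complex K' \<and> (\<forall>j. relative_position K' (S j) (v j) (n' j) \<and>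
      (\<forall>a\<in>supp (n' j). \<forall>b\<in>supp (n' j). a = b))" if "ok K n" for K n
    using that
  proof (induction "size n" arbitrary: K n rule: less_induct)
    case less
    interpret regular_complex K using less.prems by (simp add: ok_def)
    have rp: "relative_position K (S j) (v j) (n j)" for j using less.prems by (simp add: ok_def)
    show ?case
    proof (cases "\<forall>j. \<forall>a\<in>supp (n j). \<forall>b\<in>supp (n j). a = b")
      case True
      then show ?thesis using less.prems unfolding ok_def by blast
    next
      case False
      then obtain j0 u w where j0: "u \<in> supp (n j0)" "w \<in> supp (n j0)" "u \<noteq> w" by blast
      have uw: "{u, w} \<in> K"
        by (rule down[of "supp (n j0) \<union> S j0"]) (use rp[of j0] j0 in \<open>auto simp: relative_position_def\<close>)
      have nS: "\<not> {u, w} \<subseteq> S j" for j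
      proof
        assume "{u, w} \<subseteq> S j"
        moreover have "u \<notin> S j0" "w \<notin> S j0" using rp[of j0] j0 by (auto simp: relative_position_def)
        ultimately show False using E[of u j0 w] SE[of j] j0 by blast
      qed
      have "\<forall>j. \<exists>n'. relative_position (star_subdivision u w K) (S j) (v j) n' \<and> sum n' (supp n') \<le> sum (n j) (supp (n j)) \<and>
        (n j u \<noteq> 0 \<and> n j w \<noteq> 0 \<longrightarrow> sum n' (supp n') < sum (n j) (supp (n j)))"
        using relative_position_star_subdivision[OF uw j0(3) nS rp] by blast
      then obtain n' where n': "\<And>j. relative_position (star_subdivision u w K) (S j) (v j) (n' j)"
        "\<And>j. sum (n' j) (supp (n' j)) \<le> sum (n j) (supp (n j))"
        "\<And>j. n j u \<noteq> 0 \<and> n j w \<noteq> 0 \<Longrightarrow> sum (n' j) (supp (n' j)) < sum (n j) (supp (n j))"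
        by metis
      have "size n' < size n"
        unfolding size_def using n' j0 by (intro sum_strict_mono_ex1) (auto simp: supp_def)
      moreover have "ok (star_subdivision u w K) n'"
        using n'(1) regular_complex_star_subdivision[OF uw j0(3)] by (simp add: ok_def)
      ultimately show ?thesis using less.hyps by blast
    qed
  qed
  then show ?thesis using K0 n0 unfolding ok_def by blast
qed

section \<open>The fan of a regular complex\<close>

text \<open>A face that contains a sum of vectors of the cone contains the summands.  Hence all generators
  that occur in a vector of the face belong to the face.\<close>

lemma cone_face_gen_cone_subset:
  assumes A: "finite A" and \<tau>: "cone_face \<tau> (gen_cone A)"
  shows "\<exists>A'\<subseteq>A. \<tau> = gen_cone A'"
proof -
  have f: "\<tau> face_of gen_cone A" and ne: "\<tau> \<noteq> {}" using \<tau> by (auto simp: cone_face_def)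
  have sub: "\<tau> \<subseteq> gen_cone A" and conv: "convex \<tau>" using f by (auto simp: face_of_def)
  have sc: "c *\<^sub>R x \<in> \<tau>" if x: "x \<in> \<tau>" and c: "0 \<le> c" for x c
  proof -
    have xA: "x \<in> gen_cone A" using sub x by auto
    have "0 *\<^sub>R x \<in> \<tau> \<and> (c + 2) *\<^sub>R x \<in> \<tau>"
    proof (cases "x = 0")
      case True then show ?thesis using x by simp
    next
      case False
      \<comment> \<open>the summand \<open>2\<close> keeps \<open>x\<close> away from the end point for all \<open>c \<ge> 0\<close>\<close>
      have "x \<in> open_segment (0 *\<^sub>R x) ((c + 2) *\<^sub>R x)"
        unfolding in_segment using False c
        by (auto intro!: exI[of _ "1 / (c + 2)"])
      moreover have "0 *\<^sub>R x \<in> gen_cone A" "(c + 2) *\<^sub>R x \<in> gen_cone A"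
        by (rule convex_cone_scaleR[OF convex_cone_gen_cone _ xA], use c in simp)+
      ultimately show ?thesis using face_ofD[OF f _ _ _ x] by blast
    qed
    then have "closed_segment (0 *\<^sub>R x) ((c + 2) *\<^sub>R x) \<subseteq> \<tau>"
      using conv closed_segment_subset by blast
    moreover have "c *\<^sub>R x \<in> closed_segment (0 *\<^sub>R x) ((c + 2) *\<^sub>R x)"
      unfolding in_segment using c by (intro exI[of _ "c / (c + 2)"]) auto
    ultimately show ?thesis by blast
  qed
  have add: "x + y \<in> \<tau>" if "x \<in> \<tau>" "y \<in> \<tau>" for x y
  proof -
    have "(1/2) *\<^sub>R x + (1/2) *\<^sub>R y \<in> \<tau>" using conv that by (intro convexD) auto
    then have "2 *\<^sub>R ((1/2) *\<^sub>R x + (1/2) *\<^sub>R y) \<in> \<tau>" by (intro sc) auto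
    then show ?thesis by (simp add: scaleR_add_right)
  qed
  have cc: "convex_cone \<tau>"
    unfolding convex_cone_iff using sc add ne by (metis ex_in_conv order_refl scale_zero_left)
  define A' where "A' = {a \<in> A. real_vec a \<in> \<tau>}"
  have "gen_cone A' \<subseteq> \<tau>"
    unfolding gen_cone_def by (rule hull_minimal) (use cc in \<open>auto simp: A'_def\<close>)
  moreover have "\<tau> \<subseteq> gen_cone A'"
  proof
    fix x assume x: "x \<in> \<tau>"
    then obtain c where c: "\<forall>a. 0 \<le> c a" "supp c \<subseteq> A" "comb c = x"
      using sub mem_gen_cone[OF A] by blast
    have fin: "finite (supp c)" using c(2) A finite_subset by blast
    have "supp c \<subseteq> A'"
    proof
      fix a assume a: "a \<in> supp c"
      let ?y = "c a *\<^sub>R real_vec a" and ?r = "\<Sum>b\<in>supp c - {a}. c b *\<^sub>R real_vec b"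
      have xe: "x = ?y + ?r" using c(3) sum.remove[OF fin a, of "\<lambda>b. c b *\<^sub>R real_vec b"] by (simp add: comb_def)
      have yA: "c b *\<^sub>R real_vec b \<in> gen_cone A" if "b \<in> supp c" for b
        using c that by (intro convex_cone_scaleR[OF convex_cone_gen_cone] real_vec_in_gen_cone) auto
      have rA: "?r \<in> gen_cone A" by (rule sum_in_convex_cone[OF convex_cone_gen_cone]) (use yA in auto)
      have "?y \<in> \<tau>"
      proof (cases "?y = ?r")
        case True
        then have "?y = (1/2) *\<^sub>R x" using xe by (simp add: scaleR_add_right[symmetric] flip: scaleR_2)
        then show ?thesis using sc[OF x, of "1/2"] by simp
      next
        case False
        have "x \<in> open_segment (2 *\<^sub>R ?y) (2 *\<^sub>R ?r)"
          unfolding in_segment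
        proof (intro conjI exI[of _ "1/2"])
          show "2 *\<^sub>R ?y \<noteq> 2 *\<^sub>R ?r" using False by (metis scaleR_left_imp_eq zero_neq_numeral)
        qed (use xe in simp_all)
        moreover have "2 *\<^sub>R ?y \<in> gen_cone A" "2 *\<^sub>R ?r \<in> gen_cone A"
          by (rule convex_cone_scaleR[OF convex_cone_gen_cone]; use yA[OF a] rA in simp)+
        ultimately have "2 *\<^sub>R ?y \<in> \<tau>" using face_ofD[OF f _ _ _ x] by blast
        then show ?thesis using sc[of "2 *\<^sub>R ?y" "1/2"] by simp
      qed
      then have "(1 / c a) *\<^sub>R ?y \<in> \<tau>" by (rule sc) (use c(1) in simp)
      moreover have "c a \<noteq> 0" using a by (simp add: supp_def)
      ultimately have "real_vec a \<in> \<tau>" by simp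
      then show "a \<in> A'" using a c(2) by (auto simp: A'_def)
    qed
    then show "x \<in> gen_cone A'" using c mem_gen_cone[of A'] A by (auto simp: A'_def)
  qed
  ultimately show ?thesis by (intro exI[of _ A']) (auto simp: A'_def)
qed

context regular_complex
begin

lemma gen_cone_subset_orthant: "A \<in> K \<Longrightarrow> gen_cone A \<subseteq> orthant"
  unfolding gen_cone_def
  by (rule hull_minimal)
    (auto simp: orthant_def convex_cone_iff nonneg)

lemma gen_cone_eqD:
  assumes "A \<in> K" "c \<in> {c. (\<forall>a. 0 \<le> c a) \<and> supp c \<in> K}" "comb c \<in> gen_cone A"
  shows "supp c \<subseteq> A"
proof -
  obtain d where d: "\<forall>a. 0 \<le> d a" "supp d \<subseteq> A" "comb d = comb c"
    using assms(3) mem_gen_cone[OF finite_mem[OF assms(1)], of "comb c"] by blast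
  then have "d = c" using assms down by (intro unique) auto
  then show ?thesis using d by simp
qed

lemma gen_cone_Int:
  assumes "A \<in> K" "B \<in> K"
  shows "gen_cone A \<inter> gen_cone B = gen_cone (A \<inter> B)"
proof
  show "gen_cone (A \<inter> B) \<subseteq> gen_cone A \<inter> gen_cone B" using gen_cone_mono by (metis Int_lower1 Int_lower2 le_inf_iff)
  show "gen_cone A \<inter> gen_cone B \<subseteq> gen_cone (A \<inter> B)"
  proof
    fix x assume x: "x \<in> gen_cone A \<inter> gen_cone B"
    then obtain c where c: "\<forall>a. 0 \<le> c a" "supp c \<subseteq> A" "comb c = x"
      using mem_gen_cone[OF finite_mem[OF assms(1)], of x] by blast
    then have "supp c \<subseteq> B" using gen_cone_eqD[OF assms(2), of c] down[OF assms(1)] x by auto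
    then show "x \<in> gen_cone (A \<inter> B)" using c assms finite_mem mem_gen_cone[of "A \<inter> B"] by auto
  qed
qed

lemma generator_in_gen_cone:
  assumes "A \<in> K" "{a} \<in> K" "real_vec a \<in> gen_cone A"
  shows "a \<in> A"
proof -
  define c :: "int ^ 'p \<Rightarrow> real" where "c b = (if b = a then 1 else 0)" for b
  have s: "supp c = {a}" by (auto simp: supp_def c_def)
  have "comb c = real_vec a" unfolding comb_def s by (simp add: c_def)
  moreover have "\<forall>a. 0 \<le> c a" by (simp add: c_def)
  ultimately have "supp c \<subseteq> A" using assms(2,3) s by (intro gen_cone_eqD[OF assms(1)]) simp_all
  then show ?thesis using s by simp
qed

lemma gen_cone_subset_iff: "A \<in> K \<Longrightarrow> B \<in> K \<Longrightarrow> gen_cone A \<subseteq> gen_cone B \<longleftrightarrow> A \<subseteq> B"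
proof
  assume A: "A \<in> K" and B: "B \<in> K" and sub: "gen_cone A \<subseteq> gen_cone B"
  show "A \<subseteq> B"
  proof
    fix a assume a: "a \<in> A"
    show "a \<in> B"
      by (rule generator_in_gen_cone[OF B down[OF A]]) (use a sub real_vec_in_gen_cone[OF a] in auto)
  qed
qed (rule gen_cone_mono)

lemma cone_face_gen_cone:
  assumes A: "A \<in> K" and sub: "A' \<subseteq> A"
  shows "cone_face (gen_cone A') (gen_cone A)"
  unfolding cone_face_def face_of_def
proof (intro conjI ballI impI)
  have A': "A' \<in> K" using down assms by blast
  show "gen_cone A' \<subseteq> gen_cone A" using gen_cone_mono[OF sub] .
  show "convex (gen_cone A')" using convex_cone_gen_cone by (auto simp: convex_cone_def)
  show "gen_cone A' \<noteq> {}" using convex_cone_gen_cone by (auto simp: convex_cone_def)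
  fix x y z assume xy: "x \<in> gen_cone A" "y \<in> gen_cone A" and z: "z \<in> gen_cone A'" "z \<in> open_segment x y"
  obtain c d where c: "\<forall>a. 0 \<le> c a" "supp c \<subseteq> A" "comb c = x" and d: "\<forall>a. 0 \<le> d a" "supp d \<subseteq> A" "comb d = y"
    using xy mem_gen_cone[OF finite_mem[OF A]] by blast
  obtain t where t: "0 < t" "t < 1" "z = (1 - t) *\<^sub>R x + t *\<^sub>R y" using z(2) by (auto simp: in_segment)
  define e where "e a = (1 - t) * c a + t * d a" for a
  have "supp e \<subseteq> supp c \<union> supp d" by (auto simp: supp_def e_def)
  then have s: "supp e \<subseteq> A" using c d by blast
  have "comb e = (1 - t) *\<^sub>R comb c + t *\<^sub>R comb d"
    unfolding comb_eq[OF finite_mem[OF A] s] comb_eq[OF finite_mem[OF A] c(2)] comb_eq[OF finite_mem[OF A] d(2)]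
    by (simp add: e_def scaleR_add_left sum.distrib scaleR_sum_right)
  then have "comb e = z" using c d t by simp
  moreover have e: "0 \<le> e a" for a using c d t by (simp add: e_def)
  ultimately have e': "supp e \<subseteq> A'" using gen_cone_eqD[OF A', of e] down[OF A s] z by auto
  have "supp c \<subseteq> supp e" "supp d \<subseteq> supp e"
    using c(1) d(1) t by (auto simp: supp_def e_def add_nonneg_eq_0_iff)
  then have "supp c \<subseteq> A'" "supp d \<subseteq> A'" using e' by simp_all
  then show "x \<in> gen_cone A'" "y \<in> gen_cone A'"
    unfolding mem_gen_cone[OF finite_mem[OF A']] using c d by auto
qed

lemma cone_face_gen_cone_iff:
  assumes "A \<in> K" "B \<in> K"
  shows "cone_face (gen_cone B) (gen_cone A) \<longleftrightarrow> B \<subseteq> A"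
proof
  assume "cone_face (gen_cone B) (gen_cone A)"
  then have "gen_cone B \<subseteq> gen_cone A" by (simp add: cone_face_def face_of_def)
  then show "B \<subseteq> A" using gen_cone_subset_iff[OF assms(2,1)] by simp
qed (rule cone_face_gen_cone[OF assms(1)])

proposition regular_subdivision_gen_cone: "regular_subdivision (gen_cone ` K)"
  unfolding regular_subdivision_def fan_def
proof (intro conjI ballI allI impI)
  show "finite (gen_cone ` K)" using finite_K by simp
  show "\<Union> (gen_cone ` K) = orthant"
  proof
    show "orthant \<subseteq> \<Union> (gen_cone ` K)"
    proof
      fix x :: "real ^ 'p" assume "x \<in> orthant"
      then obtain c where c: "\<forall>a. 0 \<le> c a" "supp c \<in> K" "comb c = x" using cover by blast
      then have "x \<in> gen_cone (supp c)" using mem_gen_cone[OF finite_mem[OF c(2)], of x] by blast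
      then show "x \<in> \<Union> (gen_cone ` K)" using c by blast
    qed
  qed (use gen_cone_subset_orthant in auto)
next
  fix \<sigma> assume "\<sigma> \<in> gen_cone ` K"
  then obtain A where A: "A \<in> K" "\<sigma> = gen_cone A" by auto
  show "rational_cone \<sigma>" unfolding rational_cone_def using finite_mem[OF A(1)] A(2) unfolding gen_cone_def by blast
  have "x = 0" if "x \<in> \<sigma>" "- x \<in> \<sigma>" for x
  proof -
    have "x \<in> orthant" "- x \<in> orthant" using that gen_cone_subset_orthant[OF A(1)] A(2) by auto
    then have "0 \<le> x $ i \<and> 0 \<le> - x $ i" for i unfolding orthant_def by auto
    then have "x $ i = 0" for i by (metis antisym neg_0_le_iff_le)
    then show ?thesis by (simp add: vec_eq_iff)
  qed
  then have "\<sigma> \<inter> uminus ` \<sigma> \<subseteq> {0}" by auto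
  moreover have "0 \<in> \<sigma>" using convex_cone_contains_0[OF convex_cone_gen_cone] A(2) by blast
  then have "0 \<in> \<sigma> \<inter> uminus ` \<sigma>" by (auto intro: image_eqI[of _ _ 0])
  ultimately show "strictly_convex_cone \<sigma>"
    using A convex_cone_gen_cone by (auto simp: strictly_convex_cone_def)
  show "regular_cone \<sigma>"
  proof -
    obtain b d where bd: "dual_bases b d" "A \<subseteq> range b" using basis A by blast
    have "A = b ` (b -` A)" using bd by auto
    then have "real_vec ` A = (\<lambda>i. real_vec (b i)) ` (b -` A)" by (metis image_image)
    then have "\<sigma> = convex_cone hull ((\<lambda>i. real_vec (b i)) ` (b -` A))"
      using A(2) by (simp add: gen_cone_def)
    then show ?thesis unfolding regular_cone_def using dual_bases_lattice_basis[OF bd(1)] by blast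
  qed
  show "\<tau> \<in> gen_cone ` K" if "cone_face \<tau> \<sigma>" for \<tau>
  proof -
    obtain A' where "A' \<subseteq> A" "\<tau> = gen_cone A'"
      using cone_face_gen_cone_subset[OF finite_mem[OF A(1)]] \<open>cone_face \<tau> \<sigma>\<close> A(2) by blast
    then show ?thesis using down[OF A(1)] by blast
  qed
  fix \<tau> assume "\<tau> \<in> gen_cone ` K"
  then obtain B where B: "B \<in> K" "\<tau> = gen_cone B" by auto
  show "cone_face (\<sigma> \<inter> \<tau>) \<sigma>" "cone_face (\<sigma> \<inter> \<tau>) \<tau>"
    using A B gen_cone_Int cone_face_gen_cone by auto
qed

end

section \<open>Formal power series in several variables\<close>

lemma TR_simps [simp]:
  "carrier TR = UNIV" "x \<otimes>\<^bsub>TR\<^esub> y = x * y" "x \<oplus>\<^bsub>TR\<^esub> y = x + y" "\<one>\<^bsub>TR\<^esub> = 1" "\<zero>\<^bsub>TR\<^esub> = 0"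
  by (simp_all add: ring_of_type_algebra_def)

lemma mcoeff_simps [simp]:
  "mcoeff 0 e = 0" "mcoeff 1 e = (if e = 0 then 1 else 0)"
  "mcoeff (f + g) e = mcoeff f e + mcoeff g e" "mcoeff (f - g) e = mcoeff f e - mcoeff g e"
  "mcoeff (mconst c) e = (if e = 0 then c else 0)"
  by (transfer; simp)+

lemma mcoeff_mult: "mcoeff (f * g) e = (\<Sum>(a, b)\<in>splittings e. mcoeff f a * mcoeff g b)"
  by transfer simp

lemma mconst_0 [simp]: "mconst 0 = 0" and mconst_1 [simp]: "mconst 1 = 1"
  by (rule mfps_eqI; simp)+

lemma vec_add_eq_0_nat: "a + b = (0 :: nat ^ 'n) \<longleftrightarrow> a = 0 \<and> b = 0"
  by (auto simp: vec_eq_iff)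

lemma mcoeff_mult_0: "mcoeff (f * g) 0 = mcoeff f 0 * mcoeff g 0"
proof -
  have "splittings (0 :: nat ^ 'b) = {(0, 0)}" by (auto simp: splittings_def vec_add_eq_0_nat)
  then show ?thesis by (simp add: mcoeff_mult)
qed

lemma mcoeff_mvar_0 [simp]: "mcoeff (mvar i) 0 = 0"
  by transfer (auto simp: vec_eq_iff axis_def)

lemma mcoeff_mvar_mult:
  fixes f :: "('k::comm_ring_1, 'n::finite) mfps"
  shows "mcoeff (mvar i * f) e = (if e $ i = 0 then 0 else mcoeff f (e - axis i 1))"
proof (cases "e $ i = 0")
  case True
  have "mcoeff (mvar i) a * mcoeff f b = 0" if "(a, b) \<in> splittings e" for a b
  proof -
    have "a $ i = 0" using True that by (auto simp: splittings_def)
    then have "a \<noteq> axis i 1" by auto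
    then show ?thesis by (simp add: mvar.rep_eq)
  qed
  then have "mcoeff (mvar i * f) e = 0" unfolding mcoeff_mult by (intro sum.neutral) auto
  then show ?thesis using True by simp
next
  case False
  have s: "axis i 1 + (e - axis i 1) = e" using False by (auto simp: vec_eq_iff axis_def)
  have "(\<Sum>(a, b)\<in>splittings e. mcoeff (mvar i) a * mcoeff f b)
      = (\<Sum>(a, b)\<in>{(axis i 1, e - axis i 1)}. mcoeff (mvar i) a * mcoeff f b)"
  proof (rule sum.mono_neutral_right[OF finite_splittings])
    show "{(axis i 1, e - axis i 1)} \<subseteq> splittings e" using s by (simp add: splittings_def)
    show "\<forall>p\<in>splittings e - {(axis i 1, e - axis i 1)}. (case p of (a, b) \<Rightarrow> mcoeff (mvar i) a * mcoeff f b) = 0"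
    proof
      fix p assume p: "p \<in> splittings e - {(axis i 1, e - axis i 1)}"
      then have "fst p \<noteq> axis i 1" by (auto simp: splittings_def)
      then show "(case p of (a, b) \<Rightarrow> mcoeff (mvar i) a * mcoeff f b) = 0"
        by (simp add: mvar.rep_eq case_prod_beta)
    qed
  qed
  then show ?thesis using False by (simp add: mcoeff_mult mvar.rep_eq)
qed

definition total_degree :: "nat ^ 'n::finite \<Rightarrow> nat" where
  "total_degree e = (\<Sum>i\<in>UNIV. e $ i)"

lemma total_degree_add: "total_degree (a + b) = total_degree a + total_degree b"
  by (simp add: total_degree_def sum.distrib)

lemma total_degree_0_iff: "total_degree e = 0 \<longleftrightarrow> e = 0"
  by (auto simp: total_degree_def vec_eq_iff)

lemma mcoeff_power_eq_0:
  assumes "mcoeff h 0 = 0" "total_degree e < n"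
  shows "mcoeff (h ^ n) e = 0"
  using assms(2)
proof (induction n arbitrary: e)
  case (Suc n)
  have "mcoeff h a * mcoeff (h ^ n) b = 0" if "(a, b) \<in> splittings e" for a b
  proof (cases "a = 0")
    case False
    then have "total_degree b < n"
      using that Suc.prems total_degree_0_iff[of a] by (auto simp: splittings_def total_degree_add)
    then show ?thesis using Suc.IH by simp
  qed (use assms in simp)
  then show ?case by (auto simp: mcoeff_mult intro!: sum.neutral)
qed simp

text \<open>After scaling, \<open>f = 1 - h\<close> with \<open>h\<close> free of a constant term.  As \<open>h\<^sup>n\<close> has no terms of degree below
  \<open>n\<close>, each coefficient of the geometric series of \<open>h\<close> is a finite sum.\<close>

proposition mfps_unit:
  fixes f :: "('k::field, 'n::finite) mfps"
  assumes "mcoeff f 0 \<noteq> 0"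
  shows "\<exists>g. f * g = 1"
proof -
  define h where "h = 1 - mconst (inverse (mcoeff f 0)) * f"
  have h0: "mcoeff h 0 = 0" using assms by (simp add: h_def mcoeff_mult_0)
  define P where "P N = (\<Sum>n\<le>N. h ^ n)" for N
  define g where "g = Abs_mfps (\<lambda>e. mcoeff (P (total_degree e)) e)"
  have mcoeff_sum: "mcoeff (sum F A) e = (\<Sum>x\<in>A. mcoeff (F x) e)" for F :: "nat \<Rightarrow> ('k, 'n) mfps" and A e
    by (induction A rule: infinite_finite_induct) auto
  have P: "mcoeff (P N) e = mcoeff g e" if "total_degree e \<le> N" for N e
  proof -
    have "(\<Sum>n\<le>N. mcoeff (h ^ n) e) = (\<Sum>n\<le>total_degree e. mcoeff (h ^ n) e)"
      using that h0 by (intro sum.mono_neutral_right) (auto intro: mcoeff_power_eq_0)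
    then show ?thesis by (simp add: g_def Abs_mfps_inverse P_def mcoeff_sum)
  qed
  have "(1 - h) * g = 1"
  proof (rule mfps_eqI)
    fix e :: "nat ^ 'n"
    let ?N = "total_degree e"
    have "mcoeff ((1 - h) * g) e = mcoeff ((1 - h) * P ?N) e"
      unfolding mcoeff_mult
      by (intro sum.cong) (auto simp: splittings_def total_degree_add P)
    also have "(1 - h) * P ?N = 1 - h ^ Suc ?N"
      unfolding P_def using one_diff_power_eq[of h "Suc ?N"]
      by (simp only: lessThan_Suc_atMost)
    also have "mcoeff (1 - h ^ Suc ?N) e = mcoeff 1 e"
      using mcoeff_power_eq_0[OF h0, of e "Suc ?N"] by simp
    finally show "mcoeff ((1 - h) * g) e = mcoeff 1 e" .
  qed
  then have "f * (mconst (inverse (mcoeff f 0)) * g) = 1" by (simp add: h_def algebra_simps)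
  then show ?thesis by blast
qed

text \<open>A proper ideal contains no unit, so all its elements are free of a constant term.\<close>

lemma max_ideal_mfps: "max_ideal (TR :: ('k::field, 'n::finite) mfps ring) = {f. mcoeff f 0 = 0}"
proof -
  let ?R = "TR :: ('k, 'n) mfps ring" and ?M = "{f :: ('k, 'n) mfps. mcoeff f 0 = 0}"
  interpret R: cring ?R by (rule cring_from_type_algebra)
  have inv: "\<ominus>\<^bsub>?R\<^esub> f = - f" for f
    by (rule R.minus_equality) simp_all
  have I: "ideal ?M ?R"
  proof (rule idealI)
    show "subgroup ?M (add_monoid ?R)"
    proof (rule subgroup.intro)
      show "inv\<^bsub>add_monoid ?R\<^esub> f \<in> ?M" if "f \<in> ?M" for f
        unfolding inv[unfolded a_inv_def] using that by (simp add: uminus_mfps.rep_eq)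
    qed simp_all
  qed (auto simp: mcoeff_mult_0 R.ring_axioms)
  have unit: "f \<in> ?M" if J: "ideal J ?R" "J \<noteq> UNIV" and f: "f \<in> J" for J f
  proof (rule ccontr)
    assume "f \<notin> ?M"
    then obtain g where g: "f * g = 1" using mfps_unit by auto
    then have "1 \<in> J" using ideal.I_r_closed[OF J(1) f, of g] by simp
    then show False using ideal.one_imp_carrier[OF J(1)] J(2) by simp
  qed
  have max: "maximalideal ?M ?R"
  proof (rule maximalidealI[OF I])
    have "1 \<notin> ?M" by simp
    then show "carrier ?R \<noteq> ?M" by (metis TR_simps(1) UNIV_I)
    show "J = ?M \<or> J = carrier ?R" if "ideal J ?R" "?M \<subseteq> J" for J
      using unit[OF that(1)] that(2) by auto
  qed
  show ?thesis
    unfolding max_ideal_def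
  proof (rule the_equality)
    show "maximalideal ?M ?R" by (rule max)
    fix M assume M: "maximalideal M ?R"
    interpret M: maximalideal M ?R by (rule M)
    have "M \<subseteq> ?M" using unit[OF M.is_ideal] M.I_notcarr by auto
    then show "M = ?M" using M.I_maximal[OF I] maximalideal.I_notcarr[OF max] by auto
  qed
qed

section \<open>Formal arcs\<close>

text \<open>A formal arc \<open>Spec k[[t]] \<rightarrow> k\<^sup>p\<close>, such as the normalization of a branch followed by its
  inclusion.\<close>

locale formal_arc =
  fixes \<theta> :: "('k::field, 'p::finite) mfps \<Rightarrow> 'k fps"
  assumes hom_add: "\<theta> (f + g) = \<theta> f + \<theta> g"
    and hom_mult: "\<theta> (f * g) = \<theta> f * \<theta> g"
    and hom_const: "\<theta> (mconst c) = fps_const c"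
begin

lemma hom_0: "\<theta> 0 = 0" using hom_const[of 0] by simp
lemma hom_1: "\<theta> 1 = 1" using hom_const[of 1] by simp
lemma hom_diff: "\<theta> (f - g) = \<theta> f - \<theta> g" using hom_add[of "f - g" g] by simp
lemma hom_uminus: "\<theta> (- f) = - \<theta> f" using hom_diff[of 0 f] by (simp add: hom_0)
lemma hom_power: "\<theta> (f ^ n) = \<theta> f ^ n" by (induction n) (auto simp: hom_1 hom_mult)
lemma hom_prod: "\<theta> (prod F A) = (\<Prod>x\<in>A. \<theta> (F x))"
  by (induction A rule: infinite_finite_induct) (auto simp: hom_1 hom_mult)
lemma hom_sum: "\<theta> (sum F A) = (\<Sum>x\<in>A. \<theta> (F x))"
  by (induction A rule: infinite_finite_induct) (auto simp: hom_0 hom_add)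

text \<open>If \<open>\<theta> f\<close> had a constant term \<open>c \<noteq> 0\<close>, the unit \<open>f - c\<close> would have a non-unit as its image.\<close>

lemma local_hom:
  assumes "mcoeff f 0 = 0"
  shows "fps_nth (\<theta> f) 0 = 0"
proof (rule ccontr)
  assume c: "fps_nth (\<theta> f) 0 \<noteq> 0"
  then obtain g where "(f - mconst (fps_nth (\<theta> f) 0)) * g = 1"
    using mfps_unit[of "f - mconst (fps_nth (\<theta> f) 0)"] assms by auto
  then have "(\<theta> f - fps_const (fps_nth (\<theta> f) 0)) * \<theta> g = 1"
    by (metis hom_1 hom_const hom_diff hom_mult)
  then have "fps_nth ((\<theta> f - fps_const (fps_nth (\<theta> f) 0)) * \<theta> g) 0 = 1" by simp
  then show False by simp
qed

end

definition series_in_var :: "'p::finite \<Rightarrow> 'k::zero fps \<Rightarrow> ('k, 'p) mfps" where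
  "series_in_var s F = Abs_mfps (\<lambda>e. if \<forall>i. i \<noteq> s \<longrightarrow> e $ i = 0 then fps_nth F (e $ s) else 0)"

text \<open>Iterated, this splits a series in one variable into a polynomial and a multiple of a high power of
  the variable.  That is how the image of an infinite series under an arc is controlled.\<close>

lemma series_in_var_step:
  fixes F :: "'k::comm_ring_1 fps"
  shows
  "series_in_var s F = mconst (fps_nth F 0) + mvar s * series_in_var s (fps_shift 1 F)"
proof (rule mfps_eqI)
  fix e
  show "mcoeff (series_in_var s F) e = mcoeff (mconst (fps_nth F 0) + mvar s * series_in_var s (fps_shift 1 F)) e"
  proof (cases "e $ s = 0")
    case True
    then have "(\<forall>i. i \<noteq> s \<longrightarrow> e $ i = 0) \<longleftrightarrow> e = 0" unfolding vec_eq_iff by (metis zero_index)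
    then show ?thesis using True
      by (auto simp: series_in_var_def Abs_mfps_inverse mcoeff_mvar_mult)
  next
    case False
    then have "e \<noteq> 0" by auto
    then show ?thesis using False
      by (auto simp: series_in_var_def Abs_mfps_inverse mcoeff_mvar_mult axis_def)
  qed
qed

context formal_arc
begin

text \<open>Reducing the exponents \<open>r \<cdot> n\<^sub>i\<close> modulo \<open>d\<close> makes them nonnegative and does not change the order of
  the monomial modulo \<open>d\<close>.\<close>

lemma monomials_of_all_residues:
  assumes J: "\<And>i. i \<in> J \<Longrightarrow> \<theta> (mvar i) \<noteq> 0" and n: "(\<Sum>i\<in>J. n i * int (subdegree (\<theta> (mvar i)))) = 1"
    and d: "0 < d"
  shows "\<exists>f. \<theta> f \<noteq> 0 \<and> subdegree (\<theta> f) mod d = r mod d"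
proof -
  define e where "e i = nat ((int r * n i) mod int d)" for i
  let ?o = "\<lambda>i. subdegree (\<theta> (mvar i))"
  have "int (\<Sum>i\<in>J. e i * ?o i) = (\<Sum>i\<in>J. ((int r * n i) mod int d) * int (?o i))"
    using d by (simp add: e_def)
  also have "\<dots> mod int d = (\<Sum>i\<in>J. (int r * n i) * int (?o i)) mod int d"
    by (subst (1 2) mod_sum_eq[symmetric]) (simp add: mod_mult_left_eq)
  also have "(\<Sum>i\<in>J. (int r * n i) * int (?o i)) = int r"
    using n by (simp add: mult.assoc flip: sum_distrib_left)
  finally have "(\<Sum>i\<in>J. e i * ?o i) mod d = r mod d"
    by (metis nat_int zmod_int)
  moreover have "\<theta> (\<Prod>i\<in>J. mvar i ^ e i) = (\<Prod>i\<in>J. \<theta> (mvar i) ^ e i)"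
    by (simp add: hom_prod hom_power)
  moreover have "finite J" by simp
  then have "(\<Prod>i\<in>J. \<theta> (mvar i) ^ e i) \<noteq> 0" "subdegree (\<Prod>i\<in>J. \<theta> (mvar i) ^ e i) = (\<Sum>i\<in>J. e i * ?o i)"
    using J by (simp_all add: subdegree_prod)
  ultimately show ?thesis by (intro exI[of _ "\<Prod>i\<in>J. mvar i ^ e i"]) auto
qed

text \<open>With \<open>d = ord z\<^sub>s\<close>, there is a monomial in every residue class modulo \<open>d\<close>; multiplying it by the powers
  of \<open>z\<^sub>s\<close> reaches all larger orders of that class.\<close>

lemma all_large_orders:
  assumes J: "\<And>i. i \<in> J \<Longrightarrow> \<theta> (mvar i) \<noteq> 0" and n: "(\<Sum>i\<in>J. n i * int (subdegree (\<theta> (mvar i)))) = 1"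
    and s: "s \<in> J" "0 < subdegree (\<theta> (mvar s))"
  shows "\<exists>C. \<forall>N\<ge>C. \<exists>f. \<theta> f \<noteq> 0 \<and> subdegree (\<theta> f) = N"
proof -
  define d where "d = subdegree (\<theta> (mvar s))"
  have "\<forall>r. \<exists>f. \<theta> f \<noteq> 0 \<and> subdegree (\<theta> f) mod d = r mod d"
    using monomials_of_all_residues[OF J n] s(2) by (simp add: d_def)
  then obtain g where g: "\<And>r. \<theta> (g r) \<noteq> 0" "\<And>r. subdegree (\<theta> (g r)) mod d = r mod d" by metis
  define C where "C = (\<Sum>r<d. subdegree (\<theta> (g r)))"
  have "\<exists>f. \<theta> f \<noteq> 0 \<and> subdegree (\<theta> f) = N" if N: "C \<le> N" for N
  proof -
    let ?r = "N mod d" let ?o = "subdegree (\<theta> (g ?r))"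
    have "?r < d" using s(2) by (simp add: d_def)
    then have "?o \<le> C" unfolding C_def by (intro member_le_sum) auto
    then have le: "?o \<le> N" using N by simp
    have "?o mod d = N mod d" using g(2)[of ?r] by simp
    then have "d dvd N - ?o" using le by (metis mod_eq_dvd_iff_nat)
    then obtain q where q: "N - ?o = d * q" by (elim dvdE)
    have "\<theta> (g ?r * mvar s ^ q) = \<theta> (g ?r) * \<theta> (mvar s) ^ q" by (simp add: hom_mult hom_power)
    then show ?thesis using g(1)[of ?r] J[OF s(1)] q le
      by (intro exI[of _ "g ?r * mvar s ^ q"]) (auto simp: d_def mult.commute)
  qed
  then show ?thesis by blast
qed

lemma eliminate_leading_terms:
  assumes h: "\<And>i. \<theta> (h i) \<noteq> 0" "\<And>i. subdegree (\<theta> (h i)) = C + i" and g: "\<forall>k<C. fps_nth g k = 0"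
  shows "\<exists>a. \<forall>k<C + m. fps_nth (g - (\<Sum>i<m. fps_const (a i) * \<theta> (h i))) k = 0"
proof (induction m)
  case 0 then show ?case using g by simp
next
  case (Suc m)
  then obtain a where a: "\<forall>k<C + m. fps_nth (g - (\<Sum>i<m. fps_const (a i) * \<theta> (h i))) k = 0" by blast
  let ?r = "g - (\<Sum>i<m. fps_const (a i) * \<theta> (h i))"
  define b where "b = a(m := fps_nth ?r (C + m) / fps_nth (\<theta> (h m)) (C + m))"
  have nz: "fps_nth (\<theta> (h m)) (C + m) \<noteq> 0" using h[of m] by (metis nth_subdegree_nonzero)
  have eq: "(g - (\<Sum>i<Suc m. fps_const (b i) * \<theta> (h i))) = ?r - fps_const (b m) * \<theta> (h m)"
  proof -
    have "(\<Sum>i<m. fps_const (b i) * \<theta> (h i)) = (\<Sum>i<m. fps_const (a i) * \<theta> (h i))"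
      by (rule sum.cong) (auto simp: b_def)
    then show ?thesis by (simp add: algebra_simps)
  qed
  have z: "fps_nth (?r - fps_const (b m) * \<theta> (h m)) k = 0" if "k < C + Suc m" for k
  proof (cases "k = C + m")
    case True
    have bm: "b m = fps_nth ?r (C + m) / fps_nth (\<theta> (h m)) (C + m)" by (simp add: b_def)
    show ?thesis unfolding True fps_sub_nth[of ?r] fps_mult_left_const_nth bm using nz by simp
  next
    case False
    then have k: "k < C + m" using that by simp
    have "fps_nth (\<theta> (h m)) k = 0" by (rule nth_less_subdegree_zero) (use k h(2) in simp)
    moreover have "fps_nth ?r k = 0" using a k by blast
    ultimately show ?thesis unfolding fps_sub_nth[of ?r] fps_mult_left_const_nth by simp
  qed
  show ?case
  proof (intro exI[of _ b] allI impI)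
    fix k assume "k < C + Suc m"
    then show "fps_nth (g - (\<Sum>i<Suc m. fps_const (b i) * \<theta> (h i))) k = 0"
      unfolding eq by (rule z)
  qed
qed

text \<open>Let \<open>w\<close> be the image of \<open>z\<^sub>s\<close> and \<open>d\<close> its order, and choose \<open>h\<^sub>i\<close> of order \<open>C + i\<close> for \<open>i < d\<close>.  Eliminating
  \<open>d\<close> leading terms at a time and dividing by \<open>w\<close> expands a series of order at least \<open>C\<close> as
  \<open>\<Sum>\<^sub>n w\<^sup>n \<Sum>\<^sub>i a\<^sub>n\<^sub>i \<theta>(h\<^sub>i)\<close>.  The coefficients belonging to \<open>h\<^sub>i\<close> form a power series in \<open>z\<^sub>s\<close> alone, and the error made
  by replacing \<open>w\<close> by \<open>z\<^sub>s\<close> in it is divisible by every power of \<open>w\<close>.\<close>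

proposition conductor:
  assumes J: "\<And>i. i \<in> J \<Longrightarrow> \<theta> (mvar i) \<noteq> 0" and n: "(\<Sum>i\<in>J. n i * int (subdegree (\<theta> (mvar i)))) = 1"
    and s: "s \<in> J" "0 < subdegree (\<theta> (mvar s))"
  shows "\<exists>C. \<forall>g. (\<forall>k<C. fps_nth g k = 0) \<longrightarrow> g \<in> range \<theta>"
proof -
  let ?w = "\<theta> (mvar s)"
  define d where "d = subdegree ?w"
  have w: "?w \<noteq> 0" "0 < d" using J s by (auto simp: d_def)
  obtain C where C: "\<forall>N\<ge>C. \<exists>f. \<theta> f \<noteq> 0 \<and> subdegree (\<theta> f) = N"
    using all_large_orders[OF assms] by blast
  then have "\<forall>i. \<exists>f. \<theta> f \<noteq> 0 \<and> subdegree (\<theta> f) = C + i" by simp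
  then obtain h where h: "\<And>i. \<theta> (h i) \<noteq> 0" "\<And>i. subdegree (\<theta> (h i)) = C + i" by metis
  have "\<exists>a g'. (\<forall>k<C. fps_nth g' k = 0) \<and> g = (\<Sum>i<d. fps_const (a i) * \<theta> (h i)) + ?w * g'"
    if g: "\<forall>k<C. fps_nth g k = 0" for g
  proof -
    obtain a where a: "\<forall>k<C + d. fps_nth (g - (\<Sum>i<d. fps_const (a i) * \<theta> (h i))) k = 0"
      using eliminate_leading_terms[OF h g] by blast
    let ?r = "g - (\<Sum>i<d. fps_const (a i) * \<theta> (h i))"
    show ?thesis
    proof (cases "?r = 0")
      case True
      then show ?thesis by (intro exI[of _ a] exI[of _ 0]) simp
    next
      case False
      have sub: "C + d \<le> subdegree ?r" using a False by (intro subdegree_geI) auto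
      then have "?w dvd ?r" using False w by (simp add: fps_dvd_iff d_def)
      then obtain g' where g': "?r = ?w * g'" by (elim dvdE)
      then have "subdegree ?r = d + subdegree g'" using False w by (auto simp: d_def)
      then have "C \<le> subdegree g'" using sub by simp
      then have "\<forall>k<C. fps_nth g' k = 0" by (auto intro: nth_less_subdegree_zero)
      then show ?thesis using g' by (intro exI[of _ a] exI[of _ g']) (simp add: algebra_simps)
    qed
  qed
  then obtain a G where aG: "\<And>g. (\<forall>k<C. fps_nth g k = 0) \<Longrightarrow> (\<forall>k<C. fps_nth (G g) k = 0) \<and>
      g = (\<Sum>i<d. fps_const (a g i) * \<theta> (h i)) + ?w * G g" by metis
  have "g \<in> range \<theta>" if g: "\<forall>k<C. fps_nth g k = 0" for g
  proof -
    define gs where "gs m = (G ^^ m) g" for m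
    have gs: "\<forall>k<C. fps_nth (gs m) k = 0" for m
      by (induction m) (use g aG in \<open>auto simp: gs_def\<close>)
    have step: "gs m = (\<Sum>i<d. fps_const (a (gs m) i) * \<theta> (h i)) + ?w * gs (Suc m)" for m
      using aG[OF gs[of m]] by (simp add: gs_def)
    define F where "F i = Abs_fps (\<lambda>m. a (gs m) i)" for i
    let ?T = "\<lambda>m. \<Sum>i<d. \<theta> (h i) * \<theta> (series_in_var s (fps_shift m (F i)))"
    have T: "?T m = (\<Sum>i<d. fps_const (a (gs m) i) * \<theta> (h i)) + ?w * ?T (Suc m)" for m
    proof -
      have "\<theta> (series_in_var s (fps_shift m (F i)))
          = fps_const (a (gs m) i) + ?w * \<theta> (series_in_var s (fps_shift (Suc m) (F i)))" for i
      proof -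
        have "fps_shift 1 (fps_shift m (F i)) = fps_shift (Suc m) (F i)" by (rule fps_ext) simp
        moreover have "fps_nth (fps_shift m (F i)) 0 = a (gs m) i" by (simp add: F_def)
        ultimately show ?thesis
          by (subst series_in_var_step) (simp add: hom_add hom_mult hom_const)
      qed
      then show ?thesis by (simp add: algebra_simps sum.distrib sum_distrib_left)
    qed
    define D where "D m = gs m - ?T m" for m
    have D_step: "D m = ?w * D (Suc m)" for m
    proof -
      have diff: "x - y = p - q" if "x = A + p" "y = A + q" for x y p q A :: "'k fps"
        using that by simp
      show ?thesis unfolding D_def right_diff_distrib by (rule diff[OF step T])
    qed
    have D: "D 0 = ?w ^ m * D m" for m
    proof (induction m)
      case (Suc m)
      then show ?case unfolding D_step[of m] by (simp add: ac_simps)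
    qed simp
    have "D 0 = 0"
    proof (rule ccontr)
      assume nz: "D 0 \<noteq> 0"
      define m where "m = Suc (subdegree (D 0))"
      have "D m \<noteq> 0" using D[of m] nz by auto
      then have "subdegree (D 0) = m * d + subdegree (D m)"
        unfolding D[of m] using w by (simp add: d_def)
      moreover have "m \<le> m * d" using w(2) by simp
      ultimately show False by (simp add: m_def)
    qed
    then have "g = \<theta> (\<Sum>i<d. h i * series_in_var s (F i))"
      by (simp add: D_def gs_def hom_sum hom_mult)
    then show ?thesis by blast
  qed
  then show ?thesis by blast
qed

end

section \<open>Regularity of localizations\<close>

lemma regular_local_ring_field:
  assumes "field R"
  shows "regular_local_ring R"
proof -
  interpret field R by fact
  have ideals: "I = {\<zero>\<^bsub>R\<^esub>} \<or> I = carrier R" if "ideal I R" for I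
    using all_ideals that by blast
  have max: "max_ideal R = {\<zero>\<^bsub>R\<^esub>}" "\<exists>!M. maximalideal M R"
  proof -
    have "M = {\<zero>\<^bsub>R\<^esub>}" if "maximalideal M R" for M
      using ideals[of M] maximalideal.axioms(1)[OF that] maximalideal.I_notcarr[OF that] by blast
    then show "max_ideal R = {\<zero>\<^bsub>R\<^esub>}" "\<exists>!M. maximalideal M R"
      using zeromaximalideal unfolding max_ideal_def by (blast intro!: the_equality)+
  qed
  have gen: "genideal R {} = {\<zero>\<^bsub>R\<^esub>}"
    using genideal_minimal[OF zeroideal, of "{}"] additive_subgroup.zero_closed[OF ideal.axioms(1)[OF genideal_ideal[of "{}"]]]
    by auto
  have "genideal R {\<one>\<^bsub>R\<^esub>} = carrier R" using genideal_one by simp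
  then have noeth: "noetherian_ring R"
    using ideals gen by (intro noetherian_ringI) (metis empty_subsetI finite.intros insert_subset one_closed)
  have "n = 0" if "\<forall>i\<le>n. primeideal (P i) R" "\<forall>i<n. P i \<subset> P (Suc i)" for n and P :: "nat \<Rightarrow> _"
  proof (rule ccontr)
    assume n: "n \<noteq> 0"
    have "P i = {\<zero>\<^bsub>R\<^esub>}" if "i \<le> n" for i
      using ideals[of "P i"] primeideal.axioms(1)[of "P i" R] primeideal.I_notcarr[of "P i" R]
        \<open>\<forall>i\<le>n. primeideal (P i) R\<close> that by blast
    then have "P 0 = P (Suc 0)" using n by simp
    then show False using that(2) n by blast
  qed
  then have "x \<le> 0" if "x \<in> {enat n | n. \<exists>P. (\<forall>i\<le>n. primeideal (P i) R) \<and> (\<forall>i<n. P i \<subset> P (Suc i))}" for x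
    using that by (auto simp: zero_enat_def)
  then have "krull_dim R \<le> 0"
    unfolding krull_dim_def by (rule Sup_least)
  then have "krull_dim R = 0" by simp
  then show ?thesis
    unfolding regular_local_ring_def local_ring_def
    using max noeth gen is_cring by (auto intro!: exI[of _ "{}"] simp: zero_enat_def)
qed

text \<open>Such a ring is a discrete valuation ring: the nonzero ideals are generated by the powers of \<open>p\<close>, so
  that the only primes are \<open>{0}\<close> and \<open>(p)\<close>.\<close>

lemma regular_local_ring_uniformizer:
  assumes "domain R" and p: "p \<in> carrier R" "p \<noteq> \<zero>\<^bsub>R\<^esub>" "p \<notin> Units R"
    and dec: "\<And>x. x \<in> carrier R \<Longrightarrow> x \<noteq> \<zero>\<^bsub>R\<^esub> \<Longrightarrow> \<exists>n::nat. \<exists>u\<in>Units R. x = u \<otimes>\<^bsub>R\<^esub> p [^]\<^bsub>R\<^esub> n"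
  shows "regular_local_ring R"
proof -
  interpret domain R by fact
  have pow: "p [^]\<^bsub>R\<^esub> (n::nat) \<in> carrier R" for n using p by simp
  have powI: "p [^]\<^bsub>R\<^esub> k \<in> I" if "ideal I R" "p [^]\<^bsub>R\<^esub> n \<in> I" "n \<le> k" for I n and k :: nat
  proof -
    have "p [^]\<^bsub>R\<^esub> k = p [^]\<^bsub>R\<^esub> (k - n) \<otimes>\<^bsub>R\<^esub> p [^]\<^bsub>R\<^esub> n"
      using that(3) p by (simp add: nat_pow_mult)
    then show ?thesis using ideal.I_l_closed[OF that(1,2) pow] by simp
  qed
  have power: "\<exists>n::nat. p [^]\<^bsub>R\<^esub> n \<in> I \<and> I = PIdl\<^bsub>R\<^esub> (p [^]\<^bsub>R\<^esub> n)" if I: "ideal I R" "I \<noteq> {\<zero>\<^bsub>R\<^esub>}" for I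
  proof -
    have ex: "\<exists>k. \<exists>u\<in>Units R. x = u \<otimes>\<^bsub>R\<^esub> p [^]\<^bsub>R\<^esub> (k::nat) \<and> p [^]\<^bsub>R\<^esub> k \<in> I"
      if x: "x \<in> I" "x \<noteq> \<zero>\<^bsub>R\<^esub>" for x
    proof -
      have xc: "x \<in> carrier R" using x I by (meson additive_subgroup.a_Hcarr ideal.axioms(1))
      obtain k u where k: "u \<in> Units R" "x = u \<otimes>\<^bsub>R\<^esub> p [^]\<^bsub>R\<^esub> (k::nat)" using dec[OF xc x(2)] by blast
      then have "inv\<^bsub>R\<^esub> u \<otimes>\<^bsub>R\<^esub> x = p [^]\<^bsub>R\<^esub> k" using pow by (simp add: m_assoc[symmetric] Units_closed)
      then have "p [^]\<^bsub>R\<^esub> k \<in> I" using ideal.I_l_closed[OF I(1) x(1), of "inv\<^bsub>R\<^esub> u"] k by simp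
      then show ?thesis using k by blast
    qed
    have "\<zero>\<^bsub>R\<^esub> \<in> I" using I by (meson additive_subgroup.zero_closed ideal.axioms(1))
    then obtain x where "x \<in> I" "x \<noteq> \<zero>\<^bsub>R\<^esub>" using I(2) by blast
    then have e: "\<exists>k. p [^]\<^bsub>R\<^esub> (k::nat) \<in> I" using ex by blast
    define n where "n = (LEAST k. p [^]\<^bsub>R\<^esub> (k::nat) \<in> I)"
    have n: "p [^]\<^bsub>R\<^esub> n \<in> I" "\<And>k. p [^]\<^bsub>R\<^esub> k \<in> I \<Longrightarrow> n \<le> k"
      unfolding n_def using LeastI_ex[OF e] by (auto intro: Least_le)
    have "I \<subseteq> PIdl\<^bsub>R\<^esub> (p [^]\<^bsub>R\<^esub> n)"
    proof
      fix x assume x: "x \<in> I"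
      let ?P = "PIdl\<^bsub>R\<^esub> (p [^]\<^bsub>R\<^esub> n)"
      have P: "ideal ?P R" "p [^]\<^bsub>R\<^esub> n \<in> ?P" using cgenideal_ideal[OF pow] cgenideal_self[OF pow] by auto
      show "x \<in> ?P"
      proof (cases "x = \<zero>\<^bsub>R\<^esub>")
        case True then show ?thesis using P by (meson additive_subgroup.zero_closed ideal.axioms(1))
      next
        case False
        then obtain k u where k: "u \<in> Units R" "x = u \<otimes>\<^bsub>R\<^esub> p [^]\<^bsub>R\<^esub> (k::nat)" "p [^]\<^bsub>R\<^esub> k \<in> I" using ex[OF x] by blast
        then have "p [^]\<^bsub>R\<^esub> k \<in> ?P" using powI[OF P] n(2) by blast
        then show ?thesis using k ideal.I_l_closed[OF P(1)] by (simp add: Units_closed)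
      qed
    qed
    then have "I = PIdl\<^bsub>R\<^esub> (p [^]\<^bsub>R\<^esub> n)" using cgenideal_minimal[OF I(1) n(1)] by (rule antisym)
    then show ?thesis using n(1) by blast
  qed
  let ?M = "PIdl\<^bsub>R\<^esub> p"
  have M: "ideal ?M R" "p \<in> ?M" using cgenideal_ideal[OF p(1)] cgenideal_self[OF p(1)] by auto
  have Mc: "?M \<noteq> carrier R"
  proof
    assume "?M = carrier R"
    then have "\<one>\<^bsub>R\<^esub> \<in> ?M" by simp
    then obtain a where "a \<in> carrier R" "\<one>\<^bsub>R\<^esub> = a \<otimes>\<^bsub>R\<^esub> p" unfolding cgenideal_def by blast
    then have "p \<in> Units R" using p(1) m_comm[of a p] unfolding Units_def by auto
    then show False using p(3) by simp
  qed
  have proper: "I \<subseteq> ?M" if I: "ideal I R" "I \<noteq> carrier R" for I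
  proof (cases "I = {\<zero>\<^bsub>R\<^esub>}")
    case True
    then show ?thesis using M(1) by (meson additive_subgroup.zero_closed empty_subsetI ideal.axioms(1) insert_subset)
  next
    case False
    then obtain n :: nat where n: "p [^]\<^bsub>R\<^esub> n \<in> I" "I = PIdl\<^bsub>R\<^esub> (p [^]\<^bsub>R\<^esub> n)" using power[OF I(1)] by blast
    have "n \<noteq> 0" using n(1) I ideal.one_imp_carrier[OF I(1)] by auto
    then have "p [^]\<^bsub>R\<^esub> n \<in> ?M" using powI[OF M(1), of 1 n] M(2) p(1) by simp
    then show ?thesis unfolding n(2) by (rule cgenideal_minimal[OF M(1)])
  qed
  have max: "maximalideal ?M R"
  proof (rule maximalidealI[OF M(1)])
    show "J = ?M \<or> J = carrier R" if "ideal J R" "?M \<subseteq> J" for J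
      using proper[OF that(1)] that(2) by blast
  qed (use Mc in auto)
  have uniq: "N = ?M" if "maximalideal N R" for N
    using proper[of N] maximalideal.I_maximal[OF that M(1)] maximalideal.I_notcarr[OF that] Mc
      maximalideal.axioms(1)[OF that] additive_subgroup.a_subset[OF ideal.axioms(1)[OF M(1)]] by blast
  have max_id: "max_ideal R = ?M" unfolding max_ideal_def using max uniq by (blast intro!: the_equality)
  have prime: "I = {\<zero>\<^bsub>R\<^esub>} \<or> I = ?M" if I: "primeideal I R" for I
  proof (cases "I = {\<zero>\<^bsub>R\<^esub>}")
    case False
    interpret I: primeideal I R by fact
    obtain n :: nat where n: "p [^]\<^bsub>R\<^esub> n \<in> I" using power[OF I.is_ideal False] by blast
    have "p \<in> I" using n
    proof (induction n)
      case 0 then show ?case using I.one_imp_carrier I.I_notcarr by simp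
    next
      case (Suc n) then show ?case using I.I_prime[of "p [^]\<^bsub>R\<^esub> n" p] p pow by auto
    qed
    then have "?M \<subseteq> I" by (rule cgenideal_minimal[OF I.is_ideal])
    then show ?thesis using proper[OF I.is_ideal] I.I_notcarr by auto
  qed simp
  have zM: "{\<zero>\<^bsub>R\<^esub>} \<subset> ?M"
    using M p(2) additive_subgroup.zero_closed[OF ideal.axioms(1)[OF M(1)]] by blast
  have gen_empty: "genideal R {} = {\<zero>\<^bsub>R\<^esub>}"
    using genideal_minimal[OF zeroideal, of "{}"] additive_subgroup.zero_closed[OF ideal.axioms(1)[OF genideal_ideal[of "{}"]]]
    by auto
  have noeth: "noetherian_ring R"
  proof (rule noetherian_ringI)
    fix I assume I: "ideal I R"
    show "\<exists>A\<subseteq>carrier R. finite A \<and> I = Idl\<^bsub>R\<^esub> A"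
    proof (cases "I = {\<zero>\<^bsub>R\<^esub>}")
      case True then show ?thesis using gen_empty by (intro exI[of _ "{}"]) auto
    next
      case False
      then obtain n :: nat where "I = PIdl\<^bsub>R\<^esub> (p [^]\<^bsub>R\<^esub> n)" using power[OF I] by blast
      then show ?thesis using cgenideal_eq_genideal[OF pow] pow by (intro exI[of _ "{p [^]\<^bsub>R\<^esub> n}"]) auto
    qed
  qed
  let ?C = "{enat n | n. \<exists>P. (\<forall>i\<le>n. primeideal (P i) R) \<and> (\<forall>i<n. P i \<subset> P (Suc i))}"
  have "n \<le> 1" if P: "\<forall>i\<le>n. primeideal (P i) R" "\<forall>i<n. P i \<subset> P (Suc i)" for n and P :: "nat \<Rightarrow> _"
  proof (rule ccontr)
    assume n: "\<not> n \<le> 1"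
    have "P i = {\<zero>\<^bsub>R\<^esub>} \<or> P i = ?M" if "i \<le> n" for i using prime P(1) that by blast
    then have "P 0 = {\<zero>\<^bsub>R\<^esub>} \<or> P 0 = ?M" "P (Suc 0) = {\<zero>\<^bsub>R\<^esub>} \<or> P (Suc 0) = ?M"
      "P (Suc (Suc 0)) = {\<zero>\<^bsub>R\<^esub>} \<or> P (Suc (Suc 0)) = ?M" using n by auto
    moreover have "P 0 \<subset> P (Suc 0)" "P (Suc 0) \<subset> P (Suc (Suc 0))" using P(2) n by auto
    ultimately show False using zM by (metis order_less_asym order_less_irrefl)
  qed
  then have "x \<le> enat 1" if "x \<in> ?C" for x using that by auto
  then have "krull_dim R \<le> enat 1" unfolding krull_dim_def by (rule Sup_least)
  moreover have "enat 1 \<in> ?C"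
    using zeroprimeideal maximalideal_prime[OF max] zM
    by (auto intro!: exI[of _ "\<lambda>i. if i = 0 then {\<zero>\<^bsub>R\<^esub>} else ?M"])
  then have "enat 1 \<le> krull_dim R" unfolding krull_dim_def by (rule Sup_upper)
  ultimately have kd: "krull_dim R = enat 1" by (rule antisym)
  have gen: "genideal R {p} = max_ideal R" using max_id cgenideal_eq_genideal[OF p(1)] by simp
  show ?thesis
    unfolding regular_local_ring_def local_ring_def
  proof (intro conjI is_cring noeth)
    show "\<exists>!M. maximalideal M R" using max uniq by blast
    show "\<exists>A\<subseteq>carrier R. finite A \<and> genideal R A = max_ideal R \<and> enat (card A) = krull_dim R"
      using kd gen p(1) by (intro exI[of _ "{p}"]) simp
  qed
qed

lemma cring_TR_subring:
  fixes H :: "'a::comm_ring_1 set"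
  assumes "1 \<in> H" "\<And>x. x \<in> H \<Longrightarrow> - x \<in> H" "\<And>x y. x \<in> H \<Longrightarrow> y \<in> H \<Longrightarrow> x + y \<in> H"
    "\<And>x y. x \<in> H \<Longrightarrow> y \<in> H \<Longrightarrow> x * y \<in> H"
  shows "cring (TR\<lparr>carrier := H\<rparr>)"
proof -
  interpret R: cring "TR :: 'a ring" by (rule cring_from_type_algebra)
  have inv: "\<ominus>\<^bsub>TR\<^esub> f = - f" for f :: 'a
    by (rule R.minus_equality) simp_all
  have "subring H (TR :: 'a ring)"
    by (rule R.subringI) (use assms inv in auto)
  then show ?thesis using R.subcring_iff[of H] R.subcringI' by simp
qed

text \<open>Two fractions \<open>a / s\<close> represent the same element of the localization iff the values \<open>f a / f s\<close> in the
  field agree.  So the classes are the fibres of this map.\<close>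

lemma localization_ring_iso:
  fixes f :: "'a \<Rightarrow> 'l::field"
  assumes "primeideal p Q" and hom: "f \<in> ring_hom Q TR"
    and nz: "\<And>s. s \<in> carrier Q - p \<Longrightarrow> f s \<noteq> 0"
    and ker: "\<And>a. a \<in> carrier Q \<Longrightarrow> f a = 0 \<Longrightarrow> \<exists>u\<in>carrier Q - p. u \<otimes>\<^bsub>Q\<^esub> a = \<zero>\<^bsub>Q\<^esub>"
  defines "L \<equiv> {f a / f s | a s. a \<in> carrier Q \<and> s \<in> carrier Q - p}"
  shows "\<exists>g. g \<in> ring_iso (TR\<lparr>carrier := L\<rparr>) (localization Q p) \<and> g 0 = \<zero>\<^bsub>localization Q p\<^esub>"
proof -
  interpret primeideal p Q by fact
  have f: "f (a \<otimes>\<^bsub>Q\<^esub> b) = f a * f b" "f (a \<oplus>\<^bsub>Q\<^esub> b) = f a + f b" "f \<one>\<^bsub>Q\<^esub> = 1"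
    if "a \<in> carrier Q" "b \<in> carrier Q" for a b
    using hom that by (auto simp: ring_hom_def)
  have "f \<zero>\<^bsub>Q\<^esub> + 0 = f \<zero>\<^bsub>Q\<^esub> + f \<zero>\<^bsub>Q\<^esub>" using f(2)[of "\<zero>\<^bsub>Q\<^esub>" "\<zero>\<^bsub>Q\<^esub>"] by simp
  then have f0: "f \<zero>\<^bsub>Q\<^esub> = 0" unfolding add_left_cancel by simp
  have f1: "f \<one>\<^bsub>Q\<^esub> = 1" using f(3)[of "\<zero>\<^bsub>Q\<^esub>" "\<zero>\<^bsub>Q\<^esub>"] by simp
  have fm: "f (a \<ominus>\<^bsub>Q\<^esub> b) = f a - f b" if "a \<in> carrier Q" "b \<in> carrier Q" for a b
  proof -
    have "(a \<ominus>\<^bsub>Q\<^esub> b) \<oplus>\<^bsub>Q\<^esub> b = a" using that by algebra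
    then show ?thesis using f(2)[of "a \<ominus>\<^bsub>Q\<^esub> b" b] that by (simp add: algebra_simps)
  qed
  let ?S = "carrier Q - p"
  have one: "\<one>\<^bsub>Q\<^esub> \<in> ?S" using I_notcarr one_imp_carrier by auto
  have S_mult: "s \<otimes>\<^bsub>Q\<^esub> t \<in> ?S" if "s \<in> ?S" "t \<in> ?S" for s t using that I_prime by auto
  define D where "D = carrier Q \<times> ?S"
  define frac where "frac q = f (fst q) / f (snd q)" for q
  have rel: "(q, q') \<in> fraction_rel Q p \<longleftrightarrow> q \<in> D \<and> q' \<in> D \<and> frac q = frac q'" for q q'
  proof (cases "q \<in> D \<and> q' \<in> D")
    case True
    obtain a s b t where q: "q = (a, s)" "q' = (b, t)" by fastforce
    have m: "a \<in> carrier Q" "b \<in> carrier Q" "s \<in> ?S" "t \<in> ?S" using True q by (auto simp: D_def)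
    let ?d = "t \<otimes>\<^bsub>Q\<^esub> a \<ominus>\<^bsub>Q\<^esub> s \<otimes>\<^bsub>Q\<^esub> b"
    have d: "?d \<in> carrier Q" using m by simp
    have "(\<exists>u\<in>?S. u \<otimes>\<^bsub>Q\<^esub> ?d = \<zero>\<^bsub>Q\<^esub>) \<longleftrightarrow> f ?d = 0"
    proof
      assume "\<exists>u\<in>?S. u \<otimes>\<^bsub>Q\<^esub> ?d = \<zero>\<^bsub>Q\<^esub>"
      then obtain u where u: "u \<in> ?S" "u \<otimes>\<^bsub>Q\<^esub> ?d = \<zero>\<^bsub>Q\<^esub>" by blast
      then have "f u * f ?d = 0" using f(1)[of u ?d] d f0 by simp
      then show "f ?d = 0" using nz[OF u(1)] by simp
    qed (rule ker[OF d])
    also have "f ?d = f t * f a - f s * f b" using m by (simp add: fm f)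
    also have "\<dots> = 0 \<longleftrightarrow> frac q = frac q'" using nz[OF m(3)] nz[OF m(4)] q
      by (auto simp: frac_def field_simps)
    finally show ?thesis using True q m by (auto simp: fraction_rel_def)
  qed (auto simp: fraction_rel_def D_def)
  define g where "g l = {q \<in> D. frac q = l}" for l
  have cls: "fraction_rel Q p `` {q} = g (frac q)" if "q \<in> D" for q
  proof (rule Set.set_eqI)
    fix q'
    show "q' \<in> fraction_rel Q p `` {q} \<longleftrightarrow> q' \<in> g (frac q)"
      unfolding Image_singleton_iff rel g_def mem_Collect_eq using that by auto
  qed
  have Dmem: "frac q \<in> L" if "q \<in> D" for q
    unfolding L_def frac_def mem_Collect_eq
    by (intro exI[of _ "fst q"] exI[of _ "snd q"]) (use that in \<open>auto simp: D_def\<close>)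
  have Lex: "\<exists>q\<in>D. frac q = l" if "l \<in> L" for l
    using that unfolding L_def frac_def D_def by force
  have car: "carrier (localization Q p) = g ` L"
  proof -
    have "carrier (localization Q p) = (\<lambda>q. fraction_rel Q p `` {q}) ` D"
      by (auto simp: localization_def quotient_def D_def)
    also have "\<dots> = (\<lambda>q. g (frac q)) ` D" by (rule image_cong[OF refl cls])
    also have "\<dots> = g ` frac ` D" by (simp only: image_image)
    also have "frac ` D = L" using Dmem Lex by blast
    finally show ?thesis .
  qed
  have prodD: "(fst q \<otimes>\<^bsub>Q\<^esub> fst q', snd q \<otimes>\<^bsub>Q\<^esub> snd q') \<in> D"
    "frac (fst q \<otimes>\<^bsub>Q\<^esub> fst q', snd q \<otimes>\<^bsub>Q\<^esub> snd q') = frac q * frac q'" if "q \<in> D" "q' \<in> D" for q q'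
    using that S_mult by (auto simp: D_def frac_def f)
  have sumD: "(snd q' \<otimes>\<^bsub>Q\<^esub> fst q \<oplus>\<^bsub>Q\<^esub> snd q \<otimes>\<^bsub>Q\<^esub> fst q', snd q \<otimes>\<^bsub>Q\<^esub> snd q') \<in> D"
    "frac (snd q' \<otimes>\<^bsub>Q\<^esub> fst q \<oplus>\<^bsub>Q\<^esub> snd q \<otimes>\<^bsub>Q\<^esub> fst q', snd q \<otimes>\<^bsub>Q\<^esub> snd q') = frac q + frac q'"
    if "q \<in> D" "q' \<in> D" for q q'
    using that S_mult nz by (auto simp: D_def frac_def f field_simps)
  have mult: "g l \<otimes>\<^bsub>localization Q p\<^esub> g l' = g (l * l')" if "l \<in> L" "l' \<in> L" for l l'
  proof -
    have "g l \<otimes>\<^bsub>localization Q p\<^esub> g l' = (\<Union>q\<in>g l. \<Union>q'\<in>g l'. g (frac q * frac q'))"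
      unfolding localization_def using cls prodD by (simp add: g_def)
    also have "\<dots> = (\<Union>q\<in>g l. \<Union>q'\<in>g l'. g (l * l'))" by (simp add: g_def)
    also have "\<dots> = g (l * l')" using Lex[OF that(1)] Lex[OF that(2)] by (auto simp: g_def)
    finally show ?thesis .
  qed
  have add: "g l \<oplus>\<^bsub>localization Q p\<^esub> g l' = g (l + l')" if "l \<in> L" "l' \<in> L" for l l'
  proof -
    have "g l \<oplus>\<^bsub>localization Q p\<^esub> g l' = (\<Union>q\<in>g l. \<Union>q'\<in>g l'. g (frac q + frac q'))"
      unfolding localization_def using cls sumD by (simp add: g_def)
    also have "\<dots> = (\<Union>q\<in>g l. \<Union>q'\<in>g l'. g (l + l'))" by (simp add: g_def)
    also have "\<dots> = g (l + l')" using Lex[OF that(1)] Lex[OF that(2)] by (auto simp: g_def)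
    finally show ?thesis .
  qed
  have "g 1 = \<one>\<^bsub>localization Q p\<^esub>" "g 0 = \<zero>\<^bsub>localization Q p\<^esub>"
    using cls[of "(\<one>\<^bsub>Q\<^esub>, \<one>\<^bsub>Q\<^esub>)"] cls[of "(\<zero>\<^bsub>Q\<^esub>, \<one>\<^bsub>Q\<^esub>)"] one f1 f0
    by (auto simp: localization_def D_def frac_def)
  moreover have "bij_betw g L (g ` L)"
  proof (rule inj_on_imp_bij_betw, rule inj_onI)
    fix l l' assume "l \<in> L" "l' \<in> L" "g l = g l'"
    then show "l = l'" using Lex[of l] by (auto simp: g_def set_eq_iff)
  qed
  ultimately show ?thesis
    using mult add car by (intro exI[of _ g]) (auto simp: ring_iso_def ring_hom_def)
qed

text \<open>In the two cases the localization is the field \<open>k((t))\<close> or the valuation ring \<open>k[[t]]\<close>.\<close>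

lemma regular_local_ring_localization:
  fixes f :: "'a \<Rightarrow> 'k::field fls"
  assumes p: "primeideal p Q" and hom: "f \<in> ring_hom Q TR"
    and nz: "\<And>s. s \<in> carrier Q - p \<Longrightarrow> f s \<noteq> 0"
    and ker: "\<And>a. a \<in> carrier Q \<Longrightarrow> f a = 0 \<Longrightarrow> \<exists>u\<in>carrier Q - p. u \<otimes>\<^bsub>Q\<^esub> a = \<zero>\<^bsub>Q\<^esub>"
  defines "L \<equiv> {f a / f s | a s. a \<in> carrier Q \<and> s \<in> carrier Q - p}"
  assumes L: "L = UNIV \<or> L = range fps_to_fls"
  shows "regular_local_ring (localization Q p)"
proof -
  let ?A = "TR\<lparr>carrier := L\<rparr>" and ?R = "localization Q p"
  obtain g where g: "g \<in> ring_iso ?A ?R" "g 0 = \<zero>\<^bsub>?R\<^esub>"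
    using localization_ring_iso[OF p hom nz ker] unfolding L_def by blast
  have Req: "?R\<lparr>zero := g 0\<rparr> = ?R" unfolding g(2) by (simp add: localization_def)
  have gm: "g (x * y) = g x \<otimes>\<^bsub>?R\<^esub> g y" "g 1 = \<one>\<^bsub>?R\<^esub>" "g x \<in> carrier ?R" if "x \<in> L" "y \<in> L" for x y
    using ring_iso_memE[OF g(1)] that by auto
  have bij: "bij_betw g L (carrier ?R)" using ring_iso_memE(5)[OF g(1)] by simp
  from L show ?thesis
  proof
    assume "L = UNIV"
    then have "?A = TR" by (simp add: ring_of_type_algebra_def)
    then have "field ?A" by (simp add: field_from_type_algebra)
    then show ?thesis using field.ring_iso_imp_img_field[of ?A g ?R] g Req
      by (intro regular_local_ring_field) simp
  next
    assume L: "L = range fps_to_fls"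
    have Lc: "1 \<in> L" "\<And>x. x \<in> L \<Longrightarrow> - x \<in> L" "\<And>x y. x \<in> L \<Longrightarrow> y \<in> L \<Longrightarrow> x + y \<in> L"
      "\<And>x y. x \<in> L \<Longrightarrow> y \<in> L \<Longrightarrow> x * y \<in> L"
      unfolding L using fps_one_to_fls
      by (auto simp flip: fps_to_fls_uminus fps_to_fls_plus fls_times_fps_to_fls intro: rangeI)
    have "cring ?A" by (rule cring_TR_subring) (use Lc in auto)
    then have "domain ?A" by (auto intro!: domain.intro domain_axioms.intro)
    then have dom: "domain ?R" using domain.ring_iso_imp_img_domain[of ?A g ?R] g Req by simp
    interpret R: domain ?R by (rule dom)
    let ?X = "fps_to_fls (fps_X :: 'k fps)"
    have X: "?X \<in> L" unfolding L by (rule rangeI)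
    have z: "0 \<in> L" using L by (metis fps_zero_to_fls rangeI)
    have inj: "g x = g y \<Longrightarrow> x = y" if "x \<in> L" "y \<in> L" for x y
      using bij that by (auto simp: bij_betw_def inj_on_def)
    have surj: "\<exists>y\<in>L. x = g y" if "x \<in> carrier ?R" for x
      using bij_betw_imp_surj_on[OF bij] that by blast
    have pw: "g (x ^ n) = g x [^]\<^bsub>?R\<^esub> n \<and> x ^ n \<in> L" if "x \<in> L" for x and n :: nat
    proof (induction n)
      case (Suc n)
      then show ?case using that gm(1)[of "x ^ n" x] Lc(4)[of x "x ^ n"] by (simp add: mult.commute)
    qed (use gm Lc in auto)
    show ?thesis
    proof (rule regular_local_ring_uniformizer[OF dom])
      show "g ?X \<in> carrier ?R" using gm X by blast
      show "g ?X \<noteq> \<zero>\<^bsub>?R\<^esub>" using inj[OF X z] g(2) by auto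
      show "g ?X \<notin> Units ?R"
      proof
        assume "g ?X \<in> Units ?R"
        then obtain v where v: "v \<in> carrier ?R" "g ?X \<otimes>\<^bsub>?R\<^esub> v = \<one>\<^bsub>?R\<^esub>" by (auto simp: Units_def)
        then obtain w where w: "w \<in> L" "v = g w" using surj by blast
        then have "?X * w = 1" using v inj[of "?X * w" 1] gm[OF X w(1)] Lc X by auto
        moreover obtain h where "w = fps_to_fls h" using w L by auto
        ultimately have "fps_X * h = 1" by (metis fls_times_fps_to_fls fps_one_to_fls fps_to_fls_eq_iff)
        then have "fps_nth (fps_X * h) 0 = 1" by simp
        then show False by simp
      qed
      fix x assume x: "x \<in> carrier ?R" "x \<noteq> \<zero>\<^bsub>?R\<^esub>"
      then obtain y where y: "y \<in> L" "x = g y" using surj by blast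
      then obtain h where h: "y = fps_to_fls h" using L by auto
      have h0: "h \<noteq> 0"
      proof
        assume "h = 0"
        then have "x = g 0" using y(2) h by simp
        then show False using x(2) g(2) by simp
      qed
      define u where "u = fps_shift (subdegree h) h"
      have hu: "h = u * fps_X ^ subdegree h" unfolding u_def by (rule subdegree_decompose)
      have "fps_nth u 0 \<noteq> 0" using h0 by (simp add: u_def)
      then have uu: "fps_to_fls u * fps_to_fls (inverse u) = 1"
        by (simp add: inverse_mult_eq_1' flip: fls_times_fps_to_fls)
      have uL: "fps_to_fls u \<in> L" "fps_to_fls (inverse u) \<in> L" by (auto simp: L)
      have "g (fps_to_fls u) \<in> Units ?R"
        unfolding Units_def using gm[OF uL] gm(1)[OF uL(2,1)] gm(3)[OF uL(2,1)] uu
        by (auto intro!: bexI[of _ "g (fps_to_fls (inverse u))"] simp: mult.commute)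
      moreover have "y = fps_to_fls u * ?X ^ subdegree h"
        unfolding h by (subst hu) (simp add: fls_times_fps_to_fls fps_to_fls_power)
      then have "x = g (fps_to_fls u) \<otimes>\<^bsub>?R\<^esub> g ?X [^]\<^bsub>?R\<^esub> subdegree h"
        using y(2) gm(1)[OF uL(1), of "?X ^ subdegree h"] pw[OF X, of "subdegree h"] by simp
      ultimately show "\<exists>n::nat. \<exists>u\<in>Units ?R. x = u \<otimes>\<^bsub>?R\<^esub> g ?X [^]\<^bsub>?R\<^esub> n" by blast
    qed
  qed
qed

lemma fls_eq_fps_fraction:
  fixes z :: "'k::field fls"
  shows "\<exists>n w. z = fps_to_fls w / fps_to_fls (fps_X ^ n)"
proof -
  define n where "n = nat (- fls_subdegree z)"
  obtain w where w: "z = fls_shift (int n) (fps_to_fls w)"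
  proof (rule fls_as_fps)
    show "- fls_subdegree z \<le> int n" by (simp add: n_def)
  qed
  have "fls_X ^ n * z = fls_shift (- int n) z" by (rule fls_X_power_times_conv_shift)
  then have "fls_X ^ n * z = fps_to_fls w" using w by simp
  moreover have "z = fls_X ^ n * z / fls_X ^ n"
    by (rule nonzero_mult_div_cancel_left[symmetric]) simp
  ultimately have "z = fps_to_fls w / fps_to_fls (fps_X ^ n)"
    by (simp only: fps_to_fls_power fps_X_to_fls)
  then show ?thesis by blast
qed

text \<open>Modulo the common kernel the \<open>e j\<close> are orthogonal idempotents with sum \<open>1\<close>, so that the quotient is the
  product of the images of the \<open>h j\<close>.  A prime avoids some \<open>e j\<close>, and localizing at it is localizing the
  \<open>j\<close>-th factor.\<close>

proposition regular_ring_quotient: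
  fixes h :: "'j \<Rightarrow> 'a \<Rightarrow> 'k::field fls"
  assumes A: "cring A" and T: "finite T"
    and hom: "\<And>j. j \<in> T \<Longrightarrow> h j \<in> ring_hom A TR"
    and img: "\<And>j. j \<in> T \<Longrightarrow> h j ` carrier A = UNIV \<or> h j ` carrier A = range fps_to_fls"
    and e: "\<And>j. j \<in> T \<Longrightarrow> e j \<in> carrier A"
      "\<And>i j. i \<in> T \<Longrightarrow> j \<in> T \<Longrightarrow> h i (e j) = (if i = j then 1 else 0)"
  shows "regular_ring (A Quot {a \<in> carrier A. \<forall>j\<in>T. h j a = 0})"
  unfolding regular_ring_def
proof (intro allI impI)
  let ?J = "{a \<in> carrier A. \<forall>j\<in>T. h j a = 0}" and ?Q = "A Quot {a \<in> carrier A. \<forall>j\<in>T. h j a = 0}"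
  interpret A: cring A by (rule A)
  have h: "h j (a \<otimes>\<^bsub>A\<^esub> b) = h j a * h j b" "h j (a \<oplus>\<^bsub>A\<^esub> b) = h j a + h j b" "h j \<one>\<^bsub>A\<^esub> = 1"
    if "j \<in> T" "a \<in> carrier A" "b \<in> carrier A" for j a b
    using hom[OF that(1)] that by (auto simp: ring_hom_def)
  have h0: "h j \<zero>\<^bsub>A\<^esub> = 0" if "j \<in> T" for j
  proof -
    have "h j \<zero>\<^bsub>A\<^esub> + 0 = h j \<zero>\<^bsub>A\<^esub> + h j \<zero>\<^bsub>A\<^esub>" using h(2)[OF that, of "\<zero>\<^bsub>A\<^esub>" "\<zero>\<^bsub>A\<^esub>"] by simp
    then show ?thesis unfolding add_left_cancel by simp
  qed
  have hm: "h j (a \<ominus>\<^bsub>A\<^esub> b) = h j a - h j b" if "j \<in> T" "a \<in> carrier A" "b \<in> carrier A" for j a b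
  proof -
    have "(a \<ominus>\<^bsub>A\<^esub> b) \<oplus>\<^bsub>A\<^esub> b = a" using that by (simp add: A.minus_eq A.add.m_assoc A.l_neg)
    then show ?thesis using h(2)[OF that(1), of "a \<ominus>\<^bsub>A\<^esub> b" b] that by (simp add: algebra_simps)
  qed
  have hi: "h j (\<ominus>\<^bsub>A\<^esub> a) = - h j a" if "j \<in> T" "a \<in> carrier A" for j a
    using hm[OF that(1) A.zero_closed that(2)] h0[OF that(1)] that by (simp add: A.minus_eq)
  have J: "ideal ?J A"
  proof (rule idealI)
    show "subgroup ?J (add_monoid A)"
      by (rule subgroup.intro) (auto simp: h h0 a_inv_def[symmetric] hi)
  qed (auto simp: h A.ring_axioms)
  define I where "I = ?J"
  interpret I: ideal I A unfolding I_def by (rule J)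
  fix p assume "primeideal p ?Q"
  then interpret p: primeideal p "A Quot I" unfolding I_def .
  let ?c = "\<lambda>a. I +>\<^bsub>A\<^esub> a"
  have c: "?c \<in> ring_hom A (A Quot I)" by (rule I.rcos_ring_hom)
  have cm: "?c (a \<otimes>\<^bsub>A\<^esub> b) = ?c a \<otimes>\<^bsub>A Quot I\<^esub> ?c b" "?c (a \<oplus>\<^bsub>A\<^esub> b) = ?c a \<oplus>\<^bsub>A Quot I\<^esub> ?c b"
    "?c a \<in> carrier (A Quot I)" if "a \<in> carrier A" "b \<in> carrier A" for a b
    by (rule ring_hom_memE(2)[OF c that] ring_hom_memE(3)[OF c that] ring_hom_memE(1)[OF c that(1)])+
  have c1: "?c \<one>\<^bsub>A\<^esub> = \<one>\<^bsub>A Quot I\<^esub>" by (rule ring_hom_memE(4)[OF c])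
  have ceq: "?c a = ?c b \<longleftrightarrow> a \<ominus>\<^bsub>A\<^esub> b \<in> I" if "a \<in> carrier A" "b \<in> carrier A" for a b
    using A.quotient_eq_iff_same_a_r_cos[OF I.is_ideal that] by simp
  have cz: "?c a = \<zero>\<^bsub>A Quot I\<^esub> \<longleftrightarrow> a \<in> I" if "a \<in> carrier A" for a
  proof -
    have "a \<ominus>\<^bsub>A\<^esub> \<zero>\<^bsub>A\<^esub> = a" unfolding A.minus_eq A.minus_zero by (rule A.r_zero[OF that])
    then show ?thesis
      using ceq[OF that A.zero_closed] ring_hom_zero[OF c A.ring_axioms I.quotient_is_ring] by metis
  qed
  have csurj: "\<exists>a\<in>carrier A. U = ?c a" if "U \<in> carrier (A Quot I)" for U
  proof -
    have "U \<in> a_rcosets\<^bsub>A\<^esub> I" using that by (simp add: FactRing_def)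
    then show ?thesis unfolding A_RCOSETS_def' by blast
  qed
  have p0: "?c a \<in> p" if "a \<in> I" for a
    using cz[OF I.a_Hcarr[OF that]] that p.zero_closed by simp
  have padd: "U \<oplus>\<^bsub>A Quot I\<^esub> V \<in> p" if "U \<in> p" "V \<in> p" for U V
    using additive_subgroup.a_closed[OF ideal.axioms(1)[OF p.is_ideal] that] .
  \<comment> \<open>\<open>p\<close> is proper and the sum of the idempotents is \<open>1\<close> modulo \<open>I\<close>\<close>
  have "\<exists>j\<in>T. ?c (e j) \<notin> p"
  proof (rule ccontr)
    assume "\<not> (\<exists>j\<in>T. ?c (e j) \<notin> p)"
    then have all: "?c (e j) \<in> p" if "j \<in> T" for j using that by blast
    have sum: "(\<Oplus>\<^bsub>A\<^esub>j\<in>S. e j) \<in> carrier A \<and> ?c (\<Oplus>\<^bsub>A\<^esub>j\<in>S. e j) \<in> p \<and>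
        (\<forall>i\<in>T. h i (\<Oplus>\<^bsub>A\<^esub>j\<in>S. e j) = (if i \<in> S then 1 else 0))" if "finite S" "S \<subseteq> T" for S
      using that
    proof (induction S)
      case empty
      then show ?case using p0[of "\<zero>\<^bsub>A\<^esub>"] I.zero_closed h0 by simp
    next
      case (insert k S)
      have k: "k \<in> T" using insert.prems by blast
      note k = k e(1)[OF k]
      have sub: "S \<subseteq> T" using insert.prems by blast
      then have fin: "e \<in> S \<rightarrow> carrier A" using e(1) by blast
      note IH' = insert.IH[OF sub]
      have IH: "(\<Oplus>\<^bsub>A\<^esub>j\<in>S. e j) \<in> carrier A" "?c (\<Oplus>\<^bsub>A\<^esub>j\<in>S. e j) \<in> p"
        "\<And>i. i \<in> T \<Longrightarrow> h i (\<Oplus>\<^bsub>A\<^esub>j\<in>S. e j) = (if i \<in> S then 1 else 0)"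
        using conjunct1[OF IH'] conjunct1[OF conjunct2[OF IH']] bspec[OF conjunct2[OF conjunct2[OF IH']]] by -
      have eq: "(\<Oplus>\<^bsub>A\<^esub>j\<in>insert k S. e j) = e k \<oplus>\<^bsub>A\<^esub> (\<Oplus>\<^bsub>A\<^esub>j\<in>S. e j)"
        by (rule A.finsum_insert[OF insert.hyps fin k(2)])
      show ?case
        unfolding eq
      proof (intro conjI ballI)
        show "e k \<oplus>\<^bsub>A\<^esub> (\<Oplus>\<^bsub>A\<^esub>j\<in>S. e j) \<in> carrier A" by (rule A.a_closed[OF k(2) IH(1)])
        show "?c (e k \<oplus>\<^bsub>A\<^esub> (\<Oplus>\<^bsub>A\<^esub>j\<in>S. e j)) \<in> p"
          unfolding cm(2)[OF k(2) IH(1)] by (rule padd[OF all[OF k(1)] IH(2)])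
        fix i assume i: "i \<in> T"
        show "h i (e k \<oplus>\<^bsub>A\<^esub> (\<Oplus>\<^bsub>A\<^esub>j\<in>S. e j)) = (if i \<in> insert k S then 1 else 0)"
          unfolding h(2)[OF i k(2) IH(1)] e(2)[OF i k(1)] IH(3)[OF i] using insert.hyps(2) by auto
      qed
    qed
    let ?s = "\<Oplus>\<^bsub>A\<^esub>j\<in>T. e j"
    note sT = sum[OF T order_refl]
    have s: "?s \<in> carrier A" "?c ?s \<in> p" using sT by blast+
    have s3: "h i ?s = 1" if i: "i \<in> T" for i
      using bspec[OF conjunct2[OF conjunct2[OF sT]] i] unfolding if_P[OF i] .
    have "h i (\<one>\<^bsub>A\<^esub> \<ominus>\<^bsub>A\<^esub> ?s) = 0" if i: "i \<in> T" for i
      unfolding hm[OF i A.one_closed s(1)] s3[OF i] h(3)[OF i s(1) s(1)] by simp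
    then have "\<one>\<^bsub>A\<^esub> \<ominus>\<^bsub>A\<^esub> ?s \<in> I" unfolding I_def using A.minus_closed[OF A.one_closed s(1)] by blast
    then have "?c \<one>\<^bsub>A\<^esub> = ?c ?s" unfolding ceq[OF A.one_closed s(1)] .
    then have "\<one>\<^bsub>A Quot I\<^esub> \<in> p" using s(2) unfolding c1 by metis
    then show False using p.one_imp_carrier p.I_notcarr by metis
  qed
  then obtain j where j: "j \<in> T" "?c (e j) \<notin> p" by blast
  have ej: "e j \<in> carrier A" using e(1) j(1) by simp
  have kerp: "?c a \<in> p" if "a \<in> carrier A" "h j a = 0" for a
  proof -
    have "h i (a \<otimes>\<^bsub>A\<^esub> e j) = 0" if "i \<in> T" for i
      unfolding h(1)[OF that \<open>a \<in> carrier A\<close> ej] e(2)[OF that j(1)] using \<open>h j a = 0\<close> by simp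
    then have "a \<otimes>\<^bsub>A\<^esub> e j \<in> I" unfolding I_def using A.m_closed[OF that(1) ej] by blast
    then have "?c a \<otimes>\<^bsub>A Quot I\<^esub> ?c (e j) \<in> p" using p0 unfolding cm(1)[OF that(1) ej, symmetric] by blast
    then show ?thesis using p.I_prime[OF cm(3)[OF that(1) ej] cm(3)[OF ej ej]] j(2) by metis
  qed
  \<comment> \<open>\<open>h j\<close> on the quotient, through a chosen representative\<close>
  define f where "f U = h j (SOME a. a \<in> carrier A \<and> U = ?c a)" for U
  have f: "f (?c a) = h j a" if a: "a \<in> carrier A" for a
  proof -
    let ?b = "SOME b. b \<in> carrier A \<and> ?c a = ?c b"
    have b: "?b \<in> carrier A \<and> ?c a = ?c ?b" by (rule someI[of _ a]) (use a in simp)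
    then have "a \<ominus>\<^bsub>A\<^esub> ?b \<in> I" using ceq a by blast
    then have "h j (a \<ominus>\<^bsub>A\<^esub> ?b) = 0" unfolding I_def using j(1) by blast
    then show ?thesis using hm[OF j(1) a] b by (simp add: f_def)
  qed
  have "regular_local_ring (localization (A Quot I) p)"
  proof (rule regular_local_ring_localization[OF p.primeideal])
    show "f \<in> ring_hom (A Quot I) TR"
    proof (rule ring_hom_memI)
      fix U V assume "U \<in> carrier (A Quot I)" "V \<in> carrier (A Quot I)"
      then obtain a b where ab: "a \<in> carrier A" "U = ?c a" "b \<in> carrier A" "V = ?c b" using csurj by metis
      show "f (U \<otimes>\<^bsub>A Quot I\<^esub> V) = f U \<otimes>\<^bsub>TR\<^esub> f V" "f (U \<oplus>\<^bsub>A Quot I\<^esub> V) = f U \<oplus>\<^bsub>TR\<^esub> f V"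
        using ab f cm(1,2)[OF ab(1,3), symmetric] h[OF j(1) ab(1,3)] by simp_all
    next
      show "f \<one>\<^bsub>A Quot I\<^esub> = \<one>\<^bsub>TR\<^esub>" using f[of "\<one>\<^bsub>A\<^esub>"] c1 h(3)[OF j(1) ej ej] by simp
    qed simp
    show "f s \<noteq> 0" if s: "s \<in> carrier (A Quot I) - p" for s
      using s csurj[of s] f kerp by auto
    show "\<exists>u\<in>carrier (A Quot I) - p. u \<otimes>\<^bsub>A Quot I\<^esub> U = \<zero>\<^bsub>A Quot I\<^esub>"
      if U: "U \<in> carrier (A Quot I)" "f U = 0" for U
    proof -
      obtain a where a: "a \<in> carrier A" "U = ?c a" using csurj[OF U(1)] by blast
      then have "h j a = 0" using U(2) f by simp
      have "h i (e j \<otimes>\<^bsub>A\<^esub> a) = 0" if "i \<in> T" for i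
        unfolding h(1)[OF that ej a(1)] e(2)[OF that j(1)] using \<open>h j a = 0\<close> by simp
      then have "e j \<otimes>\<^bsub>A\<^esub> a \<in> I" unfolding I_def using A.m_closed[OF ej a(1)] by blast
      then have "?c (e j \<otimes>\<^bsub>A\<^esub> a) = \<zero>\<^bsub>A Quot I\<^esub>" using cz[OF A.m_closed[OF ej a(1)]] by blast
      then have "?c (e j) \<otimes>\<^bsub>A Quot I\<^esub> U = \<zero>\<^bsub>A Quot I\<^esub>"
        unfolding cm(1)[OF ej a(1)] a(2) .
      then show ?thesis using j(2) cm(3)[OF ej ej] by blast
    qed
    let ?L = "{f a / f s |a s. a \<in> carrier (A Quot I) \<and> s \<in> carrier (A Quot I) - p}"
    have L: "?L = {h j a / h j s | a s. a \<in> carrier A \<and> s \<in> carrier A \<and> ?c s \<notin> p}" (is "_ = ?L'")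
    proof (rule Set.set_eqI)
      fix z show "z \<in> ?L \<longleftrightarrow> z \<in> ?L'"
      proof
        assume "z \<in> ?L"
        then obtain U V where UV: "z = f U / f V" "U \<in> carrier (A Quot I)" "V \<in> carrier (A Quot I)" "V \<notin> p" by blast
        obtain a s where as: "a \<in> carrier A" "U = ?c a" "s \<in> carrier A" "V = ?c s"
          using csurj[OF UV(2)] csurj[OF UV(3)] by blast
        then have "z = h j a / h j s" using UV(1) f by simp
        then show "z \<in> ?L'" using as UV(4) by blast
      next
        assume "z \<in> ?L'"
        then obtain a s where "z = h j a / h j s" "a \<in> carrier A" "s \<in> carrier A" "?c s \<notin> p" by blast
        then have "z = f (?c a) / f (?c s)" "?c a \<in> carrier (A Quot I)" "?c s \<in> carrier (A Quot I) - p"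
          using f cm(3) by auto
        then show "z \<in> ?L" by blast
      qed
    qed
    have one: "?c \<one>\<^bsub>A\<^esub> \<notin> p" using c1 p.one_imp_carrier p.I_notcarr by auto
    have imgL: "h j ` carrier A \<subseteq> ?L'"
    proof
      fix z assume "z \<in> h j ` carrier A"
      then obtain a where "a \<in> carrier A" "z = h j a / h j \<one>\<^bsub>A\<^esub>" using h(3)[OF j(1) ej ej] by auto
      then show "z \<in> ?L'" using one A.one_closed by blast
    qed
    show "?L = UNIV \<or> ?L = range fps_to_fls"
      using img[OF j(1)]
    proof
      assume "h j ` carrier A = UNIV"
      then show ?thesis using imgL unfolding L by blast
    next
      assume V: "h j ` carrier A = range fps_to_fls"
      then obtain x where x: "x \<in> carrier A" "h j x = fps_to_fls fps_X" by (metis imageE rangeI)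
      show ?thesis
      proof (cases "?c x \<in> p")
        case False
        have "z \<in> ?L'" for z
        proof -
          obtain n w where w: "z = fps_to_fls w / fps_to_fls (fps_X ^ n)"
            using fls_eq_fps_fraction by blast
          have xn: "x [^]\<^bsub>A\<^esub> n \<in> carrier A \<and> h j (x [^]\<^bsub>A\<^esub> n) = fps_to_fls (fps_X ^ n) \<and> ?c (x [^]\<^bsub>A\<^esub> n) \<notin> p"
          proof (induction n)
            case 0
            then show ?case using one h(3)[OF j(1) ej ej] by simp
          next
            case (Suc n)
            then show ?case using x False h(1)[OF j(1), of "x [^]\<^bsub>A\<^esub> n" x] cm(1)[of "x [^]\<^bsub>A\<^esub> n" x]
                p.I_prime[OF cm(3) cm(3), of "x [^]\<^bsub>A\<^esub> n" "x [^]\<^bsub>A\<^esub> n" x x]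
              by (auto simp: fls_times_fps_to_fls mult.commute simp del: fps_to_fls_power)
          qed
          obtain a where "a \<in> carrier A" "h j a = fps_to_fls w" using V by (metis imageE rangeI)
          then have "z = h j a / h j (x [^]\<^bsub>A\<^esub> n)" using w xn by simp
          then show ?thesis using xn \<open>a \<in> carrier A\<close> by blast
        qed
        then show ?thesis unfolding L by blast
      next
        case True
        \<comment> \<open>denominators outside \<open>p\<close> have order zero, because \<open>p\<close> contains \<open>x\<close> and the kernel of \<open>h j\<close>\<close>
        have "?L' \<subseteq> range fps_to_fls"
        proof
          fix z assume "z \<in> ?L'"
          then obtain a s where as: "z = h j a / h j s" "a \<in> carrier A" "s \<in> carrier A" "?c s \<notin> p" by blast
          obtain u where u: "h j s = fps_to_fls u" using V as by (metis imageI imageE)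
          obtain w where w: "h j a = fps_to_fls w" using V as by (metis imageI imageE)
          have "fps_nth u 0 \<noteq> 0"
          proof
            assume "fps_nth u 0 = 0"
            then have uX: "u = fps_X * fps_shift 1 u"
              by (intro fps_ext) auto
            obtain b where b: "b \<in> carrier A" "h j b = fps_to_fls (fps_shift 1 u)" using V by (metis imageE rangeI)
            have "h j (x \<otimes>\<^bsub>A\<^esub> b) = fps_to_fls u"
              unfolding h(1)[OF j(1) x(1) b(1)] x(2) b(2) fls_times_fps_to_fls[symmetric] using uX by simp
            then have "h j (s \<ominus>\<^bsub>A\<^esub> x \<otimes>\<^bsub>A\<^esub> b) = 0"
              unfolding hm[OF j(1) as(3) A.m_closed[OF x(1) b(1)]] u by simp
            then have "?c (s \<ominus>\<^bsub>A\<^esub> x \<otimes>\<^bsub>A\<^esub> b) \<in> p"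
              by (rule kerp[OF A.minus_closed[OF as(3) A.m_closed[OF x(1) b(1)]]])
            moreover have "?c (x \<otimes>\<^bsub>A\<^esub> b) \<in> p"
              using True cm(1)[OF x(1) b(1)] p.I_r_closed[OF True cm(3)[OF b(1) b(1)]] by simp
            ultimately have "?c (s \<ominus>\<^bsub>A\<^esub> x \<otimes>\<^bsub>A\<^esub> b \<oplus>\<^bsub>A\<^esub> x \<otimes>\<^bsub>A\<^esub> b) \<in> p"
              using cm(2)[OF A.minus_closed[OF as(3) A.m_closed[OF x(1) b(1)]] A.m_closed[OF x(1) b(1)]] padd by metis
            moreover have "s \<ominus>\<^bsub>A\<^esub> x \<otimes>\<^bsub>A\<^esub> b \<oplus>\<^bsub>A\<^esub> x \<otimes>\<^bsub>A\<^esub> b = s"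
              using as x b by (simp add: A.minus_eq A.add.m_assoc A.l_neg)
            ultimately show False using as(4) by simp
          qed
          then have "z = fps_to_fls (w * inverse u)"
            using as(1) u w by (simp add: divide_inverse fls_times_fps_to_fls fls_inverse_fps_to_fls)
          then show "z \<in> range fps_to_fls" by blast
        qed
        then show ?thesis using imgL V unfolding L by blast
      qed
    qed
  qed
  then show "regular_local_ring (localization ?Q p)" unfolding I_def .
qed

section \<open>Minimal primes of a reduced ring\<close>

definition mult_set :: "('a, 'b) ring_scheme \<Rightarrow> 'a set \<Rightarrow> bool" where
  "mult_set R W \<longleftrightarrow> W \<subseteq> carrier R \<and> \<one>\<^bsub>R\<^esub> \<in> W \<and> \<zero>\<^bsub>R\<^esub> \<notin> W \<and> (\<forall>x\<in>W. \<forall>y\<in>W. x \<otimes>\<^bsub>R\<^esub> y \<in> W)"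

lemma mult_set_compl_prime:
  assumes "primeideal P R"
  shows "mult_set R (carrier R - P)"
proof -
  interpret primeideal P R by fact
  have "\<one>\<^bsub>R\<^esub> \<notin> P" using I_notcarr one_imp_carrier by auto
  then show ?thesis unfolding mult_set_def using I_prime by auto
qed

text \<open>Otherwise \<open>W\<close> could be enlarged by the powers of \<open>x\<close>.  In a reduced ring \<open>w x\<^sup>n = 0\<close> implies
  \<open>w x = 0\<close>.\<close>

lemma maximal_mult_set_annihilator:
  assumes R: "reduced_ring R" and W: "mult_set R W"
    and max: "\<And>W'. mult_set R W' \<Longrightarrow> W \<subseteq> W' \<Longrightarrow> W' = W"
    and x: "x \<in> carrier R" "x \<notin> W"
  shows "\<exists>w\<in>W. w \<otimes>\<^bsub>R\<^esub> x = \<zero>\<^bsub>R\<^esub>"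
proof (rule ccontr)
  assume n: "\<not> ?thesis"
  interpret cring R using R by (simp add: reduced_ring_def)
  have red: "a = \<zero>\<^bsub>R\<^esub>" if "a \<in> carrier R" "a [^]\<^bsub>R\<^esub> (n::nat) = \<zero>\<^bsub>R\<^esub>" for a n
    using R that by (auto simp: reduced_ring_def)
  have Wc: "W \<subseteq> carrier R" and W1: "\<one>\<^bsub>R\<^esub> \<in> W" and W0: "\<zero>\<^bsub>R\<^esub> \<notin> W"
    and Wm: "\<And>a b. a \<in> W \<Longrightarrow> b \<in> W \<Longrightarrow> a \<otimes>\<^bsub>R\<^esub> b \<in> W"
    using W by (auto simp: mult_set_def)
  let ?W = "{w \<otimes>\<^bsub>R\<^esub> x [^]\<^bsub>R\<^esub> (n::nat) | w n. w \<in> W}"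
  have nz: "w \<otimes>\<^bsub>R\<^esub> x [^]\<^bsub>R\<^esub> (k::nat) \<noteq> \<zero>\<^bsub>R\<^esub>" if w: "w \<in> W" for w k
  proof
    assume e: "w \<otimes>\<^bsub>R\<^esub> x [^]\<^bsub>R\<^esub> k = \<zero>\<^bsub>R\<^esub>"
    have wc: "w \<in> carrier R" using w Wc by blast
    show False
    proof (cases k)
      case 0
      then show ?thesis using e wc w W0 by simp
    next
      case (Suc l)
      have "(w \<otimes>\<^bsub>R\<^esub> x) [^]\<^bsub>R\<^esub> k = w [^]\<^bsub>R\<^esub> k \<otimes>\<^bsub>R\<^esub> x [^]\<^bsub>R\<^esub> k" using wc x(1) by (simp add: nat_pow_distrib)
      also have "\<dots> = w [^]\<^bsub>R\<^esub> l \<otimes>\<^bsub>R\<^esub> (w \<otimes>\<^bsub>R\<^esub> x [^]\<^bsub>R\<^esub> k)" using wc x(1) Suc by (simp add: m_assoc)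
      also have "\<dots> = \<zero>\<^bsub>R\<^esub>" unfolding e using wc by simp
      finally have "w \<otimes>\<^bsub>R\<^esub> x = \<zero>\<^bsub>R\<^esub>" by (rule red[OF m_closed[OF wc x(1)]])
      then show ?thesis using n w by blast
    qed
  qed
  have "mult_set R ?W"
    unfolding mult_set_def
  proof (intro conjI ballI)
    show "?W \<subseteq> carrier R" using Wc x(1) by auto
    show "\<one>\<^bsub>R\<^esub> \<in> ?W" using W1 by (intro CollectI exI[of _ "\<one>\<^bsub>R\<^esub>"] exI[of _ 0]) simp
    show "\<zero>\<^bsub>R\<^esub> \<notin> ?W" using nz by fastforce
    fix a b assume "a \<in> ?W" "b \<in> ?W"
    then obtain v m w n where v: "v \<in> W" "a = v \<otimes>\<^bsub>R\<^esub> x [^]\<^bsub>R\<^esub> (m::nat)" and w: "w \<in> W" "b = w \<otimes>\<^bsub>R\<^esub> x [^]\<^bsub>R\<^esub> (n::nat)"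
      by blast
    have c: "v \<in> carrier R" "w \<in> carrier R" using v w Wc by auto
    have "a \<otimes>\<^bsub>R\<^esub> b = (v \<otimes>\<^bsub>R\<^esub> w) \<otimes>\<^bsub>R\<^esub> x [^]\<^bsub>R\<^esub> (m + n)"
      unfolding v w nat_pow_mult[OF x(1), symmetric] using c x(1) by (simp add: m_ac)
    then show "a \<otimes>\<^bsub>R\<^esub> b \<in> ?W" using Wm[OF v(1) w(1)] by blast
  qed
  moreover have "W \<subseteq> ?W"
  proof
    fix w assume w: "w \<in> W"
    then have "w = w \<otimes>\<^bsub>R\<^esub> x [^]\<^bsub>R\<^esub> (0::nat)" using Wc by auto
    then show "w \<in> ?W" using w by blast
  qed
  ultimately have "?W = W" by (rule max)
  moreover have "x = \<one>\<^bsub>R\<^esub> \<otimes>\<^bsub>R\<^esub> x [^]\<^bsub>R\<^esub> (1::nat)" using x(1) by simp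
  then have "x \<in> ?W" using W1 by blast
  ultimately show False using x(2) by simp
qed

text \<open>If \<open>a \<noteq> 0\<close>, the powers of \<open>a\<close> avoid \<open>0\<close>.  By Zorn's lemma they lie in a maximal multiplicative set
  without \<open>0\<close>, whose complement is a minimal prime that does not contain \<open>a\<close>.\<close>

proposition reduced_ring_Inter_minimal_primes:
  assumes R: "reduced_ring R" and a: "a \<in> carrier R" "\<And>P. P \<in> minimal_primes_over R {\<zero>\<^bsub>R\<^esub>} \<Longrightarrow> a \<in> P"
  shows "a = \<zero>\<^bsub>R\<^esub>"
proof (rule ccontr)
  assume a0: "a \<noteq> \<zero>\<^bsub>R\<^esub>"
  interpret cring R using R by (simp add: reduced_ring_def)
  have red: "\<And>n::nat. a [^]\<^bsub>R\<^esub> n \<noteq> \<zero>\<^bsub>R\<^esub>" using R a(1) a0 by (auto simp: reduced_ring_def)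
  let ?S = "{W. mult_set R W \<and> a \<in> W}"
  have "range (\<lambda>n::nat. a [^]\<^bsub>R\<^esub> n) \<in> ?S"
  proof -
    have "\<one>\<^bsub>R\<^esub> = a [^]\<^bsub>R\<^esub> (0::nat)" "a = a [^]\<^bsub>R\<^esub> (1::nat)" using a(1) by simp_all
    then have "\<one>\<^bsub>R\<^esub> \<in> range (\<lambda>n::nat. a [^]\<^bsub>R\<^esub> n)" "a \<in> range (\<lambda>n::nat. a [^]\<^bsub>R\<^esub> n)"
      by (metis rangeI)+
    moreover have "\<zero>\<^bsub>R\<^esub> \<notin> range (\<lambda>n::nat. a [^]\<^bsub>R\<^esub> n)" using red by (metis imageE)
    ultimately show ?thesis
      unfolding mult_set_def using a(1) by (auto simp: nat_pow_mult)
  qed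
  then have ne: "?S \<noteq> {}" by blast
  have "\<exists>W\<in>?S. \<forall>V1\<in>?S. W \<subseteq> V1 \<longrightarrow> V1 = W"
  proof (rule subset_Zorn_nonempty[OF ne])
    fix C assume C: "C \<noteq> {}" "subset.chain ?S C"
    then have mem: "\<And>W. W \<in> C \<Longrightarrow> mult_set R W \<and> a \<in> W"
      and ch: "\<And>V1 V2. V1 \<in> C \<Longrightarrow> V2 \<in> C \<Longrightarrow> V1 \<subseteq> V2 \<or> V2 \<subseteq> V1"
      by (auto simp: subset_chain_def subset.chain_def)
    have "mult_set R (\<Union>C)"
      unfolding mult_set_def
    proof (intro conjI ballI)
      show "\<Union>C \<subseteq> carrier R" "\<one>\<^bsub>R\<^esub> \<in> \<Union>C" "\<zero>\<^bsub>R\<^esub> \<notin> \<Union>C"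
        using mem C(1) unfolding mult_set_def by blast+
      fix x y assume "x \<in> \<Union>C" "y \<in> \<Union>C"
      then obtain V1 V2 where XY: "V1 \<in> C" "x \<in> V1" "V2 \<in> C" "y \<in> V2" by blast
      then obtain Z where "Z \<in> C" "x \<in> Z" "y \<in> Z" using ch by blast
      then show "x \<otimes>\<^bsub>R\<^esub> y \<in> \<Union>C" using mem unfolding mult_set_def by blast
    qed
    then show "\<Union>C \<in> ?S" using mem C(1) by blast
  qed
  then obtain W where W: "mult_set R W" "a \<in> W" and max: "\<And>W'. mult_set R W' \<Longrightarrow> W \<subseteq> W' \<Longrightarrow> W' = W"
    by blast
  have Wc: "W \<subseteq> carrier R" and W1: "\<one>\<^bsub>R\<^esub> \<in> W" and W0: "\<zero>\<^bsub>R\<^esub> \<notin> W"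
    and Wm: "\<And>x y. x \<in> W \<Longrightarrow> y \<in> W \<Longrightarrow> x \<otimes>\<^bsub>R\<^esub> y \<in> W"
    using W(1) by (auto simp: mult_set_def)
  have ann: "\<exists>w\<in>W. w \<otimes>\<^bsub>R\<^esub> x = \<zero>\<^bsub>R\<^esub>" if "x \<in> carrier R" "x \<notin> W" for x
    using maximal_mult_set_annihilator[OF R W(1) max that] .
  have notW: "x \<notin> W" if "w \<in> W" "w \<otimes>\<^bsub>R\<^esub> x = \<zero>\<^bsub>R\<^esub>" for w x
    using Wm[OF that(1), of x] that(2) W0 by auto
  let ?P = "carrier R - W"
  have "ideal ?P R"
  proof (rule idealI[OF ring_axioms])
    show "subgroup ?P (add_monoid R)"
    proof (rule subgroup.intro)
      fix x y assume x: "x \<in> ?P" and y: "y \<in> ?P"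
      obtain v w where vw: "v \<in> W" "v \<otimes>\<^bsub>R\<^esub> x = \<zero>\<^bsub>R\<^esub>" "w \<in> W" "w \<otimes>\<^bsub>R\<^esub> y = \<zero>\<^bsub>R\<^esub>" using ann x y by blast
      have c: "v \<in> carrier R" "w \<in> carrier R" "x \<in> carrier R" "y \<in> carrier R" using vw Wc x y by auto
      have "(v \<otimes>\<^bsub>R\<^esub> w) \<otimes>\<^bsub>R\<^esub> (x \<oplus>\<^bsub>R\<^esub> y) = w \<otimes>\<^bsub>R\<^esub> (v \<otimes>\<^bsub>R\<^esub> x) \<oplus>\<^bsub>R\<^esub> v \<otimes>\<^bsub>R\<^esub> (w \<otimes>\<^bsub>R\<^esub> y)"
        using c by (simp add: r_distr m_ac)
      also have "\<dots> = \<zero>\<^bsub>R\<^esub>" using vw(2,4) c by simp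
      finally have "x \<oplus>\<^bsub>R\<^esub> y \<notin> W" using notW[OF Wm[OF vw(1,3)]] by blast
      then show "x \<otimes>\<^bsub>add_monoid R\<^esub> y \<in> ?P" using c by simp
    next
      fix x assume x: "x \<in> ?P"
      obtain w where w: "w \<in> W" "w \<otimes>\<^bsub>R\<^esub> x = \<zero>\<^bsub>R\<^esub>" using ann x by blast
      have "w \<otimes>\<^bsub>R\<^esub> (\<ominus>\<^bsub>R\<^esub> x) = \<zero>\<^bsub>R\<^esub>" using w x Wc by (simp add: r_minus subset_iff)
      then show "inv\<^bsub>add_monoid R\<^esub> x \<in> ?P" using notW[OF w(1)] x by (simp add: a_inv_def[symmetric])
    qed (use W0 in auto)
    fix x r assume x: "x \<in> ?P" and r: "r \<in> carrier R"
    obtain w where w: "w \<in> W" "w \<otimes>\<^bsub>R\<^esub> x = \<zero>\<^bsub>R\<^esub>" using ann x by blast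
    have "w \<otimes>\<^bsub>R\<^esub> (r \<otimes>\<^bsub>R\<^esub> x) = r \<otimes>\<^bsub>R\<^esub> (w \<otimes>\<^bsub>R\<^esub> x)" using w x r Wc by (simp add: m_lcomm subset_iff)
    then have "w \<otimes>\<^bsub>R\<^esub> (r \<otimes>\<^bsub>R\<^esub> x) = \<zero>\<^bsub>R\<^esub>" using w r by simp
    then show "r \<otimes>\<^bsub>R\<^esub> x \<in> ?P" using notW[OF w(1)] x r by simp
    then show "x \<otimes>\<^bsub>R\<^esub> r \<in> ?P" using x r by (simp add: m_comm)
  qed
  then have prime: "primeideal ?P R"
  proof (rule primeidealI[OF _ is_cring])
    show "carrier R \<noteq> ?P" using W1 by blast
    show "x \<in> ?P \<or> y \<in> ?P" if "x \<in> carrier R" "y \<in> carrier R" "x \<otimes>\<^bsub>R\<^esub> y \<in> ?P" for x y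
      using Wm that by blast
  qed
  have "?P \<in> minimal_primes_over R {\<zero>\<^bsub>R\<^esub>}"
    unfolding minimal_primes_over_def
  proof (intro CollectI conjI notI)
    show "primeideal ?P R" by (rule prime)
    show "{\<zero>\<^bsub>R\<^esub>} \<subseteq> ?P" using W0 by simp
    assume "\<exists>Q. primeideal Q R \<and> {\<zero>\<^bsub>R\<^esub>} \<subseteq> Q \<and> Q \<subset> ?P"
    then obtain Q where Q: "primeideal Q R" "Q \<subset> ?P" by blast
    have "carrier R - Q = W"
      by (rule max[OF mult_set_compl_prime[OF Q(1)]]) (use Q(2) Wc in blast)
    then show False using Q(2) by blast
  qed
  then have "a \<in> ?P" by (rule a(2))
  then show False using W(2) by blast
qed

section \<open>Families of branches\<close>

text \<open>The branches in the new coordinates: the indices \<open>Inl s\<close> stand for \<open>z\<^sub>1, \<dots>, z\<^sub>m\<close>, and \<open>Inr j\<close> for \<open>z\<^sub>m\<^sub>+\<^sub>j\<close>,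
  which vanishes on all branches except the \<open>j\<close>-th.\<close>

locale branch_family =
  fixes \<theta> :: "'r::finite \<Rightarrow> ('k::field, 'm::finite + 'r) mfps \<Rightarrow> 'k fps"
  assumes arc: "formal_arc (\<theta> j)"
    and positive: "fps_nth (\<theta> j (mvar i)) 0 = 0"
    and Inl_nonzero: "\<theta> j (mvar (Inl s)) \<noteq> 0"
    and Inr_zero_iff: "\<theta> j (mvar (Inr l)) = 0 \<longleftrightarrow> l \<noteq> j"
    and primitive: "\<exists>n. (\<Sum>s\<in>UNIV. n s * int (subdegree (\<theta> j (mvar (Inl s))))) = 1"
begin

definition vanishing :: "'r \<Rightarrow> ('m + 'r) set" where
  "vanishing j = Inr ` (- {j})"

text \<open>The generators of the cone \<open>\<sigma>\<^sub>j\<close> whose orbit closure is the smallest coordinate subspace that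
  contains the branch.\<close>

definition S :: "'r \<Rightarrow> (int ^ ('m + 'r)) set" where
  "S j = (\<lambda>i. axis i 1) ` vanishing j"

text \<open>The direction of the branch, meaningful modulo the span of \<open>S j\<close>; the coordinates that vanish on
  the branch get the default value \<open>0\<close>.\<close>

definition v :: "'r \<Rightarrow> int ^ ('m + 'r)" where
  "v j = (\<chi> i. int (subdegree (\<theta> j (mvar i))))"

lemma mvar_zero_iff: "\<theta> j (mvar i) = 0 \<longleftrightarrow> i \<in> vanishing j"
  by (cases i) (auto simp: vanishing_def Inl_nonzero Inr_zero_iff)

lemma Inl_not_vanishing [simp]: "Inl s \<notin> vanishing j" and Inr_vanishing_iff [simp]: "Inr l \<in> vanishing j \<longleftrightarrow> l \<noteq> j"
  by (auto simp: vanishing_def)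

lemma v_nth: "v j $ i = int (subdegree (\<theta> j (mvar i)))"
  by (simp add: v_def)

lemma v_pos: "i \<notin> vanishing j \<Longrightarrow> 0 < v j $ i"
  using mvar_zero_iff[of j i] positive[of j i] by (auto simp: v_nth intro!: gr0I)
    (metis nth_subdegree_nonzero)

lemma v_vanishing: "i \<in> vanishing j \<Longrightarrow> v j $ i = 0"
  using mvar_zero_iff[of j i] by (simp add: v_nth)

lemma S_zero_iff: "(\<forall>s\<in>S j. s $ i = 0) \<longleftrightarrow> i \<notin> vanishing j"
  by (auto simp: S_def axis_def)

text \<open>At the start \<open>v j\<close> is the combination of the axes with the orders as coefficients.  At the end
  it is a multiple \<open>n u\<close> of a single ray modulo \<open>S j\<close>, and \<open>n = 1\<close> because \<open>n\<close> divides orders that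
  generate the group of integers.\<close>

lemma exists_adapted_complex:
  "\<exists>K u. regular_complex K \<and> (\<forall>j. u j \<notin> S j \<and> insert (u j) (S j) \<in> K \<and>
     (\<forall>i. i \<notin> vanishing j \<longrightarrow> u j $ i = v j $ i))"
proof -
  let ?ax = "\<lambda>i :: 'm + 'r. axis i 1 :: int ^ ('m + 'r)"
  have inj: "inj ?ax" by (auto simp: inj_on_def axis_eq_axis)
  define K0 where "K0 = Pow (range ?ax)"
  define n0 where "n0 j a = (if a \<in> range ?ax then nat (pair a (v j)) else 0)" for j a
  have n0_ax: "n0 j (?ax i) = subdegree (\<theta> j (mvar i))" for j i by (simp add: n0_def v_nth)
  have supp_n0: "supp (n0 j) = ?ax ` (- vanishing j)" for j
  proof -
    have "n0 j (?ax i) \<noteq> 0 \<longleftrightarrow> i \<notin> vanishing j" for i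
      using v_pos[of i j] v_vanishing[of i j] unfolding n0_ax v_nth by auto
    note nz = this
    show ?thesis
    proof (rule Set.set_eqI)
      fix a
      show "a \<in> supp (n0 j) \<longleftrightarrow> a \<in> ?ax ` (- vanishing j)"
      proof (cases "a \<in> range ?ax")
        case True
        then obtain i where i: "a = ?ax i" by blast
        show ?thesis unfolding i supp_def mem_Collect_eq nz inj_image_mem_iff[OF inj] by simp
      next
        case False
        then have "n0 j a = 0" by (simp only: n0_def if_False)
        then show ?thesis using False by (auto simp only: supp_def)
      qed
    qed
  qed
  have rp: "relative_position K0 (S j) (v j) (n0 j)" for j
    unfolding relative_position_def
  proof (intro conjI allI impI)
    show "supp (n0 j) \<inter> S j = {}" unfolding supp_n0 S_def by (auto simp: axis_eq_axis)
    show "supp (n0 j) \<union> S j \<in> K0" unfolding supp_n0 S_def K0_def by auto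
    fix i assume "\<forall>s\<in>S j. s $ i = 0"
    then have i: "i \<notin> vanishing j" by (simp add: S_zero_iff)
    have "(\<Sum>a\<in>supp (n0 j). int (n0 j a) * a $ i) = (\<Sum>k\<in>- vanishing j. v j $ k * ?ax k $ i)"
      unfolding supp_n0 by (subst sum.reindex) (auto intro: inj_on_subset[OF inj] simp: n0_ax v_nth)
    also have "\<dots> = (\<Sum>k\<in>- vanishing j. if k = i then v j $ k else 0)"
      by (intro sum.cong) (auto simp: axis_def)
    also have "\<dots> = v j $ i" using i by simp
    finally show "v j $ i = (\<Sum>a\<in>supp (n0 j). int (n0 j a) * a $ i)" ..
  qed
  let ?E = "range (\<lambda>l. ?ax (Inr l))"
  have SE: "S j \<subseteq> ?E" for j by (auto simp: S_def vanishing_def)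
  have E: "a = ?ax (Inr j)" if "a \<in> ?E - S j" for a j
    using that by (auto simp: S_def vanishing_def)
  have E': "a = b" if "a \<in> ?E - S j" "b \<in> ?E - S j" for a b j
    using E[OF that(1)] E[OF that(2)] by simp
  have "\<exists>K n. regular_complex K \<and>
      (\<forall>j. relative_position K (S j) (v j) (n j) \<and> (\<forall>a\<in>supp (n j). \<forall>b\<in>supp (n j). a = b))"
  proof (rule exists_complex_with_rays)
    show "regular_complex K0" unfolding K0_def by (rule regular_complex_orthant)
    show "relative_position K0 (S j) (v j) (n0 j)" "S j \<subseteq> ?E" for j by (rule rp, rule SE)
    show "a = b" if "a \<in> ?E - S j" "b \<in> ?E - S j" for j a b by (rule E'[OF that])
  qed
  then obtain K n where K: "regular_complex K"
    and Kn: "\<forall>j. relative_position K (S j) (v j) (n j) \<and> (\<forall>a\<in>supp (n j). \<forall>b\<in>supp (n j). a = b)"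
    by blast
  have n: "relative_position K (S j) (v j) (n j)" "a \<in> supp (n j) \<Longrightarrow> b \<in> supp (n j) \<Longrightarrow> a = b" for j a b
    using Kn by blast+
  have "\<exists>u. u \<notin> S j \<and> insert u (S j) \<in> K \<and> (\<forall>i. i \<notin> vanishing j \<longrightarrow> u $ i = v j $ i)" for j
  proof -
    have val: "v j $ i = (\<Sum>a\<in>supp (n j). int (n j a) * a $ i)" if "i \<notin> vanishing j" for i
      using n(1)[of j] that S_zero_iff[of j i] by (auto simp: relative_position_def)
    obtain s :: 'm where True by blast
    have "supp (n j) \<noteq> {}" using val[of "Inl s"] v_pos[of "Inl s" j] by auto
    then obtain u where u: "u \<in> supp (n j)" by blast
    then have su: "supp (n j) = {u}" using n(2) by blast
    obtain m where m: "(\<Sum>s\<in>UNIV. m s * int (subdegree (\<theta> j (mvar (Inl s))))) = 1" using primitive by blast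
    have "int (subdegree (\<theta> j (mvar (Inl s)))) = int (n j u) * u $ Inl s" for s
      using val[of "Inl s"] unfolding su v_nth by simp
    then have "int (n j u) * (\<Sum>s\<in>UNIV. m s * u $ Inl s) = 1"
      using m by (simp add: sum_distrib_left mult.left_commute)
    then have "int (n j u) dvd int 1" by (metis dvd_triv_left of_nat_1)
    then have "n j u = 1" unfolding int_dvd_int_iff by simp
    then have "u $ i = v j $ i" if "i \<notin> vanishing j" for i using val[OF that] unfolding su by simp
    moreover have "u \<notin> S j" "insert u (S j) \<in> K" using n(1)[of j] u unfolding relative_position_def su by auto
    ultimately show ?thesis by blast
  qed
  then show ?thesis using K by metis
qed

lemma conductor_exists: "\<exists>C. \<forall>g. (\<forall>k<C. fps_nth g k = 0) \<longrightarrow> g \<in> range (\<theta> j)"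
proof -
  interpret formal_arc "\<theta> j" by (rule arc)
  obtain m where m: "(\<Sum>s\<in>UNIV. m s * int (subdegree (\<theta> j (mvar (Inl s))))) = 1" using primitive by blast
  define m' where "m' i = (case i of Inl s \<Rightarrow> m s | Inr l \<Rightarrow> 0)" for i :: "'m + 'r"
  have "(\<Sum>i\<in>range Inl. m' i * int (subdegree (\<theta> j (mvar i)))) = 1"
    using m by (simp add: sum.reindex m'_def)
  moreover obtain s :: 'm where True by blast
  moreover have "0 < subdegree (\<theta> j (mvar (Inl s)))" using v_pos[of "Inl s" j] by (simp add: v_nth)
  ultimately show ?thesis
    using conductor[of "range Inl" m' "Inl s"] Inl_nonzero by blast
qed

text \<open>If \<open>P\<close> contains some \<open>f\<close> with \<open>\<theta> f \<noteq> 0\<close>, then by the conductor a high power of \<open>\<theta> z\<^sub>i\<close> is \<open>\<theta> f\<close> times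
  an element of the image.  So a power of \<open>z\<^sub>i\<close> lies in \<open>P\<close>.\<close>

lemma prime_over_branch:
  assumes P: "\<And>f g. f \<in> P \<Longrightarrow> g \<in> P \<Longrightarrow> f + g \<in> P" "\<And>f g. f \<in> P \<Longrightarrow> f * g \<in> P"
    "\<And>f g. f * g \<in> P \<Longrightarrow> f \<in> P \<or> g \<in> P" "1 \<notin> P"
    and sub: "{f. \<theta> j f = 0} \<subseteq> P"
  shows "P = {f. \<theta> j f = 0} \<or> (\<forall>i. mvar i \<in> P)"
proof (rule disjCI)
  assume "\<not> (\<forall>i. mvar i \<in> P)"
  show "P = {f. \<theta> j f = 0}"
  proof (rule ccontr)
    assume ne: "P \<noteq> {f. \<theta> j f = 0}"
    interpret formal_arc "\<theta> j" by (rule arc)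
    obtain f where f: "f \<in> P" "\<theta> j f \<noteq> 0" using ne sub by blast
    obtain C where C: "\<And>g. (\<forall>k<C. fps_nth g k = 0) \<Longrightarrow> g \<in> range (\<theta> j)" using conductor_exists by metis
    have "mvar i \<in> P" for i
    proof -
      let ?w = "\<theta> j (mvar i)" and ?N = "C + subdegree (\<theta> j f)"
      show "mvar i \<in> P"
      proof (cases "?w = 0")
        case True then show ?thesis using sub by auto
      next
        case False
        then have "i \<notin> vanishing j" using mvar_zero_iff by blast
        then have "0 < subdegree ?w" using v_pos[of i j] by (simp add: v_nth)
        then have "?N * 1 \<le> ?N * subdegree ?w" by (intro mult_le_mono2) simp
        then have deg: "?N \<le> subdegree (?w ^ ?N)" by simp
        then have "subdegree (\<theta> j f) \<le> subdegree (?w ^ ?N)" by linarith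
        moreover have "?w ^ ?N \<noteq> 0" using False by simp
        ultimately have "\<theta> j f dvd ?w ^ ?N" using f(2) unfolding fps_dvd_iff[OF f(2) \<open>?w ^ ?N \<noteq> 0\<close>] by blast
        then obtain g where g: "?w ^ ?N = \<theta> j f * g" by (elim dvdE)
        have "g \<noteq> 0" using g False by auto
        then have "subdegree (?w ^ ?N) = subdegree (\<theta> j f) + subdegree g" unfolding g using f(2) by simp
        then have "C \<le> subdegree g" using deg by simp
        then have "\<forall>k<C. fps_nth g k = 0" by (auto intro: nth_less_subdegree_zero)
        then obtain h where "g = \<theta> j h" using C by blast
        then have "\<theta> j (mvar i ^ ?N - f * h) = 0" using g by (simp add: hom_diff hom_mult hom_power)
        then have "mvar i ^ ?N - f * h \<in> P" using sub by blast
        then have "(mvar i ^ ?N - f * h) + f * h \<in> P" using P(1) P(2)[OF f(1)] by blast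
        then have "mvar i ^ ?N \<in> P" by simp
        moreover have "mvar i \<in> P" if "mvar i ^ n \<in> P" for n
          using that by (induction n) (use P(3,4) in auto)
        ultimately show ?thesis by blast
      qed
    qed
    then show False using \<open>\<not> (\<forall>i. mvar i \<in> P)\<close> by blast
  qed
qed

end

section \<open>Charts\<close>

lemma mem_dual_monoid_gen_cone: "w \<in> dual_monoid (gen_cone A) \<longleftrightarrow> (\<forall>a\<in>A. 0 \<le> pair w a)"
proof
  assume w: "w \<in> dual_monoid (gen_cone A)"
  show "\<forall>a\<in>A. 0 \<le> pair w a"
  proof
    fix a assume "a \<in> A"
    then have "0 \<le> real_vec w \<bullet> real_vec a" using w real_vec_in_gen_cone by (auto simp: dual_monoid_def)
    then show "0 \<le> pair w a" by (simp add: inner_real_vec)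
  qed
next
  assume w: "\<forall>a\<in>A. 0 \<le> pair w a"
  have "gen_cone A \<subseteq> {x. real_vec w \<bullet> x \<ge> 0}"
    unfolding gen_cone_def by (rule hull_minimal) (use w convex_cone_halfspace_ge in \<open>auto simp: inner_real_vec\<close>)
  then show "w \<in> dual_monoid (gen_cone A)" by (auto simp: dual_monoid_def)
qed

lemma mem_perp_gen_cone: "w \<in> perp (gen_cone A) \<longleftrightarrow> (\<forall>a\<in>A. pair w a = 0)"
proof
  assume w: "w \<in> perp (gen_cone A)"
  show "\<forall>a\<in>A. pair w a = 0"
  proof
    fix a assume "a \<in> A"
    then have "real_vec w \<bullet> real_vec a = 0" using w real_vec_in_gen_cone by (auto simp: perp_def)
    then show "pair w a = 0" by (simp add: inner_real_vec)
  qed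
next
  assume w: "\<forall>a\<in>A. pair w a = 0"
  have "gen_cone A \<subseteq> {x. real_vec w \<bullet> x \<ge> 0}" "gen_cone A \<subseteq> {x. real_vec w \<bullet> x \<le> 0}"
    unfolding gen_cone_def
    by (rule hull_minimal; use w convex_cone_halfspace_ge convex_cone_halfspace_le in \<open>auto simp: inner_real_vec\<close>)+
  then show "w \<in> perp (gen_cone A)" by (force simp: perp_def)
qed

lemma dual_monoid_add: "w \<in> dual_monoid \<sigma> \<Longrightarrow> w' \<in> dual_monoid \<sigma> \<Longrightarrow> w + w' \<in> dual_monoid \<sigma>"
  by (auto simp: dual_monoid_def real_vec_add inner_add_left)

lemma dual_monoid_zero [simp]: "0 \<in> dual_monoid \<sigma>"
  by (simp add: dual_monoid_def real_vec_def inner_vec_def)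

lemma chart_ring_simps [simp]:
  "carrier (chart_ring \<sigma>) = {f. Poly_Mapping.keys f \<subseteq> dual_monoid \<sigma>}"
  "f \<otimes>\<^bsub>chart_ring \<sigma>\<^esub> g = f * g" "f \<oplus>\<^bsub>chart_ring \<sigma>\<^esub> g = f + g"
  "\<one>\<^bsub>chart_ring \<sigma>\<^esub> = 1" "\<zero>\<^bsub>chart_ring \<sigma>\<^esub> = 0"
  by (simp_all add: chart_ring_def)

abbreviation chart :: "(real ^ 'p::finite) set \<Rightarrow> ('k::comm_ring_1, 'p) laurent set" where
  "chart \<sigma> \<equiv> {f. Poly_Mapping.keys f \<subseteq> dual_monoid \<sigma>}"

lemma chart_closed:
  fixes f g :: "('k::comm_ring_1, 'p::finite) laurent"
  shows "1 \<in> chart \<sigma>" "0 \<in> chart \<sigma>" "f \<in> chart \<sigma> \<Longrightarrow> - f \<in> chart \<sigma>"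
  "f \<in> chart \<sigma> \<Longrightarrow> g \<in> chart \<sigma> \<Longrightarrow> f + g \<in> chart \<sigma>"
  "f \<in> chart \<sigma> \<Longrightarrow> g \<in> chart \<sigma> \<Longrightarrow> f - g \<in> chart \<sigma>"
  "f \<in> chart \<sigma> \<Longrightarrow> g \<in> chart \<sigma> \<Longrightarrow> f * g \<in> chart \<sigma>"
proof -
  show neg: "f \<in> chart \<sigma> \<Longrightarrow> - f \<in> chart \<sigma>" for f :: "('k, 'p) laurent"
    by (auto simp: in_keys_iff)
  show add: "f \<in> chart \<sigma> \<Longrightarrow> g \<in> chart \<sigma> \<Longrightarrow> f + g \<in> chart \<sigma>" for f g :: "('k, 'p) laurent"
    using keys_add[of f g] by blast
  show "f \<in> chart \<sigma> \<Longrightarrow> g \<in> chart \<sigma> \<Longrightarrow> f - g \<in> chart \<sigma>" for f g :: "('k, 'p) laurent"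
    using add[OF _ neg, of f g] by simp
  show "f \<in> chart \<sigma> \<Longrightarrow> g \<in> chart \<sigma> \<Longrightarrow> f * g \<in> chart \<sigma>" for f g :: "('k, 'p) laurent"
    using keys_mult[of f g] dual_monoid_add by blast
  show "1 \<in> chart \<sigma>" by (simp)
qed simp_all

lemma cring_chart_ring: "cring (chart_ring \<sigma> :: ('k::comm_ring_1, 'p::finite) laurent ring)"
  unfolding chart_ring_def by (rule cring_TR_subring) (rule chart_closed; assumption?)+

lemma base_in_chart: "base f \<in> chart \<sigma>"
  by (auto simp: base_def)

lemma chi_in_chart: "w \<in> dual_monoid \<sigma> \<Longrightarrow> chi w \<in> chart \<sigma>"
  by (auto simp: chi_def)

lemma chi_add: "chi (u + w) = chi u * chi w" and chi_zero: "chi 0 = 1"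
  and base_mult: "base (f * g) = base f * base g" and base_add: "base (f + g) = base f + base g"
  and base_zero: "base 0 = 0" and base_one: "base 1 = 1"
  by (simp_all add: chi_def base_def mult_single single_add)

lemma chi_scale: "chi (int n *s u) = chi u ^ n"
proof (induction n)
  case (Suc n)
  have "int (Suc n) *s u = u + int n *s u" by (simp add: vec_eq_iff algebra_simps)
  then show ?case using Suc by (simp add: chi_add)
qed (simp add: chi_zero[symmetric] vec_eq_iff)

lemma chart_prime:
  assumes "primeideal q (chart_ring \<sigma> :: ('k::comm_ring_1, 'p::finite) laurent ring)"
  shows "q \<subseteq> chart \<sigma>" "f \<in> q \<Longrightarrow> g \<in> q \<Longrightarrow> f + g \<in> q" "f \<in> q \<Longrightarrow> g \<in> chart \<sigma> \<Longrightarrow> f * g \<in> q"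
    "f \<in> q \<Longrightarrow> g \<in> chart \<sigma> \<Longrightarrow> g * f \<in> q"
    "0 \<in> q" "1 \<notin> q" "f \<in> chart \<sigma> \<Longrightarrow> g \<in> chart \<sigma> \<Longrightarrow> f * g \<in> q \<Longrightarrow> f \<in> q \<or> g \<in> q"
    "f \<in> q \<Longrightarrow> g \<in> q \<Longrightarrow> f - g \<in> q"
proof -
  interpret primeideal q "chart_ring \<sigma>" by fact
  show "q \<subseteq> chart \<sigma>" using a_subset by simp
  show mult: "g * f \<in> q" if "f \<in> q" "g \<in> chart \<sigma>" for f g using I_l_closed[of f g] that by simp
  show "f * g \<in> q" if "f \<in> q" "g \<in> chart \<sigma>" for f g using I_r_closed[of f g] that by simp
  show add: "f + g \<in> q" if "f \<in> q" "g \<in> q" for f g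
    using additive_subgroup.a_closed[OF ideal.axioms(1)[OF is_ideal] that] by simp
  show "0 \<in> q" using additive_subgroup.zero_closed[OF ideal.axioms(1)[OF is_ideal]] by simp
  show "1 \<notin> q" using I_notcarr one_imp_carrier by auto
  show "f \<in> q \<or> g \<in> q" if "f \<in> chart \<sigma>" "g \<in> chart \<sigma>" "f * g \<in> q" for f g
    using I_prime[of f g] that by simp
  have "- 1 \<in> chart \<sigma>" by (intro chart_closed)
  then show "f - g \<in> q" if "f \<in> q" "g \<in> q" for f g
    using add[OF that(1) mult[OF that(2), of "- 1"]] by simp
qed

lemma chart_power: "f \<in> chart \<sigma> \<Longrightarrow> f ^ n \<in> chart \<sigma>"
proof (induction n)
  case (Suc n)
  then show ?case unfolding power_Suc by (intro chart_closed(6))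
qed (simp add: chart_closed(1))

context regular_complex
begin

lemma dual_vectors:
  assumes A: "A \<in> K"
  shows "\<exists>D. (\<forall>a\<in>A. \<forall>b\<in>A. pair (D a) b = (if a = b then 1 else 0)) \<and>
    (\<forall>x. (\<forall>w. (\<forall>a\<in>A. pair w a = 0) \<longrightarrow> pair w x = 0) \<longrightarrow> x = (\<Sum>a\<in>A. pair (D a) x *s a))"
proof -
  obtain b d where bd: "dual_bases b d" "A \<subseteq> range b" using basis[OF A] by blast
  have delta: "pair (d i) (b j) = (if i = j then 1 else 0)" for i j using bd(1) by (simp add: dual_bases_def)
  have expand: "x = (\<Sum>i\<in>UNIV. pair (d i) x *s b i)" for x using bd(1) by (simp add: dual_bases_def)
  have inj: "inj b"
  proof (rule injI)
    fix i j assume "b i = b j"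
    then show "i = j" using delta[of i i] delta[of i j] by (auto split: if_splits)
  qed
  define I where "I = b -` A"
  have AI: "A = b ` I" using bd(2) by (auto simp: I_def)
  define D where "D a = d (inv_into UNIV b a)" for a
  have D: "D (b i) = d i" for i using inj by (simp add: D_def)
  show ?thesis
  proof (intro exI[of _ D] conjI ballI allI impI)
    fix a a' assume "a \<in> A" "a' \<in> A"
    then show "pair (D a) a' = (if a = a' then 1 else 0)"
      using inj by (auto simp: AI D delta inj_eq)
  next
    fix x assume x: "\<forall>w. (\<forall>a\<in>A. pair w a = 0) \<longrightarrow> pair w x = 0"
    have "pair (d i) x = 0" if "i \<notin> I" for i
    proof -
      have "\<forall>a\<in>A. pair (d i) a = 0" using that by (auto simp: AI delta)
      then show ?thesis using x by blast
    qed
    then have "(\<Sum>i\<in>UNIV. pair (d i) x *s b i) = (\<Sum>i\<in>I. pair (d i) x *s b i)"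
      by (intro sum.mono_neutral_right) auto
    also have "\<dots> = (\<Sum>a\<in>A. pair (D a) x *s a)"
      unfolding AI by (subst sum.reindex) (auto intro: inj_on_subset[OF inj] simp: D)
    finally show "x = (\<Sum>a\<in>A. pair (D a) x *s a)" using expand[of x] by simp
  qed
qed

text \<open>In coordinates with respect to a basis extending \<open>A\<close>, the hypothesis makes the coordinates of
  \<open>x\<close> outside of \<open>A\<close> zero and those on \<open>A - B\<close> nonnegative; the ones on \<open>B\<close> are made nonnegative by the
  translation.\<close>

lemma translate_into_cone:
  assumes A: "A \<in> K" and B: "B \<subseteq> A"
    and pos: "\<And>w. w \<in> dual_monoid (gen_cone A) \<Longrightarrow> \<forall>a\<in>B. pair w a = 0 \<Longrightarrow> 0 \<le> pair w x"
  shows "\<exists>c. (\<forall>a. 0 \<le> c a) \<and> supp c \<subseteq> B \<and> real_vec x + comb c \<in> gen_cone A"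
proof -
  obtain D where D: "\<And>a b. a \<in> A \<Longrightarrow> b \<in> A \<Longrightarrow> pair (D a) b = (if a = b then 1 else 0)"
    and ex: "(\<forall>w. (\<forall>a\<in>A. pair w a = 0) \<longrightarrow> pair w x = 0) \<Longrightarrow> x = (\<Sum>a\<in>A. pair (D a) x *s a)"
    using dual_vectors[OF A] by blast
  have "pair w x = 0" if w: "\<forall>a\<in>A. pair w a = 0" for w
  proof -
    have "\<forall>a\<in>B. pair w a = 0" using w B by blast
    then show ?thesis
      using pos[of w] pos[of "- w"] w by (auto simp: mem_dual_monoid_gen_cone pair_uminus_left)
  qed
  then have x: "x = (\<Sum>a\<in>A. pair (D a) x *s a)" using ex by blast
  have DB: "0 \<le> pair (D a) x" if "a \<in> A - B" for a
    by (rule pos) (use that B in \<open>auto simp: mem_dual_monoid_gen_cone D\<close>)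
  define c where "c a = (if a \<in> B then \<bar>real_of_int (pair (D a) x)\<bar> else 0)" for a
  define e where "e a = (if a \<in> A then real_of_int (pair (D a) x) + c a else 0)" for a
  have fin: "finite A" using finite_mem[OF A] .
  have c: "\<forall>a. 0 \<le> c a" "supp c \<subseteq> B" by (auto simp: c_def supp_def)
  have e: "\<forall>a. 0 \<le> e a" "supp e \<subseteq> A" using DB by (auto simp: e_def c_def supp_def)
  have cA: "supp c \<subseteq> A" using c(2) B by blast
  have "real_vec x = (\<Sum>a\<in>A. real_of_int (pair (D a) x) *\<^sub>R real_vec a)"
    by (subst x) (simp add: vec_eq_iff)
  then have "real_vec x + comb c = comb e"
    unfolding comb_eq[OF fin e(2)] comb_eq[OF fin cA] by (simp add: e_def scaleR_add_left sum.distrib)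
  then show ?thesis using c e mem_gen_cone[OF fin, of "real_vec x + comb c"] by metis
qed

text \<open>The rays of the face are those \<open>a\<close> for which all monomials of positive degree on \<open>a\<close> vanish
  at \<open>q\<close>.  For the remaining rays, choose monomials of positive degree that do not vanish at \<open>q\<close>; every
  monomial of degree \<open>0\<close> on the face divides a power of their product.\<close>

lemma orbit_face:
  fixes q :: "('k::comm_ring_1, 'p) laurent set"
  assumes A: "A \<in> K" and q: "q \<in> chart_points (gen_cone A)"
  shows "\<exists>A'\<subseteq>A. q \<in> orbit (gen_cone A) (gen_cone A')"
proof -
  let ?M = "dual_monoid (gen_cone A)"
  have prime: "primeideal q (chart_ring (gen_cone A))" using q by (simp add: chart_points_def)
  note Q = chart_prime[OF prime]
  define A' where "A' = {a \<in> A. \<forall>w\<in>?M. 0 < pair w a \<longrightarrow> chi w \<in> q}"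
  have sub: "A' \<subseteq> A" by (auto simp: A'_def)
  have pos: "0 \<le> pair w a" if "w \<in> ?M" "a \<in> A" for w a using that by (auto simp: mem_dual_monoid_gen_cone)
  have "chi w \<notin> q \<longleftrightarrow> w \<in> perp (gen_cone A')" if w: "w \<in> ?M" for w
  proof
    assume nq: "chi w \<notin> q"
    have "pair w a = 0" if a: "a \<in> A'" for a
      using a nq w pos[OF w, of a] by (force simp: A'_def)
    then show "w \<in> perp (gen_cone A')" by (simp add: mem_perp_gen_cone)
  next
    assume perp: "w \<in> perp (gen_cone A')"
    have "\<forall>a\<in>A - A'. \<exists>w'. w' \<in> ?M \<and> 0 < pair w' a \<and> chi w' \<notin> q"
      unfolding A'_def by blast
    then obtain W where W: "\<And>a. a \<in> A - A' \<Longrightarrow> W a \<in> ?M \<and> 0 < pair (W a) a \<and> chi (W a) \<notin> q" by metis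
    \<comment> \<open>a large multiple of \<open>s\<close> exceeds \<open>w\<close> on all generators outside the face\<close>
    define s where "s = (\<Sum>a\<in>A - A'. W a)"
    have fin: "finite (A - A')" using finite_mem[OF A] by simp
    have "finite B \<Longrightarrow> B \<subseteq> A - A' \<Longrightarrow> (\<Sum>a\<in>B. W a) \<in> ?M \<and> chi (\<Sum>a\<in>B. W a) \<notin> q" for B
    proof (induction B rule: finite_induct)
      case empty
      then show ?case using Q(6) by (simp add: chi_zero)
    next
      case (insert b B)
      then have b: "W b \<in> ?M" "chi (W b) \<notin> q" and IH: "(\<Sum>a\<in>B. W a) \<in> ?M" "chi (\<Sum>a\<in>B. W a) \<notin> q"
        using W by auto
      have "chi (W b + (\<Sum>a\<in>B. W a)) \<notin> q"
        unfolding chi_add using Q(7)[OF chi_in_chart[OF b(1)] chi_in_chart[OF IH(1)]] b IH by blast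
      then show ?case using insert.hyps dual_monoid_add[OF b(1) IH(1)] by simp
    qed
    then have s: "s \<in> ?M" "chi s \<notin> q" using fin by (auto simp: s_def)
    define N where "N = nat (\<Sum>a\<in>A. pair w a)"
    have N: "pair w a \<le> int N" if "a \<in> A" for a
    proof -
      have "pair w a \<le> (\<Sum>a\<in>A. pair w a)"
        using pos[OF w] that finite_mem[OF A] by (intro member_le_sum) auto
      then show ?thesis by (simp add: N_def)
    qed
    have "int N *s s - w \<in> ?M"
      unfolding mem_dual_monoid_gen_cone
    proof
      fix a assume a: "a \<in> A"
      show "0 \<le> pair (int N *s s - w) a"
      proof (cases "a \<in> A'")
        case True
        then have "pair w a = 0" using perp by (simp add: mem_perp_gen_cone)
        then show ?thesis using pos[OF s(1) a] by (simp add: pair_diff_left pair_scale_left)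
      next
        case False
        have "0 < pair (W a) a" using W a False by blast
        also have "pair (W a) a \<le> pair s a"
          unfolding s_def pair_sum_left using fin W pos a False by (intro member_le_sum) auto
        finally have "1 \<le> pair s a" by simp
        then have "int N * 1 \<le> int N * pair s a" by (intro mult_left_mono) auto
        then show ?thesis using N[OF a] by (simp add: pair_diff_left pair_scale_left)
      qed
    qed
    moreover have "chi (int N *s s) \<notin> q"
      unfolding chi_scale
    proof (induction N)
      case 0 then show ?case using Q(6) by simp
    next
      case (Suc n)
      show ?case using Q(7)[OF chi_in_chart[OF s(1)] chart_power[OF chi_in_chart[OF s(1)]]] Suc s(2)
        unfolding power_Suc by blast
    qed
    moreover have "int N *s s = w + (int N *s s - w)" by simp
    ultimately show "chi w \<notin> q" using Q(3)[of "chi w" "chi (int N *s s - w)"] chi_in_chart chi_add by metis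
  qed
  then have "q \<in> orbit (gen_cone A) (gen_cone A')"
    using q cone_face_gen_cone[OF A sub] by (auto simp: orbit_def)
  then show ?thesis using sub by blast
qed

text \<open>The monomial dual to a generator \<open>a\<close> vanishes on the orbit of a face iff \<open>a\<close> belongs to the face.\<close>

lemma orbit_unique:
  fixes q :: "('k::comm_ring_1, 'p) laurent set"
  assumes A: "A \<in> K" "A1 \<subseteq> A" "A2 \<subseteq> A"
    and q: "q \<in> orbit (gen_cone A) (gen_cone A1)" "q \<in> orbit (gen_cone A) (gen_cone A2)"
  shows "A1 = A2"
proof -
  obtain D where D: "\<And>a b. a \<in> A \<Longrightarrow> b \<in> A \<Longrightarrow> pair (D a) b = (if a = b then 1 else 0)"
    using dual_vectors[OF A(1)] by blast
  have *: "a \<in> B \<longleftrightarrow> chi (D a) \<in> q" if "a \<in> A" "B \<subseteq> A" "q \<in> orbit (gen_cone A) (gen_cone B)" for a B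
  proof -
    have "D a \<in> dual_monoid (gen_cone A)" using that D by (simp add: mem_dual_monoid_gen_cone)
    then have "chi (D a) \<notin> q \<longleftrightarrow> (\<forall>b\<in>B. pair (D a) b = 0)"
      using that(3) by (simp add: orbit_def mem_perp_gen_cone)
    also have "\<dots> \<longleftrightarrow> a \<notin> B" using that D by (auto simp: subset_iff)
    finally show ?thesis by blast
  qed
  show ?thesis using *[OF _ A(2) q(1)] *[OF _ A(3) q(2)] A(2,3) by blast
qed

end

section \<open>Faces of the orthant\<close>

lemma orthant_eq_gen_cone: "(orthant :: (real ^ 'p::finite) set) = gen_cone (range (\<lambda>i. axis i 1))"
proof -
  let ?E = "range (\<lambda>i. axis i 1) :: (int ^ 'p) set"
  interpret regular_complex "Pow ?E" by (rule regular_complex_orthant)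
  show ?thesis
  proof
    show "gen_cone ?E \<subseteq> orthant" by (rule gen_cone_subset_orthant) simp
    show "orthant \<subseteq> gen_cone ?E"
    proof
      fix x :: "real ^ 'p" assume "x \<in> orthant"
      then obtain c where c: "\<forall>a. 0 \<le> c a" "supp c \<in> Pow ?E" "comb c = x" using cover by blast
      then show "x \<in> gen_cone ?E" using mem_gen_cone[of ?E x] by auto
    qed
  qed
qed

lemma orthant_face_eq:
  fixes \<tau> :: "(real ^ 'p::finite) set"
  assumes "\<tau> \<in> orthant_fan"
  shows "\<tau> = gen_cone {axis i 1 | i. axis i 1 \<in> \<tau>}"
proof -
  let ?E = "range (\<lambda>i. axis i 1) :: (int ^ 'p) set"
  interpret regular_complex "Pow ?E" by (rule regular_complex_orthant)
  have "cone_face \<tau> (gen_cone ?E)" using assms by (simp add: orthant_fan_def orthant_eq_gen_cone)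
  then obtain A where A: "A \<subseteq> ?E" "\<tau> = gen_cone A" using cone_face_gen_cone_subset[of ?E \<tau>] by auto
  have "axis i 1 \<in> A \<longleftrightarrow> axis i 1 \<in> \<tau>" for i
    using generator_in_gen_cone[of A "axis i 1"] real_vec_in_gen_cone[of "axis i 1" A] A
    by (auto simp: real_vec_axis)
  then have "A = {axis i 1 | i. axis i 1 \<in> \<tau>}" using A(1) by blast
  then show ?thesis using A(2) by simp
qed

lemma gen_cone_axes_in_orthant_fan: "gen_cone ((\<lambda>i. axis i 1) ` N) \<in> orthant_fan"
proof -
  let ?E = "range (\<lambda>i. axis i 1) :: (int ^ 'a) set"
  interpret regular_complex "Pow ?E" by (rule regular_complex_orthant)
  show ?thesis
    using cone_face_gen_cone[of ?E "(\<lambda>i. axis i 1) ` N"] by (auto simp: orthant_fan_def orthant_eq_gen_cone)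
qed

lemma orthant_face_interior:
  fixes \<tau> :: "(real ^ 'p::finite) set"
  assumes "\<tau> \<in> orthant_fan" "x \<in> \<tau>" "\<And>i. 0 < x $ i"
  shows "\<tau> = orthant"
proof -
  let ?A = "{axis i 1 | i. axis i 1 \<in> \<tau>} :: (int ^ 'p) set"
  have A: "\<tau> = gen_cone ?A" by (rule orthant_face_eq[OF assms(1)])
  have fin: "finite ?A" by simp
  obtain c where c: "supp c \<subseteq> ?A" "comb c = x" using assms(2) A mem_gen_cone[OF fin, of x] by blast
  have "axis i 1 \<in> ?A" for i
  proof (rule ccontr)
    assume i: "axis i 1 \<notin> ?A"
    have "(a :: int ^ 'p) $ i = 0" if "a \<in> ?A" for a using that i by (auto simp: axis_def)
    then have "comb c $ i = 0" unfolding comb_eq[OF fin c(1)] sum_component by (intro sum.neutral) auto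
    then show False using assms(3)[of i] c(2) by simp
  qed
  then have E: "?A = range (\<lambda>i. axis i 1)" by blast
  have "gen_cone ?A = orthant" unfolding E orthant_eq_gen_cone ..
  with A show ?thesis by (rule trans)
qed

section \<open>Evaluating chart functions along a branch\<close>

lemma fls_subdegree_prod_idom:
  fixes F :: "'a \<Rightarrow> 'b::idom fls"
  assumes "\<And>x. F x \<noteq> 0"
  shows "fls_subdegree (\<Prod>x\<in>I. F x) = (\<Sum>x\<in>I. fls_subdegree (F x))"
  using assms by (induction I rule: infinite_finite_induct) auto

context branch_family
begin

text \<open>The exponents of monomials without poles along the coordinate hyperplanes that contain the
  branch; on them \<open>monomial_value\<close> below is multiplicative.\<close>

definition effective :: "'r \<Rightarrow> (int ^ ('m + 'r)) set" where
  "effective j = {w. \<forall>i\<in>vanishing j. 0 \<le> w $ i}"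

definition nonvanishing :: "'r \<Rightarrow> (int ^ ('m + 'r)) set" where
  "nonvanishing j = {w. \<forall>i\<in>vanishing j. w $ i = 0}"

definition monomial_value :: "'r \<Rightarrow> int ^ ('m + 'r) \<Rightarrow> 'k fls" where
  "monomial_value j w = (if w \<in> nonvanishing j
     then \<Prod>i\<in>UNIV. fps_to_fls (\<theta> j (mvar i)) powi (w $ i) else 0)"

text \<open>The restriction of a function to the branch: the image under \<open>z\<^sub>i \<mapsto> \<theta> z\<^sub>i\<close>.\<close>

definition eval_branch :: "'r \<Rightarrow> ('k, 'm + 'r) laurent \<Rightarrow> 'k fls" where
  "eval_branch j f = (\<Sum>w\<in>Poly_Mapping.keys f.
     fps_to_fls (\<theta> j (Poly_Mapping.lookup f w)) * monomial_value j w)"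

lemma nonvanishing_zero [simp]: "0 \<in> nonvanishing j"
  by (simp add: nonvanishing_def)

lemma nonvanishing_add: "w \<in> nonvanishing j \<Longrightarrow> w' \<in> nonvanishing j \<Longrightarrow> w + w' \<in> nonvanishing j"
  by (simp add: nonvanishing_def)

lemma monomial_value_zero: "monomial_value j 0 = 1"
  by (simp add: monomial_value_def)

lemma monomial_value_nonzero:
  assumes "w \<in> nonvanishing j"
  shows "monomial_value j w \<noteq> 0" "fls_subdegree (monomial_value j w) = pair w (v j)"
proof -
  have nz: "fps_to_fls (\<theta> j (mvar i)) powi (w $ i) \<noteq> 0" for i
  proof (cases "i \<in> vanishing j")
    case True
    then have "w $ i = 0" using assms by (simp add: nonvanishing_def)
    then show ?thesis by simp
  next
    case False
    then have "fps_to_fls (\<theta> j (mvar i)) \<noteq> 0" using mvar_zero_iff[of j i] by simp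
    then show ?thesis by (simp add: power_int_eq_0_iff)
  qed
  then show "monomial_value j w \<noteq> 0" using assms by (simp add: monomial_value_def)
  have "fls_subdegree (\<Prod>i\<in>UNIV. fps_to_fls (\<theta> j (mvar i)) powi (w $ i))
      = (\<Sum>i\<in>UNIV. fls_subdegree (fps_to_fls (\<theta> j (mvar i)) powi (w $ i)))"
    using nz by (intro fls_subdegree_prod_idom)
  also have "\<dots> = pair w (v j)"
    by (simp add: pair_def v_nth fls_subdegree_fls_to_fps)
  finally show "fls_subdegree (monomial_value j w) = pair w (v j)"
    using assms by (simp add: monomial_value_def)
qed

lemma monomial_value_add:
  assumes "w \<in> effective j" "w' \<in> effective j"
  shows "monomial_value j (w + w') = monomial_value j w * monomial_value j w'"
proof (cases "w \<in> nonvanishing j \<and> w' \<in> nonvanishing j")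
  case True
  have "fps_to_fls (\<theta> j (mvar i)) powi ((w + w') $ i)
      = fps_to_fls (\<theta> j (mvar i)) powi (w $ i) * fps_to_fls (\<theta> j (mvar i)) powi (w' $ i)" for i
  proof (cases "i \<in> vanishing j")
    case i: True
    have "w $ i = 0" "w' $ i = 0" using True i by (auto simp: nonvanishing_def)
    then show ?thesis by simp
  next
    case False
    then have "fps_to_fls (\<theta> j (mvar i)) \<noteq> 0" using mvar_zero_iff[of j i] by simp
    then show ?thesis by (simp add: power_int_add)
  qed
  then show ?thesis
    using True nonvanishing_add[of w j w'] by (simp add: monomial_value_def prod.distrib)
next
  case False
  then obtain i where i: "i \<in> vanishing j" "w $ i \<noteq> 0 \<or> w' $ i \<noteq> 0" by (auto simp: nonvanishing_def)
  moreover have "0 \<le> w $ i" "0 \<le> w' $ i" using assms i by (auto simp: effective_def)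
  ultimately have "(w + w') $ i \<noteq> 0" by auto
  then have "w + w' \<notin> nonvanishing j" using i(1) by (auto simp: nonvanishing_def)
  then show ?thesis using False by (auto simp: monomial_value_def)
qed

lemma monomial_value_axis: "monomial_value j (axis i 1) = fps_to_fls (\<theta> j (mvar i))"
proof (cases "i \<in> vanishing j")
  case True
  then have "axis i 1 \<notin> nonvanishing j" by (auto simp: nonvanishing_def axis_def)
  then show ?thesis using True mvar_zero_iff[of j i] by (simp add: monomial_value_def)
next
  case False
  then have "axis i 1 \<in> nonvanishing j" by (auto simp: nonvanishing_def axis_def)
  moreover have "fps_to_fls (\<theta> j (mvar k)) powi (axis i 1 $ k) = (if k = i then fps_to_fls (\<theta> j (mvar k)) else 1)" for k
    by (auto simp: axis_def)
  ultimately show ?thesis by (simp add: monomial_value_def)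
qed

lemma eval_branch_eq:
  assumes "finite F" "Poly_Mapping.keys f \<subseteq> F"
  shows "eval_branch j f = (\<Sum>w\<in>F. fps_to_fls (\<theta> j (Poly_Mapping.lookup f w)) * monomial_value j w)"
  unfolding eval_branch_def
  by (rule sum.mono_neutral_left) (use assms formal_arc.hom_0[OF arc] in \<open>auto simp: in_keys_iff\<close>)

lemma eval_branch_add: "eval_branch j (f + g) = eval_branch j f + eval_branch j g"
proof -
  let ?F = "Poly_Mapping.keys f \<union> Poly_Mapping.keys g"
  show ?thesis
    using keys_add[of f g]
    by (simp add: eval_branch_eq[of ?F] lookup_add formal_arc.hom_add[OF arc] distrib_right sum.distrib)
qed

lemma eval_branch_zero: "eval_branch j 0 = 0"
  by (simp add: eval_branch_def)

lemma eval_branch_diff: "eval_branch j (f - g) = eval_branch j f - eval_branch j g"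
  using eval_branch_add[of j "f - g" g] by simp

lemma eval_branch_sum: "eval_branch j (sum f F) = (\<Sum>x\<in>F. eval_branch j (f x))"
  by (induction F rule: infinite_finite_induct) (auto simp: eval_branch_zero eval_branch_add)

lemma eval_branch_single: "eval_branch j (Poly_Mapping.single w c) = fps_to_fls (\<theta> j c) * monomial_value j w"
  by (subst eval_branch_eq[of "{w}"]) auto

lemma eval_branch_base: "eval_branch j (base f) = fps_to_fls (\<theta> j f)"
  by (simp add: base_def eval_branch_single monomial_value_zero)

lemma eval_branch_chi: "eval_branch j (chi w) = monomial_value j w"
  by (simp add: chi_def eval_branch_single formal_arc.hom_1[OF arc])

lemma eval_branch_one: "eval_branch j 1 = 1"
  using eval_branch_chi[of j 0] by (simp add: chi_zero monomial_value_zero)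

lemma sum_of_singles: "f = (\<Sum>w\<in>Poly_Mapping.keys f. Poly_Mapping.single w (Poly_Mapping.lookup f w))"
proof (rule poly_mapping_eqI)
  fix k
  have "(\<Sum>w\<in>Poly_Mapping.keys f. Poly_Mapping.lookup (Poly_Mapping.single w (Poly_Mapping.lookup f w)) k)
      = (\<Sum>w\<in>Poly_Mapping.keys f. if w = k then Poly_Mapping.lookup f k else 0)"
    by (intro sum.cong) (auto simp: lookup_single when_def)
  also have "\<dots> = Poly_Mapping.lookup f k" by (simp add: in_keys_iff)
  finally show "Poly_Mapping.lookup f k
      = Poly_Mapping.lookup (\<Sum>w\<in>Poly_Mapping.keys f. Poly_Mapping.single w (Poly_Mapping.lookup f w)) k"
    by (simp add: lookup_sum)
qed

lemma eval_branch_mult: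
  assumes "Poly_Mapping.keys f \<subseteq> effective j" "Poly_Mapping.keys g \<subseteq> effective j"
  shows "eval_branch j (f * g) = eval_branch j f * eval_branch j g"
proof -
  let ?l = Poly_Mapping.lookup and ?s = Poly_Mapping.single
  have "f * g = (\<Sum>w\<in>Poly_Mapping.keys f. \<Sum>w'\<in>Poly_Mapping.keys g. ?s (w + w') (?l f w * ?l g w'))"
    by (subst sum_of_singles[of f], subst sum_of_singles[of g]) (simp add: sum_product mult_single)
  then have "eval_branch j (f * g) = (\<Sum>w\<in>Poly_Mapping.keys f. \<Sum>w'\<in>Poly_Mapping.keys g.
      fps_to_fls (\<theta> j (?l f w * ?l g w')) * monomial_value j (w + w'))"
    by (simp add: eval_branch_sum eval_branch_single)
  also have "\<dots> = (\<Sum>w\<in>Poly_Mapping.keys f. \<Sum>w'\<in>Poly_Mapping.keys g.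
      (fps_to_fls (\<theta> j (?l f w)) * monomial_value j w) * (fps_to_fls (\<theta> j (?l g w')) * monomial_value j w'))"
    using assms monomial_value_add
    by (intro sum.cong refl) (simp add: subset_iff formal_arc.hom_mult[OF arc] fls_times_fps_to_fls)
  also have "\<dots> = eval_branch j f * eval_branch j g"
    by (simp add: eval_branch_def sum_product)
  finally show ?thesis .
qed

lemma dual_effective:
  assumes "S j \<subseteq> A"
  shows "dual_monoid (gen_cone A) \<subseteq> effective j"
proof
  fix w assume "w \<in> dual_monoid (gen_cone A)"
  then have "\<forall>a\<in>S j. 0 \<le> pair w a" using assms by (auto simp: mem_dual_monoid_gen_cone)
  then show "w \<in> effective j" by (simp add: effective_def S_def)
qed

lemma mem_perp_S: "w \<in> perp (gen_cone (S j)) \<longleftrightarrow> w \<in> nonvanishing j"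
  by (simp add: mem_perp_gen_cone S_def nonvanishing_def)

definition branch_point :: "'r \<Rightarrow> (int ^ ('m + 'r)) set \<Rightarrow> ('k, 'm + 'r) laurent set" where
  "branch_point j A = {f \<in> chart (gen_cone A). eval_branch j f = 0}"

lemma eval_branch_mult_chart:
  assumes "S j \<subseteq> A" "f \<in> chart (gen_cone A)" "g \<in> chart (gen_cone A)"
  shows "eval_branch j (f * g) = eval_branch j f * eval_branch j g"
  using assms dual_effective[OF assms(1)] by (intro eval_branch_mult) auto

lemma eval_branch_hom:
  assumes "S j \<subseteq> A"
  shows "eval_branch j \<in> ring_hom (chart_ring (gen_cone A)) TR"
  by (rule ring_hom_memI)
    (use eval_branch_mult_chart[OF assms] in \<open>auto simp: eval_branch_add eval_branch_one\<close>)

lemma eval_branch_relation: "f \<in> chart_relations \<Longrightarrow> eval_branch j f = 0"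
  by (auto simp: chart_relations_def eval_branch_diff eval_branch_chi eval_branch_base monomial_value_axis)

text \<open>Multiplication by a monomial that does not vanish on the branch turns every function of the
  chart into a power series, up to elements of any of the points of \<open>O(S j)\<close>.\<close>

lemma clear_denominators:
  fixes f :: "('k, 'm + 'r) laurent"
  assumes f: "f \<in> chart (gen_cone A)" and A: "\<And>a i. a \<in> A \<Longrightarrow> 0 \<le> a $ i"
  shows "\<exists>w g. w \<in> dual_monoid (gen_cone A) \<and> w \<in> nonvanishing j \<and>
    (\<forall>q \<in> chart_points (gen_cone A). (\<forall>u\<in>dual_monoid (gen_cone A). u \<notin> nonvanishing j \<longrightarrow> chi u \<in> q) \<longrightarrow>
       chi w * f - base g \<in> q)"
proof -
  let ?M = "dual_monoid (gen_cone A)"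
  have nonneg: "w \<in> ?M" if "\<And>i. 0 \<le> w $ i" for w
    using that A by (auto simp: mem_dual_monoid_gen_cone pair_def intro!: sum_nonneg)
  \<comment> \<open>\<open>w + u\<close> is nonnegative for every exponent \<open>u\<close> of \<open>f\<close> that does not vanish on the branch\<close>
  define w :: "int ^ ('m + 'r)" where
    "w = (\<chi> i. if i \<in> vanishing j then 0 else (\<Sum>u\<in>Poly_Mapping.keys f. \<bar>u $ i\<bar>))"
  have w: "w \<in> ?M" "w \<in> nonvanishing j"
    by (rule nonneg) (auto simp: w_def nonvanishing_def)
  define Z :: "int ^ ('m + 'r) \<Rightarrow> ('k, 'm + 'r) mfps" where
    "Z u = (\<Prod>i\<in>UNIV. mvar i ^ nat (u $ i))" for u
  define g where "g = (\<Sum>u\<in>Poly_Mapping.keys f. if u \<in> nonvanishing j then Poly_Mapping.lookup f u * Z (w + u) else 0)"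
  have "chi w * f - base g \<in> q" if q: "q \<in> chart_points (gen_cone A)"
    and van: "\<forall>u\<in>?M. u \<notin> nonvanishing j \<longrightarrow> chi u \<in> q" for q
  proof -
    have prime: "primeideal q (chart_ring (gen_cone A))" and rel: "chart_relations \<subseteq> q"
      using q by (auto simp: chart_points_def)
    note Q = chart_prime[OF prime]
    have cong_mult: "a * b - a' * b' \<in> q"
      if "a - a' \<in> q" "b - b' \<in> q" "b \<in> chart (gen_cone A)" "a' \<in> chart (gen_cone A)" for a b a' b'
    proof -
      have "a * b - a' * b' = (a - a') * b + a' * (b - b')" by (simp add: algebra_simps)
      then show ?thesis using Q(2)[OF Q(3)[OF that(1,3)] Q(4)[OF that(2,4)]] by simp
    qed
    have cong_power: "a ^ n - b ^ n \<in> q"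
      if "a - b \<in> q" "a \<in> chart (gen_cone A)" "b \<in> chart (gen_cone A)" for a b n
    proof (induction n)
      case 0 then show ?case using Q(5) by simp
    next
      case (Suc n)
      show ?case unfolding power_Suc by (rule cong_mult[OF that(1) Suc chart_power[OF that(2)] that(3)])
    qed
    have axis_mem: "axis i 1 \<in> ?M" for i by (rule nonneg) (simp add: axis_def)
    have monom: "chi (\<Sum>i\<in>B. int (e i) *s axis i 1) - base (\<Prod>i\<in>B. mvar i ^ e i) \<in> q \<and>
        (chi (\<Sum>i\<in>B. int (e i) *s axis i 1) :: ('k, 'm + 'r) laurent) \<in> chart (gen_cone A)" if "finite B" for B and e :: "'m + 'r \<Rightarrow> nat"
      using that
    proof (induction B rule: finite_induct)
      case empty
      then show ?case using Q(5) chart_closed(1) by (simp add: chi_zero base_one)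
    next
      case (insert i B)
      let ?c = "chi (\<Sum>i\<in>B. int (e i) *s axis i 1) :: ('k, 'm + 'r) laurent"
      have r: "chi (axis i 1) - base (mvar i) \<in> q" using rel by (auto simp: chart_relations_def)
      have base_power: "base (mvar i ^ n) = base (mvar i) ^ n" for n
        by (induction n) (auto simp: base_mult base_one)
      have "chi (axis i 1) ^ e i * ?c - base (mvar i) ^ e i * base (\<Prod>i\<in>B. mvar i ^ e i) \<in> q"
      proof (rule cong_mult)
        show "chi (axis i 1) ^ e i - base (mvar i) ^ e i \<in> q"
          by (rule cong_power[OF r chi_in_chart[OF axis_mem] base_in_chart])
        show "?c - base (\<Prod>i\<in>B. mvar i ^ e i) \<in> q" "?c \<in> chart (gen_cone A)"
          using insert.IH by blast+
        show "base (mvar i) ^ e i \<in> chart (gen_cone A)" by (rule chart_power[OF base_in_chart])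
      qed
      moreover have "chi (axis i 1) ^ e i * ?c \<in> chart (gen_cone A)"
        by (rule chart_closed(6)[OF chart_power[OF chi_in_chart[OF axis_mem]] conjunct2[OF insert.IH]])
      ultimately show ?case
        using insert.hyps by (simp add: chi_add chi_scale base_mult base_power)
    qed
    have Z: "chi u - base (Z u) \<in> q" if "\<And>i. 0 \<le> u $ i" for u
    proof -
      have "u = (\<Sum>i\<in>UNIV. int (nat (u $ i)) *s axis i 1)"
        using that by (simp add: vec_eq_iff axis_def if_distrib cong: if_cong)
      then show ?thesis using monom[of UNIV "\<lambda>i. nat (u $ i)"] by (simp add: Z_def)
    qed
    have term_mem: "chi w * Poly_Mapping.single u (Poly_Mapping.lookup f u)
        - base (if u \<in> nonvanishing j then Poly_Mapping.lookup f u * Z (w + u) else 0) \<in> q"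
      if u: "u \<in> Poly_Mapping.keys f" for u
    proof -
      let ?c = "Poly_Mapping.lookup f u"
      have uM: "u \<in> ?M" using f u by auto
      have single: "chi w * Poly_Mapping.single u ?c = base ?c * chi (w + u)"
        by (simp add: chi_def base_def mult_single)
      show ?thesis
      proof (cases "u \<in> nonvanishing j")
        case True
        have "0 \<le> (w + u) $ i" for i
        proof (cases "i \<in> vanishing j")
          case True
          then show ?thesis using \<open>u \<in> nonvanishing j\<close> by (simp add: w_def nonvanishing_def)
        next
          case False
          have "\<bar>u $ i\<bar> \<le> (\<Sum>u\<in>Poly_Mapping.keys f. \<bar>u $ i\<bar>)"
            using u by (intro member_le_sum) auto
          then show ?thesis using False by (simp add: w_def)
        qed
        then have "base ?c * (chi (w + u) - base (Z (w + u))) \<in> q" using Q(4)[OF Z base_in_chart] by blast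
        then show ?thesis using True single by (simp add: base_mult algebra_simps)
      next
        case False
        then have "w + u \<notin> nonvanishing j" using w(2) by (auto simp: nonvanishing_def)
        then have "chi (w + u) \<in> q" using van dual_monoid_add[OF w(1) uM] by blast
        then show ?thesis using False single Q(4)[OF _ base_in_chart] by (simp add: base_zero)
      qed
    qed
    have base_sum: "base (sum h F) = (\<Sum>x\<in>F. base (h x))" for h :: "int ^ ('m + 'r) \<Rightarrow> ('k, 'm + 'r) mfps" and F
      by (induction F rule: infinite_finite_induct) (auto simp: base_zero base_add)
    have sum_mem: "sum h F \<in> q" if "\<And>x. x \<in> F \<Longrightarrow> h x \<in> q" for h :: "int ^ ('m + 'r) \<Rightarrow> _" and F
      using that by (induction F rule: infinite_finite_induct) (auto simp: Q(5) Q(2))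
    have "chi w * f - base g = (\<Sum>u\<in>Poly_Mapping.keys f. chi w * Poly_Mapping.single u (Poly_Mapping.lookup f u)
        - base (if u \<in> nonvanishing j then Poly_Mapping.lookup f u * Z (w + u) else 0))"
      unfolding sum_subtractf g_def base_sum sum_distrib_left[symmetric] sum_of_singles[symmetric] ..
    then show ?thesis using sum_mem[of _ "\<lambda>u. chi w * Poly_Mapping.single u (Poly_Mapping.lookup f u)
        - base (if u \<in> nonvanishing j then Poly_Mapping.lookup f u * Z (w + u) else 0)"] term_mem by simp
  qed
  then show ?thesis using w by blast
qed

end

section \<open>Non-exceptional points over a branch\<close>

lemma chart_idealI:
  fixes J :: "('k::comm_ring_1, 'p::finite) laurent set"
  assumes "J \<subseteq> chart \<sigma>" "0 \<in> J" "\<And>f g. f \<in> J \<Longrightarrow> g \<in> J \<Longrightarrow> f + g \<in> J"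
    and mult: "\<And>f g. f \<in> J \<Longrightarrow> g \<in> chart \<sigma> \<Longrightarrow> g * f \<in> J"
  shows "ideal J (chart_ring \<sigma>)"
proof -
  interpret R: cring "chart_ring \<sigma> :: ('k, 'p) laurent ring" by (rule cring_chart_ring)
  have inv: "\<ominus>\<^bsub>chart_ring \<sigma>\<^esub> f = - f" if "f \<in> chart \<sigma>" for f :: "('k, 'p) laurent"
    by (rule R.minus_equality) (use that chart_closed(3)[OF that] in simp_all)
  have neg: "- f \<in> J" if "f \<in> J" for f
    using mult[OF that chart_closed(3)[OF chart_closed(1)]] by simp
  show ?thesis
  proof (rule idealI[OF R.ring_axioms])
    show "subgroup J (add_monoid (chart_ring \<sigma>))"
    proof (rule subgroup.intro)
      show "inv\<^bsub>add_monoid (chart_ring \<sigma>)\<^esub> f \<in> J" if "f \<in> J" for f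
      proof -
        have "f \<in> chart \<sigma>" using that assms(1) by blast
        then show ?thesis using inv[unfolded a_inv_def] neg[OF that] by metis
      qed
    qed (use assms in auto)
  qed (use mult in \<open>auto simp: mult.commute\<close>)
qed

lemma prime_contains_some:
  fixes Q :: "'a::comm_ring_1 set"
  assumes T: "finite T" and sub: "(\<Inter>j\<in>T. J j) \<subseteq> Q"
    and J: "\<And>j f g. f \<in> J j \<Longrightarrow> f * g \<in> J j"
    and Q: "\<And>f g. f * g \<in> Q \<Longrightarrow> f \<in> Q \<or> g \<in> Q" "1 \<notin> Q"
  shows "\<exists>j\<in>T. J j \<subseteq> Q"
proof (rule ccontr)
  assume "\<not> ?thesis"
  then have "\<forall>j\<in>T. \<exists>f. f \<in> J j \<and> f \<notin> Q" by blast
  then obtain F where F: "\<And>j. j \<in> T \<Longrightarrow> F j \<in> J j \<and> F j \<notin> Q" by metis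
  have "(\<Prod>i\<in>T. F i) \<in> J j" if "j \<in> T" for j
    unfolding prod.remove[OF T that] using F[OF that] J by blast
  then have "(\<Prod>i\<in>T. F i) \<in> Q" using sub by blast
  moreover have "(\<Prod>i\<in>B. F i) \<notin> Q" if "finite B" "B \<subseteq> T" for B
    using that
  proof (induction B rule: finite_induct)
    case (insert b B)
    then show ?case using Q(1)[of "F b" "\<Prod>i\<in>B. F i"] F[of b] by auto
  qed (use Q(2) in simp)
  ultimately show False using T by blast
qed

locale adapted_complex = branch_family \<theta> + regular_complex K
  for \<theta> :: "'r::finite \<Rightarrow> ('k::field, 'm::finite + 'r) mfps \<Rightarrow> 'k fps"
    and K :: "(int ^ ('m + 'r)) set set" +
  fixes u :: "'r \<Rightarrow> int ^ ('m + 'r)"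
  assumes u_notin: "u j \<notin> S j" and u_edge: "insert (u j) (S j) \<in> K"
    and u_nth: "i \<notin> vanishing j \<Longrightarrow> u j $ i = v j $ i"
begin

abbreviation fan_of_K :: "(real ^ ('m + 'r)) set set" where
  "fan_of_K \<equiv> gen_cone ` K"

lemma S_in_K: "S j \<in> K"
  using down[OF u_edge] by blast

lemma finite_S: "finite (S j)"
  using finite_mem[OF S_in_K] .

lemma axis_nonvanishing: "a \<in> S j \<Longrightarrow> i \<notin> vanishing j \<Longrightarrow> a $ i = 0"
  by (auto simp: S_def axis_def)

text \<open>If the orthant were a cone of the complex, the cone of \<open>u j\<close> and \<open>S j\<close> would be a face of it.  Since it
  contains a vector with positive coordinates, it would be the whole orthant.  But \<open>u j\<close> has at least
  two nonzero coordinates outside of \<open>vanishing j\<close>, so the axis of \<open>z\<^sub>1\<close> is not in that cone.\<close>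

lemma orthant_notin: "orthant \<notin> fan_of_K"
proof
  assume "orthant \<in> fan_of_K"
  then obtain A where A: "A \<in> K" "gen_cone A = orthant" by auto
  obtain j :: 'r and s :: 'm where True by blast
  let ?B = "insert (u j) (S j)"
  have finB: "finite ?B" using finite_S by simp
  define c :: "int ^ ('m + 'r) \<Rightarrow> real" where "c a = (if a \<in> ?B then 1 else 0)" for a
  have c: "supp c = ?B" "\<forall>a. 0 \<le> c a" by (auto simp: supp_def c_def)
  have x: "comb c \<in> gen_cone ?B" using mem_gen_cone[OF finB, of "comb c"] c by blast
  then have "comb c \<in> gen_cone A" using gen_cone_subset_orthant[OF u_edge] A(2) by blast
  then have sub: "?B \<subseteq> A" using gen_cone_eqD[OF A(1), of c] c u_edge by auto
  have face: "gen_cone ?B \<in> orthant_fan"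
    using cone_face_gen_cone[OF A(1) sub] A(2) by (simp add: orthant_fan_def)
  have "0 < comb c $ i" for i
  proof -
    have "comb c $ i = (\<Sum>a\<in>?B. real_of_int (a $ i))"
      unfolding comb_eq[OF finB eq_refl[OF c(1)]] sum_component
      by (intro sum.cong) (auto simp: c_def)
    also have "\<dots> = real_of_int (\<Sum>a\<in>?B. a $ i)" by simp
    finally have e: "comb c $ i = real_of_int (\<Sum>a\<in>?B. a $ i)" .
    have mem: "a $ i \<le> (\<Sum>a\<in>?B. a $ i)" if "a \<in> ?B" for a
      using that nonneg[OF u_edge] finB by (intro member_le_sum) auto
    show ?thesis
    proof (cases "i \<in> vanishing j")
      case True
      then have "axis i 1 \<in> ?B" by (simp add: S_def)
      from mem[OF this] show ?thesis unfolding e by (simp del: of_int_sum)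
    next
      case False
      then have "0 < u j $ i" using u_nth v_pos by simp
      then show ?thesis unfolding e using mem[of "u j"] by (simp del: of_int_sum)
    qed
  qed
  then have "gen_cone ?B = orthant" by (rule orthant_face_interior[OF face x])
  moreover have "axis (Inl s) 1 \<in> (orthant :: (real ^ ('m + 'r)) set)" by (simp add: orthant_def axis_def)
  ultimately have "axis (Inl s) 1 \<in> gen_cone ?B" by simp
  then obtain e where e: "supp e \<subseteq> ?B" "comb e = axis (Inl s) 1"
    using mem_gen_cone[OF finB, of "axis (Inl s) 1"] by blast
  have coord: "comb e $ i = e (u j) * real_of_int (u j $ i)" if "i \<notin> vanishing j" for i
  proof -
    have "(\<Sum>a\<in>S j. (e a *\<^sub>R real_vec a) $ i) = 0"
      using axis_nonvanishing[OF _ that] by (intro sum.neutral) auto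
    then show ?thesis
      unfolding comb_eq[OF finB e(1)] sum_component using u_notin finite_S by simp
  qed
  have "e (u j) * real_of_int (u j $ Inr j) = 0" using coord[of "Inr j"] e(2) by (simp add: axis_def)
  moreover have "0 < u j $ Inr j" using u_nth[of "Inr j" j] v_pos[of "Inr j" j] by simp
  ultimately have "e (u j) = 0" by simp
  then have "comb e $ Inl s = 0" using coord[of "Inl s"] by simp
  then show False using e(2) by (simp add: axis_def)
qed

lemma branch_point_prime:
  assumes "S j \<subseteq> A"
  shows "primeideal (branch_point j A) (chart_ring (gen_cone A))"
proof (rule primeidealI)
  show "ideal (branch_point j A) (chart_ring (gen_cone A))"
  proof (rule chart_idealI)
    fix f g assume f: "f \<in> branch_point j A"
    show "g \<in> branch_point j A \<Longrightarrow> f + g \<in> branch_point j A"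
      using f chart_closed(4)[of f _ g] unfolding branch_point_def by (simp add: eval_branch_add)
    show "g \<in> chart (gen_cone A) \<Longrightarrow> g * f \<in> branch_point j A"
      using f chart_closed(6)[of g _ f] eval_branch_mult_chart[OF assms, of g f] unfolding branch_point_def by simp
  qed (auto simp: branch_point_def eval_branch_zero)
  show "cring (chart_ring (gen_cone A) :: ('k, 'm + 'r) laurent ring)" by (rule cring_chart_ring)
  have "1 \<notin> branch_point j A" by (simp add: branch_point_def eval_branch_one)
  then show "carrier (chart_ring (gen_cone A)) \<noteq> branch_point j A"
    using chart_closed(1)[of "gen_cone A"] unfolding chart_ring_simps by blast
  fix f g assume fg: "f \<in> carrier (chart_ring (gen_cone A))" "g \<in> carrier (chart_ring (gen_cone A))"
    "f \<otimes>\<^bsub>chart_ring (gen_cone A)\<^esub> g \<in> branch_point j A"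
  then have "eval_branch j f * eval_branch j g = 0"
    using eval_branch_mult_chart[OF assms, of f g] by (simp add: branch_point_def)
  then show "f \<in> branch_point j A \<or> g \<in> branch_point j A"
    using fg by (auto simp: branch_point_def)
qed

lemma axis_in_dual: "A \<in> K \<Longrightarrow> axis i 1 \<in> dual_monoid (gen_cone A)"
  using nonneg by (simp add: mem_dual_monoid_gen_cone)

lemma relations_in_chart: "A \<in> K \<Longrightarrow> chart_relations \<subseteq> chart (gen_cone A)"
  unfolding chart_relations_def using chart_closed(5)[OF chi_in_chart[OF axis_in_dual] base_in_chart] by blast

lemma branch_point_orbit:
  assumes A: "A \<in> K" "S j \<subseteq> A"
  shows "branch_point j A \<in> orbit (gen_cone A) (gen_cone (S j))"
    "branch_point j A \<in> chart_points (gen_cone A)"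
proof -
  have "chart_relations \<subseteq> branch_point j A"
    using relations_in_chart[OF A(1)] eval_branch_relation unfolding branch_point_def by blast
  then show pt: "branch_point j A \<in> chart_points (gen_cone A)"
    using branch_point_prime[OF A(2)] by (simp add: chart_points_def)
  have "chi w \<notin> branch_point j A \<longleftrightarrow> w \<in> perp (gen_cone (S j))" if "w \<in> dual_monoid (gen_cone A)" for w
    using chi_in_chart[OF that] monomial_value_nonzero(1)[of w j]
    unfolding branch_point_def mem_perp_S by (auto simp: eval_branch_chi monomial_value_def)
  then show "branch_point j A \<in> orbit (gen_cone A) (gen_cone (S j))"
    using pt cone_face_gen_cone[OF A] by (simp add: orbit_def)
qed

lemma branch_point_nonexceptional:
  assumes A: "A \<in> K" "S j \<subseteq> A"
  shows "branch_point j A \<notin> exceptional_locus fan_of_K (gen_cone A)"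
proof
  assume "branch_point j A \<in> exceptional_locus fan_of_K (gen_cone A)"
  then obtain B where B: "B \<in> K" "gen_cone B \<notin> orthant_fan" "branch_point j A \<in> orbit (gen_cone A) (gen_cone B)"
    by (auto simp: exceptional_locus_def)
  have "B \<subseteq> A" using B(3) cone_face_gen_cone_iff[OF A(1) B(1)] by (simp add: orbit_def)
  then have "B = S j" using orbit_unique[OF A(1) _ A(2) B(3) branch_point_orbit(1)[OF A]] by blast
  then show False using B(2) gen_cone_axes_in_orthant_fan[of "vanishing j"] by (simp add: S_def)
qed

text \<open>By \<open>prime_over_branch\<close> there are two cases.  If all coordinates vanish at \<open>q\<close>, then \<open>q\<close> lies in the
  orbit of a cone that meets the interior of the orthant, hence in the exceptional locus.  Otherwise the
  coordinates vanishing at \<open>q\<close> are those vanishing on the branch, which leaves only the orbit of \<open>S j\<close>; there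
  \<open>clear_denominators\<close> determines \<open>q\<close> from its contraction to the power series.\<close>

lemma nonexceptional_point_over_branch:
  fixes q :: "('k, 'm + 'r) laurent set"
  assumes A: "A \<in> K" and q: "q \<in> chart_points (gen_cone A)"
    and ne: "q \<notin> exceptional_locus fan_of_K (gen_cone A)" and over: "base ` {f. \<theta> j f = 0} \<subseteq> q"
  shows "S j \<subseteq> A \<and> q = branch_point j A"
proof -
  let ?C = "chart (gen_cone A) :: ('k, 'm + 'r) laurent set"
  have prime: "primeideal q (chart_ring (gen_cone A))" and rel: "chart_relations \<subseteq> q"
    using q by (auto simp: chart_points_def)
  note Q = chart_prime[OF prime]
  define P where "P = {f. base f \<in> q}"
  have chi_mvar: "chi (axis i 1) \<in> q \<longleftrightarrow> mvar i \<in> P" for i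
  proof -
    have r: "chi (axis i 1) - base (mvar i) \<in> q" using rel by (auto simp: chart_relations_def)
    have "chi (axis i 1) \<in> q \<longleftrightarrow> base (mvar i) \<in> q"
      using Q(2)[OF r, of "base (mvar i)"] Q(8)[of "chi (axis i 1)", OF _ r] by auto
    then show ?thesis by (simp add: P_def)
  qed
  obtain A' where A': "A' \<subseteq> A" "q \<in> orbit (gen_cone A) (gen_cone A')" using orbit_face[OF A q] by blast
  have A'K: "A' \<in> K" using down[OF A A'(1)] .
  have finA': "finite A'" using finite_mem[OF A'K] .
  define c :: "int ^ ('m + 'r) \<Rightarrow> real" where "c a = (if a \<in> A' then 1 else 0)" for a
  have c: "supp c = A'" "\<And>a. 0 \<le> c a" by (auto simp: supp_def c_def)
  have comb_c: "comb c $ i = real_of_int (\<Sum>a\<in>A'. a $ i)" for i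
  proof -
    have "comb c $ i = (\<Sum>a\<in>A'. real_of_int (a $ i))"
      unfolding comb_eq[OF finA' eq_refl[OF c(1)]] sum_component
      by (intro sum.cong) (auto simp: c_def)
    then show ?thesis by simp
  qed
  have comb_nonneg: "0 \<le> comb c $ i" for i
    unfolding comb_c using nonneg[OF A'K] by (simp add: sum_nonneg)
  have comb_zero: "comb c $ i = 0 \<longleftrightarrow> mvar i \<notin> P" for i
  proof -
    have "comb c $ i = 0 \<longleftrightarrow> (\<forall>a\<in>A'. a $ i = 0)"
      unfolding comb_c using sum_nonneg_eq_0_iff[OF finA', of "\<lambda>a. a $ i"] nonneg[OF A'K] by (simp del: of_int_sum)
    also have "\<dots> \<longleftrightarrow> axis i 1 \<in> perp (gen_cone A')" by (simp add: mem_perp_gen_cone)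
    also have "\<dots> \<longleftrightarrow> chi (axis i 1) \<notin> q" using A'(2) axis_in_dual[OF A] by (simp add: orbit_def)
    finally show ?thesis using chi_mvar by simp
  qed
  have "P = {f. \<theta> j f = 0} \<or> (\<forall>i. mvar i \<in> P)"
  proof (rule prime_over_branch)
    show "f + g \<in> P" if "f \<in> P" "g \<in> P" for f g using that Q(2) by (simp add: P_def base_add)
    show "f * g \<in> P" if "f \<in> P" for f g
      using that Q(3)[OF _ base_in_chart, of "base f" g] by (simp add: P_def base_mult)
    show "f \<in> P \<or> g \<in> P" if "f * g \<in> P" for f g
      using that Q(7)[OF base_in_chart base_in_chart, of f g] by (simp add: P_def base_mult)
    show "1 \<notin> P" using Q(6) by (simp add: P_def base_one)
    show "{f. \<theta> j f = 0} \<subseteq> P" using over by (auto simp: P_def)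
  qed
  then have Pj: "P = {f. \<theta> j f = 0}"
  proof
    assume all: "\<forall>i. mvar i \<in> P"
    have "gen_cone A' \<notin> orthant_fan"
    proof
      assume fan: "gen_cone A' \<in> orthant_fan"
      have "comb c \<in> gen_cone A'" using mem_gen_cone[OF finA', of "comb c"] c by blast
      moreover have "0 < comb c $ i" for i
        using comb_zero[of i] comb_nonneg[of i] all by (simp add: less_le)
      ultimately have "gen_cone A' = orthant" by (rule orthant_face_interior[OF fan])
      then show False using A'K orthant_notin by (metis imageI)
    qed
    then have "q \<in> exceptional_locus fan_of_K (gen_cone A)"
      unfolding exceptional_locus_def using A'K A'(2) by blast
    then show ?thesis using ne by blast
  qed
  have "A' = S j"
  proof -
    have zero: "comb c $ i = 0 \<longleftrightarrow> i \<notin> vanishing j" for i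
      using comb_zero[of i] mvar_zero_iff[of j i] by (simp add: Pj)
    \<comment> \<open>the coordinates of \<open>comb c\<close>, as coefficients of the axes in \<open>S j\<close>\<close>
    define d :: "int ^ ('m + 'r) \<Rightarrow> real" where "d a = (if a \<in> S j then inner (real_vec a) (comb c) else 0)" for a
    have d_axis: "d (axis i 1) = comb c $ i" if "i \<in> vanishing j" for i
      using that by (simp add: d_def S_def real_vec_axis inner_axis')
    have d_zero: "d a = 0" if "a \<notin> S j" for a using that by (simp add: d_def)
    have d0: "0 \<le> d a" for a
      using d_axis d_zero[of a] comb_nonneg by (cases "a \<in> S j") (auto simp: S_def)
    have sd: "supp d = S j"
    proof (rule Set.set_eqI)
      fix a show "a \<in> supp d \<longleftrightarrow> a \<in> S j"
        using d_axis d_zero[of a] zero by (cases "a \<in> S j") (auto simp: S_def supp_def)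
    qed
    have inj: "inj_on (\<lambda>i. axis i (1::int)) (vanishing j)" by (auto simp: inj_on_def axis_eq_axis)
    have "comb d = (\<Sum>i\<in>vanishing j. comb c $ i *\<^sub>R axis i 1)"
      unfolding comb_def[of d] sd S_def sum.reindex[OF inj]
      by (intro sum.cong) (simp_all add: d_axis real_vec_axis)
    also have "\<dots> = comb c"
      using zero by (auto simp: vec_eq_iff axis_def if_distrib cong: if_cong)
    finally have "c = d" using c d0 sd A'K S_in_K by (intro unique) auto
    then show ?thesis using c(1) sd by simp
  qed
  then have SA: "S j \<subseteq> A" and orb: "q \<in> orbit (gen_cone A) (gen_cone (S j))" using A' by auto
  have van: "\<forall>w\<in>dual_monoid (gen_cone A). w \<notin> nonvanishing j \<longrightarrow> chi w \<in> q"
    and nvan: "w \<in> dual_monoid (gen_cone A) \<Longrightarrow> w \<in> nonvanishing j \<Longrightarrow> chi w \<notin> q" for w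
    using orb by (auto simp: orbit_def mem_perp_S)
  have van': "\<forall>w\<in>dual_monoid (gen_cone A). w \<notin> nonvanishing j \<longrightarrow> chi w \<in> branch_point j A"
    and nvan': "w \<in> dual_monoid (gen_cone A) \<Longrightarrow> w \<in> nonvanishing j \<Longrightarrow> chi w \<notin> branch_point j A" for w
    using branch_point_orbit(1)[OF A SA] by (auto simp: orbit_def mem_perp_S)
  have A_nn: "0 \<le> a $ i" if "a \<in> A" for a i using nonneg[OF A that] .
  note Q' = chart_prime[OF branch_point_prime[OF SA]]
  have "f \<in> q \<longleftrightarrow> f \<in> branch_point j A" if f: "f \<in> ?C" for f
  proof -
    obtain w g where w: "w \<in> dual_monoid (gen_cone A)" "w \<in> nonvanishing j"
      and g: "\<And>q. q \<in> chart_points (gen_cone A) \<Longrightarrow>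
        (\<forall>w\<in>dual_monoid (gen_cone A). w \<notin> nonvanishing j \<longrightarrow> chi w \<in> q) \<Longrightarrow> chi w * f - base g \<in> q"
      using clear_denominators[OF f A_nn, of j] by blast
    have r: "chi w * f - base g \<in> q" by (rule g[OF q van])
    have r': "chi w * f - base g \<in> branch_point j A" by (rule g[OF branch_point_orbit(2)[OF A SA] van'])
    have cw: "chi w \<in> ?C" using chi_in_chart[OF w(1)] .
    have "f \<in> q \<longleftrightarrow> chi w * f \<in> q" using Q(4)[of f "chi w"] Q(7)[OF cw f] nvan[OF w] cw by blast
    also have "\<dots> \<longleftrightarrow> base g \<in> q"
      using Q(2)[OF r, of "base g"] Q(8)[of "chi w * f", OF _ r] by auto
    also have "\<dots> \<longleftrightarrow> \<theta> j g = 0" using Pj by (auto simp: P_def)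
    also have "\<dots> \<longleftrightarrow> base g \<in> branch_point j A"
      using base_in_chart[of g "gen_cone A"] by (simp add: branch_point_def eval_branch_base)
    also have "\<dots> \<longleftrightarrow> chi w * f \<in> branch_point j A"
      using Q'(2)[OF r', of "base g"] Q'(8)[of "chi w * f", OF _ r'] by auto
    also have "\<dots> \<longleftrightarrow> f \<in> branch_point j A"
      using Q'(4)[of f "chi w"] Q'(7)[OF cw f] nvan'[OF w] cw by blast
    finally show ?thesis .
  qed
  then have "q = branch_point j A" using Q(1) Q'(1) by blast
  then show ?thesis using SA by blast
qed

proposition strict_transform_branches:
  fixes T :: "'r set"
  assumes A: "A \<in> K"
  shows "strict_transform fan_of_K (gen_cone A) (\<Inter>j\<in>T. {f. \<theta> j f = 0})
    = {f \<in> chart (gen_cone A). \<forall>j\<in>T. S j \<subseteq> A \<longrightarrow> eval_branch j f = 0}"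
proof -
  let ?I = "\<Inter>j\<in>T. {f. \<theta> j f = 0}"
  let ?Q = "{q \<in> chart_points (gen_cone A). base ` ?I \<subseteq> q \<and> q \<notin> exceptional_locus fan_of_K (gen_cone A)}"
  have "?Q = {branch_point j A | j. j \<in> T \<and> S j \<subseteq> A}"
  proof (rule Set.set_eqI, rule iffI)
    fix q assume "q \<in> ?Q"
    then have q: "q \<in> chart_points (gen_cone A)" "base ` ?I \<subseteq> q" "q \<notin> exceptional_locus fan_of_K (gen_cone A)"
      by auto
    have prime: "primeideal q (chart_ring (gen_cone A))" using q(1) by (simp add: chart_points_def)
    note Q = chart_prime[OF prime]
    have "\<exists>j\<in>T. {f. \<theta> j f = 0} \<subseteq> {f. base f \<in> q}"
    proof (rule prime_contains_some)
      show "?I \<subseteq> {f. base f \<in> q}" using q(2) by blast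
      show "f * g \<in> {f. \<theta> j f = 0}" if "f \<in> {f. \<theta> j f = 0}" for f g j
        using that by (simp add: formal_arc.hom_mult[OF arc])
      show "f \<in> {f. base f \<in> q} \<or> g \<in> {f. base f \<in> q}" if "f * g \<in> {f. base f \<in> q}" for f g
        using that Q(7)[OF base_in_chart base_in_chart, of f g] by (simp add: base_mult)
      show "1 \<notin> {f. base f \<in> q}" using Q(6) by (simp add: base_one)
    qed simp
    then obtain j where "j \<in> T" "base ` {f. \<theta> j f = 0} \<subseteq> q" by blast
    then show "q \<in> {branch_point j A | j. j \<in> T \<and> S j \<subseteq> A}"
      using nonexceptional_point_over_branch[OF A q(1,3)] by blast
  next
    fix q assume "q \<in> {branch_point j A | j. j \<in> T \<and> S j \<subseteq> A}"
    then obtain j where j: "q = branch_point j A" "j \<in> T" "S j \<subseteq> A" by blast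
    have "base ` ?I \<subseteq> q"
      unfolding j(1) branch_point_def using j(2) base_in_chart by (auto simp: eval_branch_base)
    then show "q \<in> ?Q"
      using branch_point_orbit(2)[OF A j(3)] branch_point_nonexceptional[OF A j(3)] j(1) by blast
  qed
  then have "strict_transform fan_of_K (gen_cone A) ?I
      = chart (gen_cone A) \<inter> \<Inter> {branch_point j A | j. j \<in> T \<and> S j \<subseteq> A}"
    unfolding strict_transform_def chart_ring_simps by (rule arg_cong)
  also have "\<dots> = {f \<in> chart (gen_cone A). \<forall>j\<in>T. S j \<subseteq> A \<longrightarrow> f \<in> branch_point j A}" by blast
  also have "\<dots> = {f \<in> chart (gen_cone A). \<forall>j\<in>T. S j \<subseteq> A \<longrightarrow> eval_branch j f = 0}"
    unfolding branch_point_def by blast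
  finally show ?thesis .
qed

end

section \<open>The strict transform in a chart\<close>

lemma mem_range_fps_to_fls: "z \<in> range fps_to_fls \<longleftrightarrow> 0 \<le> fls_subdegree z"
proof
  assume "0 \<le> fls_subdegree z"
  then obtain w where "z = fls_shift 0 (fps_to_fls w)" using fls_as_fps[of z 0] by auto
  then show "z \<in> range fps_to_fls" by simp
qed (auto simp: fls_subdegree_fls_to_fps_gt0)

context adapted_complex
begin

lemma pair_v_eq_pair_u:
  assumes "w \<in> nonvanishing j"
  shows "pair w (v j) = pair w (u j)"
  unfolding pair_def
proof (rule sum.cong)
  fix i
  show "w $ i * v j $ i = w $ i * u j $ i"
    using assms u_nth[of i j] by (cases "i \<in> vanishing j") (auto simp: nonvanishing_def)
qed simp

lemma subdegree_monomial_value: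
  "w \<in> nonvanishing j \<Longrightarrow> fls_subdegree (monomial_value j w) = pair w (u j)"
  using monomial_value_nonzero(2) pair_v_eq_pair_u by simp

lemma nonvanishing_iff_pair: "w \<in> nonvanishing j \<longleftrightarrow> (\<forall>a\<in>S j. pair w a = 0)"
  by (simp add: nonvanishing_def S_def)

lemma ray_coordinate:
  assumes A: "A \<in> K" "a \<in> A"
  shows "\<exists>w\<in>dual_monoid (gen_cone A). \<forall>b\<in>A. pair w b = (if b = a then 1 else 0)"
proof -
  obtain D where D: "\<And>a b. a \<in> A \<Longrightarrow> b \<in> A \<Longrightarrow> pair (D a) b = (if a = b then 1 else 0)"
    using dual_vectors[OF A(1)] by blast
  then show ?thesis using A(2) by (intro bexI[of _ "D a"]) (auto simp: mem_dual_monoid_gen_cone)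
qed

lemma eval_branch_power:
  assumes "S j \<subseteq> A" "f \<in> chart (gen_cone A)"
  shows "eval_branch j (f ^ n) = eval_branch j f ^ n"
proof (induction n)
  case (Suc n)
  then show ?case
    using eval_branch_mult_chart[OF assms(1,2) chart_power[OF assms(2)]] by simp
qed (simp add: eval_branch_one)

text \<open>Chart functions have no pole on the branch because \<open>v j\<close> agrees with \<open>u j\<close>, a vector of the cone,
  modulo \<open>S j\<close>.  Conversely, the monomial dual to \<open>u j\<close> has order one, so polynomials in it approximate a
  given series up to an order where the conductor takes over.\<close>

lemma eval_branch_image_ray:
  assumes A: "A \<in> K" "S j \<subseteq> A" "u j \<in> A"
  shows "eval_branch j ` chart (gen_cone A) = range fps_to_fls"
proof
  show "eval_branch j ` chart (gen_cone A) \<subseteq> range fps_to_fls"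
  proof
    fix z assume "z \<in> eval_branch j ` chart (gen_cone A)"
    then obtain f where f: "f \<in> chart (gen_cone A)" "z = eval_branch j f" by blast
    have sum: "sum g F \<in> range fps_to_fls" if "\<And>x. x \<in> F \<Longrightarrow> g x \<in> range fps_to_fls"
      for F and g :: "int ^ ('m + 'r) \<Rightarrow> 'k fls"
      using that
    proof (induction F rule: infinite_finite_induct)
      case (insert x F)
      then obtain a b where "g x = fps_to_fls a" "sum g F = fps_to_fls b" by blast
      then have "sum g (insert x F) = fps_to_fls (a + b)" using insert.hyps by simp
      then show ?case by blast
    qed (metis fps_zero_to_fls rangeI sum.infinite, metis fps_zero_to_fls rangeI sum.empty)
    show "z \<in> range fps_to_fls"
      unfolding f(2) eval_branch_def
    proof (rule sum)
      fix w assume "w \<in> Poly_Mapping.keys f"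
      then have w: "w \<in> dual_monoid (gen_cone A)" using f(1) by blast
      have "0 \<le> fls_subdegree (monomial_value j w)"
      proof (cases "w \<in> nonvanishing j")
        case True
        then show ?thesis using w A(3) by (simp add: subdegree_monomial_value mem_dual_monoid_gen_cone)
      qed (simp add: monomial_value_def)
      then obtain b where "monomial_value j w = fps_to_fls b" using mem_range_fps_to_fls by blast
      then show "fps_to_fls (\<theta> j (Poly_Mapping.lookup f w)) * monomial_value j w \<in> range fps_to_fls"
        by (metis fls_times_fps_to_fls rangeI)
    qed
  qed
  show "range fps_to_fls \<subseteq> eval_branch j ` chart (gen_cone A)"
  proof
    fix z :: "'k fls" assume "z \<in> range fps_to_fls"
    then obtain g where g: "z = fps_to_fls g" by blast
    obtain d where d: "d \<in> dual_monoid (gen_cone A)" "\<And>b. b \<in> A \<Longrightarrow> pair d b = (if b = u j then 1 else 0)"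
      using ray_coordinate[OF A(1,3)] by blast
    have dn: "d \<in> nonvanishing j" using d(2) A(2) u_notin[of j] by (auto simp: nonvanishing_iff_pair)
    have deg: "fls_subdegree (monomial_value j d) = 1" using subdegree_monomial_value[OF dn] d(2) A(3) by simp
    then obtain t where t: "monomial_value j d = fps_to_fls t" using mem_range_fps_to_fls[of "monomial_value j d"] by auto
    have t1: "subdegree t = 1" using deg t by (simp add: fls_subdegree_fls_to_fps)
    then have t0: "t \<noteq> 0" by auto
    have cd: "chi d \<in> chart (gen_cone A)" using chi_in_chart[OF d(1)] .
    have approx: "\<exists>f h. f \<in> chart (gen_cone A) \<and> eval_branch j f = fps_to_fls h \<and> (\<forall>k<n. fps_nth (g - h) k = 0)" for n
    proof (induction n)
      case 0
      then show ?case using chart_closed(2) eval_branch_zero by (intro exI[of _ 0]) auto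
    next
      case (Suc n)
      then obtain f h where fh: "f \<in> chart (gen_cone A)" "eval_branch j f = fps_to_fls h" "\<forall>k<n. fps_nth (g - h) k = 0"
        by blast
      define c where "c = fps_nth (g - h) n / fps_nth (t ^ n) n"
      have st: "subdegree (t ^ n) = n" using t0 t1 by simp
      have "t ^ n \<noteq> 0" using t0 by simp
      then have nz: "fps_nth (t ^ n) n \<noteq> 0" using nth_subdegree_nonzero[of "t ^ n"] unfolding st by blast
      let ?m = "base (mconst c) * chi d ^ n"
      have m: "?m \<in> chart (gen_cone A)" by (rule chart_closed(6)[OF base_in_chart chart_power[OF cd]])
      have "eval_branch j ?m = fps_to_fls (fps_const c * t ^ n)"
        using eval_branch_mult_chart[OF A(2) base_in_chart chart_power[OF cd], of "mconst c" n]
        by (simp add: eval_branch_power[OF A(2) cd] eval_branch_base eval_branch_chi t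
            formal_arc.hom_const[OF arc] fls_times_fps_to_fls fps_to_fls_power)
      then have "eval_branch j (f + ?m) = fps_to_fls (h + fps_const c * t ^ n)"
        using fh(2) by (simp add: eval_branch_add)
      moreover have "fps_nth (g - (h + fps_const c * t ^ n)) k = 0" if "k < Suc n" for k
      proof (cases "k = n")
        case True
        then show ?thesis using nz by (simp add: c_def)
      next
        case False
        then have k: "k < n" using that by simp
        then have "fps_nth (t ^ n) k = 0" using st by (intro nth_less_subdegree_zero) simp
        then show ?thesis using fh(3) k by simp
      qed
      ultimately show ?case using chart_closed(4)[OF fh(1) m] by blast
    qed
    obtain C where C: "\<And>g. (\<forall>k<C. fps_nth g k = 0) \<Longrightarrow> g \<in> range (\<theta> j)" using conductor_exists by metis
    obtain f h where fh: "f \<in> chart (gen_cone A)" "eval_branch j f = fps_to_fls h" "\<forall>k<C. fps_nth (g - h) k = 0"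
      using approx by blast
    obtain s where s: "g - h = \<theta> j s" using C[OF fh(3)] by blast
    have "eval_branch j (f + base s) = fps_to_fls (h + \<theta> j s)" using fh(2) by (simp add: eval_branch_add eval_branch_base)
    also have "h + \<theta> j s = g" using s by (simp add: algebra_simps)
    finally show "z \<in> eval_branch j ` chart (gen_cone A)"
      using g chart_closed(4)[OF fh(1) base_in_chart[of s]] by (metis imageI)
  qed
qed

text \<open>If the chart had only monomials without pole on the branch, a translate of \<open>u j\<close> along \<open>S j\<close> would lie in
  the cone, and by uniqueness of representations \<open>u j\<close> would be one of its generators.  Powers of a
  monomial with a pole move any Laurent series into the range of the conductor.\<close>

lemma eval_branch_image_no_ray:
  assumes A: "A \<in> K" "S j \<subseteq> A" "u j \<notin> A"
  shows "eval_branch j ` chart (gen_cone A) = UNIV"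
proof -
  have "\<exists>w\<in>dual_monoid (gen_cone A). (\<forall>a\<in>S j. pair w a = 0) \<and> pair w (u j) < 0"
  proof (rule ccontr)
    assume "\<not> ?thesis"
    then have "0 \<le> pair w (u j)" if "w \<in> dual_monoid (gen_cone A)" "\<forall>a\<in>S j. pair w a = 0" for w
      using that not_less by blast
    then obtain c where c: "\<forall>a. 0 \<le> c a" "supp c \<subseteq> S j" "real_vec (u j) + comb c \<in> gen_cone A"
      using translate_into_cone[OF A(1,2), of "u j"] by blast
    define e where "e = c(u j := 1)"
    have cu: "c (u j) = 0" using c(2) u_notin[of j] by (auto simp: supp_def)
    have se: "supp e = insert (u j) (supp c)" by (auto simp: supp_def e_def)
    have "supp e \<subseteq> insert (u j) (S j)" using se c(2) by blast
    then have eK: "supp e \<in> K" using down[OF u_edge] by blast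
    have fin: "finite (supp c)" using finite_subset[OF c(2) finite_S] .
    have "(\<Sum>a\<in>supp c. e a *\<^sub>R real_vec a) = comb c"
      unfolding comb_def by (intro sum.cong) (auto simp: e_def cu supp_def)
    then have "comb e = real_vec (u j) + comb c"
      unfolding comb_def[of e] se using fin cu by (simp add: e_def supp_def)
    then have "supp e \<subseteq> A" using gen_cone_eqD[OF A(1), of e] c eK by (auto simp: e_def)
    then show False using se A(3) by blast
  qed
  then obtain w where w: "w \<in> dual_monoid (gen_cone A)" "w \<in> nonvanishing j" "pair w (u j) < 0"
    by (auto simp: nonvanishing_iff_pair)
  let ?x = "monomial_value j w"
  have x: "?x \<noteq> 0" "fls_subdegree ?x = pair w (u j)"
    using monomial_value_nonzero(1)[OF w(2)] subdegree_monomial_value[OF w(2)] by auto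
  have cw: "chi w \<in> chart (gen_cone A)" using chi_in_chart[OF w(1)] .
  obtain C where C: "\<And>g. (\<forall>k<C. fps_nth g k = 0) \<Longrightarrow> g \<in> range (\<theta> j)" using conductor_exists by metis
  have "z \<in> eval_branch j ` chart (gen_cone A)" for z
  proof (cases "z = 0")
    case True
    then show ?thesis using eval_branch_zero[of j] chart_closed(2)[of "gen_cone A"] by (metis imageI)
  next
    case False
    \<comment> \<open>each factor \<open>?x\<close> lowers the order by at least one, so \<open>z / ?x\<^sup>N\<close> has order at least \<open>C\<close>\<close>
    define N where "N = C + nat \<bar>fls_subdegree z\<bar>"
    define y where "y = z / ?x ^ N"
    have y0: "y \<noteq> 0" using False x by (simp add: y_def)
    have zy: "z = y * ?x ^ N" using x by (simp add: y_def)
    have "fls_subdegree z = fls_subdegree y + int N * pair w (u j)"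
      unfolding zy using y0 x by (simp add: fls_subdegree_pow)
    moreover have "int N * pair w (u j) \<le> int N * (- 1)" using w(3) by (intro mult_left_mono) auto
    ultimately have deg: "int C \<le> fls_subdegree y" by (simp add: N_def)
    then obtain g where g: "y = fps_to_fls g" using mem_range_fps_to_fls[of y] by auto
    have "int C \<le> int (subdegree g)" using deg g by (simp add: fls_subdegree_fls_to_fps)
    then have "\<forall>k<C. fps_nth g k = 0" by (auto intro!: nth_less_subdegree_zero)
    then obtain s where s: "g = \<theta> j s" using C by blast
    have "eval_branch j (base s * chi w ^ N) = z"
      using eval_branch_mult_chart[OF A(2) base_in_chart chart_power[OF cw], of s N] zy g s
      by (simp add: eval_branch_power[OF A(2) cw] eval_branch_base eval_branch_chi)
    then show ?thesis using chart_closed(6)[OF base_in_chart chart_power[OF cw], of s N] by (metis imageI)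
  qed
  then show ?thesis by blast
qed

text \<open>A second branch in the chart forces the axis of \<open>z\<^sub>m\<^sub>+\<^sub>j\<close> to be a generator of the cone.  The monomial
  dual to this axis vanishes on all branches but the \<open>j\<close>-th, and there it is a unit of the image of the
  evaluation.\<close>

lemma separating_function:
  assumes A: "A \<in> K" "S j \<subseteq> A"
  shows "\<exists>e\<in>chart (gen_cone A). \<forall>i. S i \<subseteq> A \<longrightarrow> eval_branch i e = (if i = j then 1 else 0)"
proof (cases "\<exists>i. i \<noteq> j \<and> S i \<subseteq> A")
  case False
  then show ?thesis
    using chart_closed(1)[of "gen_cone A"] eval_branch_one[of j] by (intro bexI[of _ 1]) auto
next
  case True
  then obtain i0 where i0: "i0 \<noteq> j" "S i0 \<subseteq> A" by blast
  let ?a = "axis (Inr j) 1 :: int ^ ('m + 'r)"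
  have aA: "?a \<in> A" using i0 by (auto simp: S_def)
  obtain w where w: "w \<in> dual_monoid (gen_cone A)" "\<And>b. b \<in> A \<Longrightarrow> pair w b = (if b = ?a then 1 else 0)"
    using ray_coordinate[OF A(1) aA] by blast
  have aS: "?a \<notin> S j" by (auto simp: S_def axis_eq_axis)
  have wn: "w \<in> nonvanishing j" using w(2) A(2) aS by (auto simp: nonvanishing_iff_pair)
  have other: "monomial_value i w = 0" if "i \<noteq> j" for i
  proof -
    have "w $ Inr j = 1" using w(2)[OF aA] by simp
    then have "w \<notin> nonvanishing i" using that by (auto simp: nonvanishing_def intro!: bexI[of _ "Inr j"])
    then show ?thesis by (simp add: monomial_value_def)
  qed
  have nz: "monomial_value j w \<noteq> 0" by (rule monomial_value_nonzero(1)[OF wn])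
  have "inverse (monomial_value j w) \<in> eval_branch j ` chart (gen_cone A)"
  proof (cases "u j \<in> A")
    case True
    obtain s :: 'm where True by blast
    have "u j $ Inl s \<noteq> 0" using u_nth[of "Inl s" j] v_pos[of "Inl s" j] by simp
    then have "u j \<noteq> ?a" by (auto simp: axis_def)
    then have "fls_subdegree (monomial_value j w) = 0" using subdegree_monomial_value[OF wn] w(2)[OF True] by simp
    then have "fls_subdegree (inverse (monomial_value j w)) = 0" by (simp add: fls_inverse_subdegree)
    then show ?thesis unfolding eval_branch_image_ray[OF A True] mem_range_fps_to_fls by simp
  next
    case False
    then show ?thesis using eval_branch_image_no_ray[OF A False] by blast
  qed
  then obtain b where b: "b \<in> chart (gen_cone A)" "eval_branch j b = inverse (monomial_value j w)" by force
  have cw: "chi w \<in> chart (gen_cone A)" using chi_in_chart[OF w(1)] .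
  have "eval_branch i (b * chi w) = (if i = j then 1 else 0)" if "S i \<subseteq> A" for i
    using eval_branch_mult_chart[OF that b(1) cw] other[of i] b(2) nz by (auto simp: eval_branch_chi)
  then show ?thesis using chart_closed(6)[OF b(1) cw] by blast
qed

proposition regular_strict_transform:
  assumes A: "A \<in> K"
  shows "regular_ring (chart_ring (gen_cone A) Quot strict_transform fan_of_K (gen_cone A) (\<Inter>j. {f. \<theta> j f = 0}))"
proof -
  let ?T = "{j. S j \<subseteq> A}"
  have "\<forall>j. \<exists>e. S j \<subseteq> A \<longrightarrow> e \<in> chart (gen_cone A) \<and> (\<forall>i. S i \<subseteq> A \<longrightarrow> eval_branch i e = (if i = j then 1 else 0))"
    using separating_function[OF A] by blast
  then obtain e where e: "\<And>j. S j \<subseteq> A \<Longrightarrow> e j \<in> chart (gen_cone A)"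
    "\<And>i j. S j \<subseteq> A \<Longrightarrow> S i \<subseteq> A \<Longrightarrow> eval_branch i (e j) = (if i = j then 1 else 0)" by metis
  have "regular_ring (chart_ring (gen_cone A) Quot
      {a \<in> carrier (chart_ring (gen_cone A)). \<forall>j\<in>?T. eval_branch j a = 0})"
  proof (rule regular_ring_quotient)
    show "cring (chart_ring (gen_cone A) :: ('k, 'm + 'r) laurent ring)" by (rule cring_chart_ring)
    show "finite ?T" by simp
    fix j assume j: "j \<in> ?T"
    then have SA: "S j \<subseteq> A" by simp
    show "eval_branch j \<in> ring_hom (chart_ring (gen_cone A)) TR" by (rule eval_branch_hom[OF SA])
    show "eval_branch j ` carrier (chart_ring (gen_cone A)) = UNIV \<or>
        eval_branch j ` carrier (chart_ring (gen_cone A)) = range fps_to_fls"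
      unfolding chart_ring_simps
      using eval_branch_image_ray[OF A SA] eval_branch_image_no_ray[OF A SA] by blast
    show "e j \<in> carrier (chart_ring (gen_cone A))" using e(1)[OF SA] by simp
    fix i assume "i \<in> ?T"
    then show "eval_branch i (e j) = (if i = j then 1 else 0)" using e(2)[OF SA] by simp
  qed
  then show ?thesis unfolding strict_transform_branches[OF A, of UNIV] by simp
qed

end

section \<open>Transversality\<close>

context adapted_complex
begin

lemma coord_cone_branch: "coord_cone {f. \<theta> j f = 0} = gen_cone (S j)"
proof -
  have "{axis i (1::real) | i. mvar i \<in> {f. \<theta> j f = 0}} = real_vec ` S j"
    unfolding S_def image_image real_vec_axis using mvar_zero_iff[of j] by auto
  then show ?thesis by (simp add: coord_cone_def gen_cone_def)
qed

lemma orbit_closure_generators: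
  assumes "A \<in> K"
  shows "chart_relations \<union> chi ` (dual_monoid (gen_cone A) - perp \<sigma>) \<subseteq> carrier (chart_ring (gen_cone A))"
  using relations_in_chart[OF assms] chi_in_chart[of _ "gen_cone A"] unfolding chart_ring_simps by blast

lemma generators_in_orbit_closure_ideal:
  fixes \<sigma> :: "(real ^ ('m + 'r)) set"
  assumes "A \<in> K"
  shows "(chart_relations :: ('k, 'm + 'r) laurent set) \<subseteq> orbit_closure_ideal (gen_cone A) \<sigma>"
    "\<And>w. w \<in> dual_monoid (gen_cone A) \<Longrightarrow> w \<notin> perp \<sigma> \<Longrightarrow>
      (chi w :: ('k, 'm + 'r) laurent) \<in> orbit_closure_ideal (gen_cone A) \<sigma>"
proof -
  interpret R: cring "chart_ring (gen_cone A) :: ('k, 'm + 'r) laurent ring" by (rule cring_chart_ring)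
  have "(chart_relations :: ('k, 'm + 'r) laurent set) \<union> chi ` (dual_monoid (gen_cone A) - perp \<sigma>)
      \<subseteq> orbit_closure_ideal (gen_cone A) \<sigma>"
    unfolding orbit_closure_ideal_def by (rule R.genideal_self[OF orbit_closure_generators[OF assms]])
  then show "(chart_relations :: ('k, 'm + 'r) laurent set) \<subseteq> orbit_closure_ideal (gen_cone A) \<sigma>"
    "\<And>w. w \<in> dual_monoid (gen_cone A) \<Longrightarrow> w \<notin> perp \<sigma> \<Longrightarrow>
      (chi w :: ('k, 'm + 'r) laurent) \<in> orbit_closure_ideal (gen_cone A) \<sigma>"
    by blast+
qed

lemma orbit_closure_ideal_least:
  fixes J :: "('k, 'm + 'r) laurent set"
  assumes "ideal J (chart_ring (gen_cone A))" "chart_relations \<subseteq> J"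
    "\<And>w. w \<in> dual_monoid (gen_cone A) \<Longrightarrow> w \<notin> perp \<sigma> \<Longrightarrow> chi w \<in> J"
  shows "orbit_closure_ideal (gen_cone A) \<sigma> \<subseteq> J"
proof -
  interpret R: cring "chart_ring (gen_cone A) :: ('k, 'm + 'r) laurent ring" by (rule cring_chart_ring)
  show ?thesis unfolding orbit_closure_ideal_def
    by (rule R.genideal_minimal[OF assms(1)]) (use assms(2,3) in blast)
qed

lemma ideal_orbit_closure_ideal:
  assumes "A \<in> K"
  shows "ideal (orbit_closure_ideal (gen_cone A) \<sigma> :: ('k, 'm + 'r) laurent set) (chart_ring (gen_cone A))"
proof -
  interpret R: cring "chart_ring (gen_cone A) :: ('k, 'm + 'r) laurent ring" by (rule cring_chart_ring)
  show ?thesis unfolding orbit_closure_ideal_def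
    by (rule R.genideal_ideal[OF orbit_closure_generators[OF assms]])
qed

text \<open>The point factors through the image of the evaluation.  The field \<open>k((t))\<close> has no homomorphism of
  \<open>k\<close>-algebras to \<open>k\<close>, and the only one from \<open>k[[t]]\<close> is \<open>t = 0\<close>, since \<open>t - c\<close> is invertible for \<open>c \<noteq> 0\<close>.\<close>

lemma rational_point_on_strict_transform:
  fixes x :: "('k, 'm + 'r) laurent \<Rightarrow> 'k"
  assumes A: "A \<in> K" "S j \<subseteq> A" and x: "rational_point (gen_cone A) x"
    and kill: "\<And>f. f \<in> branch_point j A \<Longrightarrow> x f = 0"
  shows "u j \<in> A" "f \<in> chart (gen_cone A) \<Longrightarrow> x f = fls_nth (eval_branch j f) 0"
proof -
  let ?C = "chart (gen_cone A) :: ('k, 'm + 'r) laurent set"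
  have x_add: "x (f + g) = x f + x g" and x_mult: "x (f * g) = x f * x g" if "f \<in> ?C" "g \<in> ?C" for f g
    using x that by (auto simp: rational_point_def alg_hom_def ring_hom_def)
  have x_one: "x 1 = 1" using x by (auto simp: rational_point_def alg_hom_def ring_hom_def)
  have x_const: "x (base (mconst c)) = c" for c using x by (auto simp: rational_point_def alg_hom_def)
  have eq: "x f = x g" if "f \<in> ?C" "g \<in> ?C" "eval_branch j f = eval_branch j g" for f g
  proof -
    have "f - g \<in> branch_point j A"
      using chart_closed(5)[OF that(1,2)] that(3) by (simp add: branch_point_def eval_branch_diff)
    then have "x (f - g) = 0" by (rule kill)
    then show ?thesis using x_add[OF chart_closed(5)[OF that(1,2)] that(2)] by simp
  qed
  have const: "base (mconst c) \<in> ?C" for c by (rule base_in_chart)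
  have eval_const: "eval_branch j (base (mconst c)) = fps_to_fls (fps_const c)" for c
    by (simp add: eval_branch_base formal_arc.hom_const[OF arc])
  \<comment> \<open>\<open>x\<close> cannot take the value \<open>c\<close> on a function whose difference to \<open>c\<close> is invertible on the branch\<close>
  have not_unit: "eval_branch j g * (eval_branch j f - fps_to_fls (fps_const (x f))) \<noteq> 1"
    if "f \<in> ?C" "g \<in> ?C" for f g
  proof
    assume e: "eval_branch j g * (eval_branch j f - fps_to_fls (fps_const (x f))) = 1"
    let ?d = "f - base (mconst (x f))"
    have d: "?d \<in> ?C" by (rule chart_closed(5)[OF that(1) const])
    have "eval_branch j (g * ?d) = eval_branch j 1"
      using e eval_branch_mult_chart[OF A(2) that(2) d] by (simp add: eval_branch_diff eval_const eval_branch_one)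
    then have "x (g * ?d) = 1" using eq[OF chart_closed(6)[OF that(2) d] chart_closed(1)] x_one by simp
    moreover have "x ?d = 0" using x_add[OF d const[of "x f"]] x_const[of "x f"] by simp
    ultimately show False using x_mult[OF that(2) d] by simp
  qed
  show uA: "u j \<in> A"
  proof (rule ccontr)
    assume "u j \<notin> A"
    then have img: "\<exists>f\<in>?C. z = eval_branch j f" for z
      using eval_branch_image_no_ray[OF A] by blast
    obtain f where f: "f \<in> ?C" "fls_X = eval_branch j f" using img by blast
    let ?y = "fls_X - fps_to_fls (fps_const (x f)) :: 'k fls"
    have "fls_nth ?y 1 = 1" by simp
    then have "?y \<noteq> 0" by (metis fls_zero_nth zero_neq_one)
    moreover obtain g where "g \<in> ?C" "inverse ?y = eval_branch j g" using img by blast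
    ultimately show False using not_unit[OF f(1)] f(2) by (metis left_inverse)
  qed
  have img: "\<exists>f\<in>?C. fps_to_fls h = eval_branch j f" for h
    using eval_branch_image_ray[OF A uA] by blast
  obtain f1 where f1: "f1 \<in> ?C" "fps_to_fls fps_X = eval_branch j f1" using img by blast
  have xf1: "x f1 = 0"
  proof (rule ccontr)
    assume "x f1 \<noteq> 0"
    then have "fps_nth (fps_X - fps_const (x f1)) 0 \<noteq> 0" by simp
    then have "inverse (fps_X - fps_const (x f1)) * (fps_X - fps_const (x f1)) = 1"
      by (rule inverse_mult_eq_1)
    then have "fps_to_fls (inverse (fps_X - fps_const (x f1))) * (fps_to_fls fps_X - fps_to_fls (fps_const (x f1))) = 1"
      unfolding fps_to_fls_minus[symmetric] fls_times_fps_to_fls[symmetric] by simp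
    moreover obtain g where "g \<in> ?C" "fps_to_fls (inverse (fps_X - fps_const (x f1))) = eval_branch j g"
      using img by blast
    ultimately show False using not_unit[OF f1(1)] f1(2) by metis
  qed
  show "x f = fls_nth (eval_branch j f) 0" if f: "f \<in> ?C"
  proof -
    obtain h where h: "eval_branch j f = fps_to_fls h" using f eval_branch_image_ray[OF A uA] by blast
    obtain g where g: "g \<in> ?C" "fps_to_fls (fps_shift 1 h) = eval_branch j g" using img by blast
    have hX: "h = fps_const (fps_nth h 0) + fps_X * fps_shift 1 h" by (intro fps_ext) auto
    have f1g: "f1 * g \<in> ?C" by (rule chart_closed(6)[OF f1(1) g(1)])
    have "eval_branch j (base (mconst (fps_nth h 0)) + f1 * g) = fps_to_fls (fps_const (fps_nth h 0) + fps_X * fps_shift 1 h)"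
      unfolding eval_branch_add eval_branch_mult_chart[OF A(2) f1(1) g(1)] f1(2)[symmetric] g(2)[symmetric] eval_const
      by (simp only: fps_to_fls_plus fls_times_fps_to_fls)
    then have "eval_branch j f = eval_branch j (base (mconst (fps_nth h 0)) + f1 * g)"
      using h unfolding hX[symmetric] by simp
    then have "x f = x (base (mconst (fps_nth h 0)) + f1 * g)" by (rule eq[OF f chart_closed(4)[OF const f1g]])
    also have "\<dots> = fps_nth h 0" using x_add[OF const f1g] x_mult[OF f1(1) g(1)] xf1 x_const by simp
    finally show ?thesis using h by simp
  qed
qed

text \<open>The monomial dual to a further ray of \<open>A\<close> would vanish on the orbit of the cone, although its
  value at the point is nonzero, its order on the branch being zero.\<close>

lemma exceptional_point_chart:
  fixes x :: "('k, 'm + 'r) laurent \<Rightarrow> 'k"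
  assumes A: "A \<in> K" "S j \<subseteq> A" "u j \<in> A"
    and x: "\<And>f. f \<in> chart (gen_cone A) \<Longrightarrow> x f = fls_nth (eval_branch j f) 0"
    and kill: "\<And>f. f \<in> orbit_closure_ideal (gen_cone A) (gen_cone A) \<Longrightarrow> x f = 0"
  shows "A = insert (u j) (S j)"
proof (rule ccontr)
  assume "A \<noteq> insert (u j) (S j)"
  then obtain a where a: "a \<in> A" "a \<notin> S j" "a \<noteq> u j" using A by blast
  obtain w where w: "w \<in> dual_monoid (gen_cone A)" "\<And>b. b \<in> A \<Longrightarrow> pair w b = (if b = a then 1 else 0)"
    using ray_coordinate[OF A(1) a(1)] by blast
  have wn: "w \<in> nonvanishing j" using w(2) A(2) a(2) by (auto simp: nonvanishing_iff_pair)
  have deg: "fls_subdegree (monomial_value j w) = 0" using subdegree_monomial_value[OF wn] w(2)[OF A(3)] a(3) by simp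
  have "fls_nth (monomial_value j w) 0 \<noteq> 0"
    using nth_fls_subdegree_nonzero[OF monomial_value_nonzero(1)[OF wn]] deg by simp
  then have "x (chi w) \<noteq> 0" using x[OF chi_in_chart[OF w(1)]] by (simp add: eval_branch_chi)
  moreover have "w \<notin> perp (gen_cone A)" using w(2)[OF a(1)] a(1) by (auto simp: mem_perp_gen_cone intro!: bexI[of _ a])
  ultimately show False using kill generators_in_orbit_closure_ideal(2)[OF A(1) w(1)] by blast
qed

text \<open>A derivation \<open>D\<close> tangent to the coordinate subspace is corrected by the multiple \<open>C\<close> of the velocity of
  the branch that agrees with \<open>D\<close> on the monomial \<open>w\<^sub>0\<close> dual to the ray \<open>u j\<close>.  The difference \<open>E\<close> kills \<open>w\<^sub>0\<close>,
  and every monomial that vanishes on the orbit either vanishes on the coordinate subspace or is a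
  multiple of \<open>w\<^sub>0\<close>.\<close>

lemma tangent_spaces_span:
  fixes x :: "('k, 'm + 'r) laurent \<Rightarrow> 'k"
  assumes A: "A = insert (u j) (S j)"
    and x: "\<And>f. f \<in> chart (gen_cone A) \<Longrightarrow> x f = fls_nth (eval_branch j f) 0"
    and kill: "\<And>f. f \<in> orbit_closure_ideal (gen_cone A) (gen_cone A) \<Longrightarrow> x f = 0"
  shows "{(\<lambda>f. D f + E f) | D E. D \<in> tangent_space (gen_cone A) x (branch_point j A) \<and>
      E \<in> tangent_space (gen_cone A) x (orbit_closure_ideal (gen_cone A) (gen_cone A))}
    = tangent_space (gen_cone A) x (orbit_closure_ideal (gen_cone A) (gen_cone (S j)))" (is "?L = ?R")
proof
  let ?C = "chart (gen_cone A) :: ('k, 'm + 'r) laurent set"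
  let ?OA = "orbit_closure_ideal (gen_cone A) (gen_cone A) :: ('k, 'm + 'r) laurent set"
  let ?OS = "orbit_closure_ideal (gen_cone A) (gen_cone (S j)) :: ('k, 'm + 'r) laurent set"
  have AK: "A \<in> K" and SA: "S j \<subseteq> A" and uA: "u j \<in> A" using A u_edge by auto
  have img: "\<exists>a. eval_branch j f = fps_to_fls a" if "f \<in> ?C" for f
    using that eval_branch_image_ray[OF AK SA uA] by blast
  have bp_ideal: "ideal (branch_point j A) (chart_ring (gen_cone A))"
    using branch_point_prime[OF SA] by (rule primeideal.axioms(1))
  have rel_bp: "chart_relations \<subseteq> branch_point j A"
    using branch_point_orbit(2)[OF AK SA] by (simp add: chart_points_def)
  have OS_bp: "?OS \<subseteq> branch_point j A"
    by (rule orbit_closure_ideal_least[OF bp_ideal rel_bp])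
      (use chi_in_chart in \<open>auto simp: branch_point_def eval_branch_chi monomial_value_def mem_perp_S\<close>)
  have OS_OA: "?OS \<subseteq> ?OA"
  proof (rule orbit_closure_ideal_least[OF ideal_orbit_closure_ideal[OF AK] generators_in_orbit_closure_ideal(1)[OF AK]])
    fix w assume w: "w \<in> dual_monoid (gen_cone A)" "w \<notin> perp (gen_cone (S j))"
    then have "w \<notin> perp (gen_cone A)" using SA by (auto simp: mem_perp_gen_cone)
    then show "chi w \<in> ?OA" by (rule generators_in_orbit_closure_ideal(2)[OF AK w(1)])
  qed
  show "?L \<subseteq> ?R"
  proof
    fix F assume "F \<in> ?L"
    then obtain D E where F: "F = (\<lambda>f. D f + E f)" and D: "D \<in> tangent_space (gen_cone A) x (branch_point j A)"
      and E: "E \<in> tangent_space (gen_cone A) x ?OA" by blast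
    have "\<forall>f\<in>?OS. F f = 0"
    proof
      fix f assume "f \<in> ?OS"
      then have "f \<in> branch_point j A" "f \<in> ?OA" using OS_bp OS_OA by blast+
      then show "F f = 0" using D E by (simp add: F tangent_space_def)
    qed
    then show "F \<in> ?R" using D E unfolding tangent_space_def F by (simp add: algebra_simps)
  qed
  show "?R \<subseteq> ?L"
  proof
    fix D assume D: "D \<in> ?R"
    have D_add: "D (f + g) = D f + D g" and D_mult: "D (f * g) = x f * D g + x g * D f" if "f \<in> ?C" "g \<in> ?C" for f g
      using D that by (auto simp: tangent_space_def)
    have D_const: "D (base (mconst c)) = 0" for c using D by (simp add: tangent_space_def)
    have D_out: "D f = 0" if "f \<notin> ?C" for f using D that by (simp add: tangent_space_def)
    have D_OS: "D f = 0" if "f \<in> ?OS" for f using D that by (simp add: tangent_space_def)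
    obtain w0 where w0: "w0 \<in> dual_monoid (gen_cone A)" "\<And>b. b \<in> A \<Longrightarrow> pair w0 b = (if b = u j then 1 else 0)"
      using ray_coordinate[OF AK uA] by blast
    have w0n: "w0 \<in> nonvanishing j" using w0(2) SA u_notin[of j] by (auto simp: nonvanishing_iff_pair)
    have deg: "fls_subdegree (monomial_value j w0) = 1" using subdegree_monomial_value[OF w0n] w0(2)[OF uA] by simp
    have c1: "fls_nth (monomial_value j w0) 1 \<noteq> 0"
      using nth_fls_subdegree_nonzero[OF monomial_value_nonzero(1)[OF w0n]] deg by simp
    have cw0: "chi w0 \<in> ?C" using chi_in_chart[OF w0(1)] .
    have x_w0: "x (chi w0) = 0" using x[OF cw0] deg by (simp add: eval_branch_chi)
    define k where "k = D (chi w0) / fls_nth (monomial_value j w0) 1"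
    define C where "C f = (if f \<in> ?C then k * fls_nth (eval_branch j f) 1 else 0)" for f
    have C: "C f = k * fls_nth (eval_branch j f) 1" if "f \<in> ?C" for f using that by (simp only: C_def if_True)
    have C_out: "C f = 0" if "f \<notin> ?C" for f using that by (simp only: C_def if_False)
    have C_add: "C (f + g) = C f + C g" if "f \<in> ?C" "g \<in> ?C" for f g
      using C[OF chart_closed(4)[OF that]] C[OF that(1)] C[OF that(2)] by (simp add: eval_branch_add algebra_simps)
    have C_mult: "C (f * g) = x f * C g + x g * C f" if fg: "f \<in> ?C" "g \<in> ?C" for f g
    proof -
      obtain a b where ab: "eval_branch j f = fps_to_fls a" "eval_branch j g = fps_to_fls b"
        using img[OF fg(1)] img[OF fg(2)] by blast
      have "eval_branch j (f * g) = fps_to_fls (a * b)"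
        using eval_branch_mult_chart[OF SA fg] ab by (simp add: fls_times_fps_to_fls)
      moreover have "fps_nth (a * b) 1 = fps_nth a 0 * fps_nth b 1 + fps_nth a 1 * fps_nth b 0"
        by (rule fps_mult_nth_1[unfolded One_nat_def[symmetric]])
      ultimately show ?thesis
        using C[OF chart_closed(6)[OF fg]] C[OF fg(1)] C[OF fg(2)] x[OF fg(1)] x[OF fg(2)] ab
        by (simp add: algebra_simps)
    qed
    have C_const: "C (base (mconst c)) = 0" for c
      using C[OF base_in_chart] by (simp add: eval_branch_base formal_arc.hom_const[OF arc])
    have C_bp: "C f = 0" if "f \<in> branch_point j A" for f
      using that C[of f] by (auto simp: branch_point_def)
    have C_tan: "C \<in> tangent_space (gen_cone A) x (branch_point j A)"
      unfolding tangent_space_def chart_ring_simps using C_add C_mult C_const C_out C_bp by blast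
    define E where "E f = D f - C f" for f
    have E_add: "E (f + g) = E f + E g" and E_mult: "E (f * g) = x f * E g + x g * E f" if "f \<in> ?C" "g \<in> ?C" for f g
      using D_add[OF that] D_mult[OF that] C_add[OF that] C_mult[OF that] by (simp_all add: E_def algebra_simps)
    have E_w0: "E (chi w0) = 0"
      using C[OF cw0] c1 by (simp add: E_def k_def eval_branch_chi)
    let ?J = "{f \<in> ?C. x f = 0 \<and> E f = 0}"
    have x_mult: "x (f * g) = x f * x g" and x_add: "x (f + g) = x f + x g" if fg: "f \<in> ?C" "g \<in> ?C" for f g
    proof -
      obtain a b where ab: "eval_branch j f = fps_to_fls a" "eval_branch j g = fps_to_fls b"
        using img[OF fg(1)] img[OF fg(2)] by blast
      have "eval_branch j (f * g) = fps_to_fls (a * b)"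
        using eval_branch_mult_chart[OF SA fg] ab by (simp add: fls_times_fps_to_fls)
      then show "x (f * g) = x f * x g"
        using x[OF chart_closed(6)[OF fg]] x[OF fg(1)] x[OF fg(2)] ab by simp
      show "x (f + g) = x f + x g"
        using x[OF chart_closed(4)[OF fg]] x[OF fg(1)] x[OF fg(2)] by (simp add: eval_branch_add)
    qed
    have J_ideal: "ideal ?J (chart_ring (gen_cone A))"
    proof (rule chart_idealI)
      have "E (0 + 0) = E 0 + E 0" by (rule E_add[OF chart_closed(2,2)])
      then have "E 0 + 0 = E 0 + E 0" by (simp only: add_0_right)
      then have "E 0 = 0" unfolding add_left_cancel by (rule sym)
      moreover have "x 0 = 0" using x[OF chart_closed(2)] by (simp add: eval_branch_zero)
      ultimately show "0 \<in> ?J" using chart_closed(2)[of "gen_cone A"] by simp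
      fix f g assume f: "f \<in> ?J"
      then have fC: "f \<in> ?C" "x f = 0" "E f = 0" by auto
      show "f + g \<in> ?J" if "g \<in> ?J"
      proof -
        have gC: "g \<in> ?C" "x g = 0" "E g = 0" using that by auto
        show ?thesis using chart_closed(4)[OF fC(1) gC(1)] x_add[OF fC(1) gC(1)] E_add[OF fC(1) gC(1)] fC gC by simp
      qed
      show "g * f \<in> ?J" if g: "g \<in> ?C"
        using chart_closed(6)[OF g fC(1)] x_mult[OF g fC(1)] E_mult[OF g fC(1)] fC by simp
    qed blast
    have "?OA \<subseteq> ?J"
    proof (rule orbit_closure_ideal_least[OF J_ideal])
      show "chart_relations \<subseteq> ?J"
      proof
        fix f :: "('k, 'm + 'r) laurent" assume f: "f \<in> chart_relations"
        have "f \<in> ?OS" "f \<in> ?OA" using f generators_in_orbit_closure_ideal(1)[OF AK] by blast+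
        moreover have "f \<in> branch_point j A" using f rel_bp by blast
        ultimately show "f \<in> ?J"
          using D_OS C_bp kill relations_in_chart[OF AK] f by (auto simp: E_def)
      qed
    next
      fix w assume w: "w \<in> dual_monoid (gen_cone A)" "w \<notin> perp (gen_cone A)"
      have cw: "chi w \<in> ?C" using chi_in_chart[OF w(1)] .
      have "x (chi w) = 0" using kill generators_in_orbit_closure_ideal(2)[OF AK w] by blast
      moreover have "E (chi w) = 0"
      proof (cases "w \<in> nonvanishing j")
        case False
        then have "chi w \<in> ?OS" using generators_in_orbit_closure_ideal(2)[OF AK w(1)] by (simp add: mem_perp_S)
        then show ?thesis using D_OS C_bp OS_bp by (auto simp: E_def)
      next
        case True
        then have S0: "\<And>a. a \<in> S j \<Longrightarrow> pair w a = 0" by (simp add: nonvanishing_iff_pair)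
        then have "pair w (u j) \<noteq> 0" using w(2) A by (auto simp: mem_perp_gen_cone)
        then have pos: "1 \<le> pair w (u j)" using w(1) uA by (force simp: mem_dual_monoid_gen_cone)
        have "w - w0 \<in> dual_monoid (gen_cone A)"
          unfolding mem_dual_monoid_gen_cone
        proof
          fix a assume a: "a \<in> A"
          show "0 \<le> pair (w - w0) a"
            using a pos S0[of a] w0(2)[OF a] A u_notin[of j] by (auto simp: pair_diff_left)
        qed
        then have c: "chi (w - w0) \<in> ?C" by (rule chi_in_chart)
        have "chi w = chi w0 * (chi (w - w0) :: ('k, 'm + 'r) laurent)" by (simp flip: chi_add)
        then show ?thesis using E_mult[OF cw0 c] x_w0 E_w0 by simp
      qed
      ultimately show "chi w \<in> ?J" using cw by blast
    qed
    then have E_OA: "\<forall>f\<in>?OA. E f = 0" by blast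
    have "E \<in> tangent_space (gen_cone A) x ?OA"
      unfolding tangent_space_def chart_ring_simps using E_add E_mult D_const C_const D_out C_out E_OA
      by (simp add: E_def)
    moreover have "D = (\<lambda>f. C f + E f)" by (simp add: E_def)
    ultimately show "D \<in> ?L" using C_tan by blast
  qed
qed

proposition transversal_branch: "transversal_branch fan_of_K {f. \<theta> j f = 0}"
  unfolding transversal_branch_def coord_cone_branch
proof (intro ballI allI impI)
  fix \<tau> x
  assume \<tau>: "\<tau> \<in> exceptional_cones fan_of_K (gen_cone (S j))"
    and x: "rational_point \<tau> x \<and> (\<forall>f\<in>strict_transform fan_of_K \<tau> {f. \<theta> j f = 0} \<union> orbit_closure_ideal \<tau> \<tau>. x f = 0)"
  obtain A where A: "A \<in> K" "\<tau> = gen_cone A" "cone_face (gen_cone (S j)) (gen_cone A)"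
    using \<tau> by (auto simp: exceptional_cones_def)
  have SA: "S j \<subseteq> A" using A(3) cone_face_gen_cone_iff[OF A(1) S_in_K] by simp
  have st: "strict_transform fan_of_K \<tau> {f. \<theta> j f = 0} = branch_point j A"
    using strict_transform_branches[OF A(1), of "{j}"] SA unfolding A(2) branch_point_def by simp
  have rp: "rational_point (gen_cone A) x" and k1: "\<And>f. f \<in> branch_point j A \<Longrightarrow> x f = 0"
    and k2: "\<And>f. f \<in> orbit_closure_ideal (gen_cone A) (gen_cone A) \<Longrightarrow> x f = 0"
    using x unfolding st unfolding A(2) by auto
  note pt = rational_point_on_strict_transform[OF A(1) SA rp k1]
  have "A = insert (u j) (S j)" by (rule exceptional_point_chart[OF A(1) SA pt(1) pt(2) k2])
  then show "{(\<lambda>f. D f + E f) | D E. D \<in> tangent_space \<tau> x (strict_transform fan_of_K \<tau> {f. \<theta> j f = 0}) \<and>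
      E \<in> tangent_space \<tau> x (orbit_closure_ideal \<tau> \<tau>)} = tangent_space \<tau> x (orbit_closure_ideal \<tau> (gen_cone (S j)))"
    unfolding st unfolding A(2) by (rule tangent_spaces_span[OF _ pt(2) k2])
qed

lemma branch_not_in_discriminant: "{f. \<theta> j f = 0} \<notin> discriminant_locus fan_of_K"
proof
  assume "{f. \<theta> j f = 0} \<in> discriminant_locus fan_of_K"
  then obtain \<tau> where \<tau>: "\<tau> \<in> orthant_fan" "\<tau> \<notin> fan_of_K" "{f. \<theta> j f = 0} \<in> base_orbit \<tau>"
    by (auto simp: discriminant_locus_def)
  have "axis i 1 \<in> \<tau> \<longleftrightarrow> i \<in> vanishing j" for i
    using \<tau>(3) mvar_zero_iff[of j i] by (auto simp: base_orbit_def)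
  then have "{axis i 1 | i. axis i 1 \<in> \<tau>} = S j" by (auto simp: S_def)
  then have "\<tau> = gen_cone (S j)" using orthant_face_eq[OF \<tau>(1)] by simp
  then show False using \<tau>(2) S_in_K by blast
qed

end

section \<open>The branches of the curve\<close>

lemma generate_integer_group_combination:
  fixes g :: "'s::finite \<Rightarrow> int"
  assumes "x \<in> generate integer_group (range g)"
  shows "\<exists>n. x = (\<Sum>s\<in>UNIV. n s * g s)"
  using assms
proof (induction rule: generate.induct)
  case one
  show ?case by (intro exI[of _ "\<lambda>_. 0"]) simp
next
  case (incl h)
  then obtain s where "h = g s" by blast
  then show ?case by (intro exI[of _ "\<lambda>t. if t = s then 1 else 0"]) (simp add: if_distrib[of "\<lambda>x. x * _"] cong: if_cong)
next
  case (inv h)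
  then obtain s where "h = g s" by blast
  then show ?case by (intro exI[of _ "\<lambda>t. if t = s then - 1 else 0"]) (simp add: if_distrib[of "\<lambda>x. x * _"] cong: if_cong)
next
  case (eng h1 h2)
  then obtain n1 n2 where "h1 = (\<Sum>s\<in>UNIV. n1 s * g s)" "h2 = (\<Sum>s\<in>UNIV. n2 s * g s)" by blast
  then show ?case by (intro exI[of _ "\<lambda>s. n1 s + n2 s"]) (simp add: algebra_simps sum.distrib)
qed

lemma formal_arc_ring_hom:
  assumes "\<theta> \<in> ring_hom TR TR" "\<And>c. \<theta> (mconst c) = fps_const c"
  shows "formal_arc \<theta>"
  using assms by unfold_locales (auto simp: ring_hom_def)

lemma primeideal_arc_kernel:
  assumes "formal_arc \<theta>"
  shows "primeideal {f. \<theta> f = 0} (TR :: ('k::field, 'p::finite) mfps ring)"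
proof -
  interpret formal_arc \<theta> by fact
  interpret R: cring "TR :: ('k, 'p) mfps ring" by (rule cring_from_type_algebra)
  have inv: "\<ominus>\<^bsub>TR\<^esub> f = - f" for f :: "('k, 'p) mfps"
    by (rule R.minus_equality) simp_all
  show ?thesis
  proof (rule primeidealI)
    show "ideal {f. \<theta> f = 0} TR"
    proof (rule idealI[OF R.ring_axioms])
      show "subgroup {f. \<theta> f = 0} (add_monoid TR)"
      proof (rule subgroup.intro)
        show "inv\<^bsub>add_monoid TR\<^esub> f \<in> {f. \<theta> f = 0}" if "f \<in> {f. \<theta> f = 0}" for f
          unfolding inv[unfolded a_inv_def] using that by (simp add: hom_uminus)
      qed (simp_all add: hom_add hom_0)
    qed (simp_all add: hom_mult)
    show "carrier TR \<noteq> {f. \<theta> f = 0}"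
    proof
      assume "carrier TR = {f. \<theta> f = 0}"
      then have "1 \<in> {f. \<theta> f = 0}" by (metis TR_simps(1) UNIV_I)
      then show False by (simp add: hom_1)
    qed
  qed (use R.is_cring in \<open>auto simp: hom_mult\<close>)
qed

lemma (in branch_family) minimal_primes_over_branches:
  assumes "P \<in> minimal_primes_over TR (\<Inter>j. {f. \<theta> j f = 0})"
  shows "\<exists>j. P = {f. \<theta> j f = 0}"
proof -
  have P: "primeideal P TR" "(\<Inter>j. {f. \<theta> j f = 0}) \<subseteq> P"
    and min: "\<And>Q. primeideal Q TR \<Longrightarrow> (\<Inter>j. {f. \<theta> j f = 0}) \<subseteq> Q \<Longrightarrow> \<not> Q \<subset> P"
    using assms by (auto simp: minimal_primes_over_def)
  interpret P: primeideal P "TR :: ('k, 'm + 'r) mfps ring" by (rule P(1))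
  have "\<exists>j\<in>UNIV. {f. \<theta> j f = 0} \<subseteq> P"
  proof (rule prime_contains_some)
    show "f \<in> P \<or> g \<in> P" if "f * g \<in> P" for f g using P.I_prime[of f g] that by simp
    show "1 \<notin> P" using P.one_imp_carrier P.I_notcarr by auto
  qed (use P(2) in \<open>auto simp: formal_arc.hom_mult[OF arc]\<close>)
  then obtain j where "{f. \<theta> j f = 0} \<subseteq> P" by blast
  moreover have "\<not> {f. \<theta> j f = 0} \<subset> P" by (rule min[OF primeideal_arc_kernel[OF arc]]) blast
  ultimately show ?thesis by blast
qed

theorem theorem1p22:
  fixes R :: "'o ring"
    and \<iota> :: "'k::alg_closed_field \<Rightarrow> 'o"
    and \<phi> :: "('k, 'n::finite) mfps \<Rightarrow> 'o"
    and x :: "'n \<Rightarrow> 'o"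
    and P :: "'r::finite \<Rightarrow> 'o set"
    and \<nu> :: "'r \<Rightarrow> 'o set \<Rightarrow> 'k fps"
    and y :: "'m::finite + 'r \<Rightarrow> ('k, 'n) mfps"
    and \<psi> :: "('k, 'm + 'r) mfps \<Rightarrow> ('k, 'n) mfps"
  assumes curve: "formal_curve \<iota> R" "reduced_ring R"
    and branches: "bij_betw P UNIV (minimal_primes_over R {\<zero>\<^bsub>R\<^esub>})"
    and embedding: "range x \<subseteq> carrier R" "genideal R (range x) = max_ideal R"
      "alg_hom mconst TR \<iota> R \<phi>" "range \<phi> = carrier R" "\<And>i. \<phi> (mvar i) = x i"
    and normalizations: "\<And>j. is_normalization (R Quot P j) (\<nu> j)"
      "\<And>j. alg_hom (\<lambda>c. P j +>\<^bsub>R\<^esub> \<iota> c) (R Quot P j) fps_const TR (\<nu> j)"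
    and y_in_max_ideal: "\<And>i. y i \<in> max_ideal TR"
    and cond1: "genideal TR (range (\<lambda>s. y (Inl s))) = max_ideal TR"
    and cond2: "\<And>s j. y (Inl s) \<notin> \<phi> -` P j"
    and cond3: "\<And>j. generate integer_group
      (range (\<lambda>s. int (subdegree (\<nu> j (P j +>\<^bsub>R\<^esub> \<phi> (y (Inl s))))))) = carrier integer_group"
    and cond4: "\<And>j. y (Inr j) \<in> (\<Inter>i\<in>UNIV - {j}. \<phi> -` P i)" "\<And>j. y (Inr j) \<notin> \<phi> -` P j"
    and new_embedding: "alg_hom mconst TR mconst TR \<psi>" "\<And>i. \<psi> (mvar i) = y i"
  shows "\<exists>\<Sigma>. toric_embedded_resolution \<Sigma> (a_kernel TR R (\<phi> \<circ> \<psi>))"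
proof -
  interpret R: cring R using curve(2) by (simp add: reduced_ring_def)
  have minimal: "P j \<in> minimal_primes_over R {\<zero>\<^bsub>R\<^esub>}" for j
    using branches by (auto simp: bij_betw_def)
  have prime: "primeideal (P j) R" for j using minimal[of j] by (simp add: minimal_primes_over_def)
  define \<rho> where "\<rho> j f = \<nu> j (P j +>\<^bsub>R\<^esub> \<phi> f)" for j f
  define \<theta> where "\<theta> j f = \<rho> j (\<psi> f)" for j f
  have \<phi>: "\<phi> \<in> ring_hom TR R" "\<And>c. \<phi> (mconst c) = \<iota> c" using embedding(3) by (auto simp: alg_hom_def)
  have \<psi>: "\<psi> \<in> ring_hom TR TR" "\<And>c. \<psi> (mconst c) = mconst c" using new_embedding(1) by (auto simp: alg_hom_def)
  have \<nu>: "\<nu> j \<in> ring_hom (R Quot P j) TR" "inj_on (\<nu> j) (carrier (R Quot P j))" for j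
    using normalizations(1)[of j] by (auto simp: is_normalization_def)
  have \<nu>_const: "\<nu> j (P j +>\<^bsub>R\<^esub> \<iota> c) = fps_const c" for j c
    using normalizations(2)[of j] by (auto simp: alg_hom_def)
  have \<rho>_hom: "\<rho> j \<in> ring_hom TR TR" for j
  proof -
    interpret primeideal "P j" R by (rule prime)
    have "\<rho> j = \<nu> j \<circ> ((+>\<^bsub>R\<^esub>) (P j) \<circ> \<phi>)" by (auto simp: \<rho>_def)
    then show ?thesis using ring_hom_trans[OF ring_hom_trans[OF \<phi>(1) rcos_ring_hom] \<nu>(1)] by simp
  qed
  have \<rho>_arc: "formal_arc (\<rho> j)" for j
    by (rule formal_arc_ring_hom[OF \<rho>_hom]) (simp add: \<rho>_def \<phi>(2) \<nu>_const)
  have \<theta>_arc: "formal_arc (\<theta> j)" for j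
  proof (rule formal_arc_ring_hom)
    have "\<theta> j = \<rho> j \<circ> \<psi>" by (auto simp: \<theta>_def)
    then show "\<theta> j \<in> ring_hom TR TR" using ring_hom_trans[OF \<psi>(1) \<rho>_hom] by simp
    show "\<theta> j (mconst c) = fps_const c" for c by (simp add: \<theta>_def \<psi>(2) \<rho>_def \<phi>(2) \<nu>_const)
  qed
  have \<phi>_carrier: "\<phi> f \<in> carrier R" for f using \<phi>(1) by (auto simp: ring_hom_def)
  have \<rho>_zero: "\<rho> j f = 0 \<longleftrightarrow> \<phi> f \<in> P j" for j f
  proof -
    interpret P: primeideal "P j" R by (rule prime)
    have z: "\<nu> j (P j) = 0"
      using ring_hom_zero[OF \<nu>(1) P.quotient_is_ring ring_from_type_algebra] by (simp add: FactRing_def)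
    have mem: "P j +>\<^bsub>R\<^esub> \<phi> f \<in> carrier (R Quot P j)" "P j \<in> carrier (R Quot P j)"
      using ring_hom_closed[OF P.rcos_ring_hom \<phi>_carrier] ring.ring_simprules(2)[OF P.quotient_is_ring]
      by (simp_all add: FactRing_def)
    have "\<rho> j f = 0 \<longleftrightarrow> \<nu> j (P j +>\<^bsub>R\<^esub> \<phi> f) = \<nu> j (P j)" by (simp add: \<rho>_def z)
    also have "\<dots> \<longleftrightarrow> P j +>\<^bsub>R\<^esub> \<phi> f = P j" using inj_on_eq_iff[OF \<nu>(2) mem] .
    also have "\<dots> \<longleftrightarrow> \<phi> f \<in> P j"
      using P.a_rcos_const P.a_rcos_self[OF \<phi>_carrier] by metis
    finally show ?thesis .
  qed
  have \<theta>_zero: "\<theta> j f = 0 \<longleftrightarrow> \<phi> (\<psi> f) \<in> P j" for j f by (simp add: \<theta>_def \<rho>_zero)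
  have \<theta>_var: "\<theta> j (mvar i) = \<rho> j (y i)" for i j by (simp add: \<theta>_def new_embedding(2))
  interpret branch_family \<theta>
  proof (rule branch_family.intro)
    show "formal_arc (\<theta> j)" for j by (rule \<theta>_arc)
    show "fps_nth (\<theta> j (mvar i)) 0 = 0" for i j
      unfolding \<theta>_var using y_in_max_ideal[of i]
      by (intro formal_arc.local_hom[OF \<rho>_arc]) (simp add: max_ideal_mfps)
    show "\<theta> j (mvar (Inl s)) \<noteq> 0" for j s using cond2[of s j] by (simp add: \<theta>_var \<rho>_zero)
    show "\<theta> j (mvar (Inr l)) = 0 \<longleftrightarrow> l \<noteq> j" for l j
      using cond4(1)[of l] cond4(2)[of l] by (auto simp: \<theta>_var \<rho>_zero)
    show "\<exists>n. (\<Sum>s\<in>UNIV. n s * int (subdegree (\<theta> j (mvar (Inl s))))) = 1" for j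
    proof -
      have "(1::int) \<in> generate integer_group (range (\<lambda>s. int (subdegree (\<theta> j (mvar (Inl s))))))"
        using cond3[of j] by (simp add: \<theta>_var \<rho>_def)
      from generate_integer_group_combination[OF this] show ?thesis by metis
    qed
  qed
  obtain K u where K: "regular_complex K"
    and u: "\<And>j. u j \<notin> S j \<and> insert (u j) (S j) \<in> K \<and> (\<forall>i. i \<notin> vanishing j \<longrightarrow> u j $ i = v j $ i)"
    using exists_adapted_complex by blast
  interpret K: regular_complex K by (rule K)
  interpret adapted_complex \<theta> K u by unfold_locales (use u in auto)
  have I: "a_kernel TR R (\<phi> \<circ> \<psi>) = (\<Inter>j. {f. \<theta> j f = 0})"
  proof -
    have "\<phi> (\<psi> f) = \<zero>\<^bsub>R\<^esub> \<longleftrightarrow> (\<forall>j. \<phi> (\<psi> f) \<in> P j)" for f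
    proof
      assume "\<phi> (\<psi> f) = \<zero>\<^bsub>R\<^esub>"
      then show "\<forall>j. \<phi> (\<psi> f) \<in> P j" using minimal by (simp add: minimal_primes_over_def)
    next
      assume all: "\<forall>j. \<phi> (\<psi> f) \<in> P j"
      show "\<phi> (\<psi> f) = \<zero>\<^bsub>R\<^esub>"
      proof (rule reduced_ring_Inter_minimal_primes[OF curve(2) \<phi>_carrier])
        fix Q assume "Q \<in> minimal_primes_over R {\<zero>\<^bsub>R\<^esub>}"
        then obtain j where "Q = P j" using branches by (auto simp: bij_betw_def)
        then show "\<phi> (\<psi> f) \<in> Q" using all by simp
      qed
    qed
    then show ?thesis by (auto simp: a_kernel_def' \<theta>_zero)
  qed
  have "toric_embedded_resolution (gen_cone ` K) (\<Inter>j. {f. \<theta> j f = 0})"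
    unfolding toric_embedded_resolution_def
  proof (intro conjI ballI notI)
    show "regular_subdivision (gen_cone ` K)" by (rule K.regular_subdivision_gen_cone)
    fix \<sigma> assume "\<sigma> \<in> gen_cone ` K"
    then show "regular_ring (chart_ring \<sigma> Quot strict_transform (gen_cone ` K) \<sigma> (\<Inter>j. {f. \<theta> j f = 0}))"
      using regular_strict_transform by blast
  next
    fix Q assume Q: "Q \<in> minimal_primes_over TR (\<Inter>j. {f. \<theta> j f = 0})"
    then obtain j where j: "Q = {f. \<theta> j f = 0}" using minimal_primes_over_branches by blast
    show "transversal_branch (gen_cone ` K) Q" unfolding j by (rule transversal_branch)
    assume "{q. primeideal q TR \<and> Q \<subseteq> q} \<subseteq> discriminant_locus (gen_cone ` K)"
    then have "Q \<in> discriminant_locus (gen_cone ` K)"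
      using Q by (auto simp: minimal_primes_over_def)
    then show False unfolding j using branch_not_in_discriminant by blast
  qed
  then show ?thesis unfolding I by blast
qed

end
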